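(* Let $R$ be a ring with right socle $S_r$. The following are equivalent: (1) $R$ is $QF$ (quasi-Frobenius). (2) $R$ is right (or left) perfect, and right and left small injective. (3) $R$ is a semilocal and right small injective ring with ACC (or DCC) on right annihilators. (4) $R$ is a right small injective ring with ACC on right annihilators in which $S_r$ is an essential right ideal of $R$. (5) $R$ is a semiregular and right small injective ring with ACC on right annihilators. (Each alternative in parentheses gives a condition which is also equivalent to the others.)
   Context: Rings are associative with identity. A right ideal $I$ of $R$ is small if $I+K\neq R$ for every proper right ideal $K$ of $R$; small left ideals are defined analogously. $R$ is right small injective if every right $R$-homomorphism from a small right ideal of $R$ to $R_R$ extends to an $R$-homomorphism $R_R\to R_R$; left small injective is defined analogously. $R$ is $QF$ if it is left or right artinian and left or right self-injective (all four combinations are equivalent). A right annihilator is a right ideal of the form $\{r\in R: xr=0 \text{ for all } x\in X\}$ for a subset $X\subseteq R$. With $J$ the Jacobson radical, $R$ is semilocal if $R/J$ is semisimple artinian, and semiregular if $R/J$ is von Neumann regular and idempotents lift modulo $J$. *)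

theory Defs
  imports "HOL-Algebra.Module" "HOL-Algebra.QuotRing"
begin

text \<open>
  Rings are the (not necessarily commutative, unital) rings of HOL-Algebra; the zero ring is
  allowed. Every left-handed notion is the corresponding right-handed notion of the opposite ring.
\<close>

definition opp_ring :: "('a, 'r) ring_scheme \<Rightarrow> ('a, 'r) ring_scheme" where
  "opp_ring R = R\<lparr>mult := (\<lambda>x y. y \<otimes>\<^bsub>R\<^esub> x)\<rparr>"

lemma opp_ring_simps [simp]:
  "carrier (opp_ring R) = carrier R"
  "x \<otimes>\<^bsub>opp_ring R\<^esub> y = y \<otimes>\<^bsub>R\<^esub> x"
  "\<one>\<^bsub>opp_ring R\<^esub> = \<one>\<^bsub>R\<^esub>"
  "\<zero>\<^bsub>opp_ring R\<^esub> = \<zero>\<^bsub>R\<^esub>"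
  "x \<oplus>\<^bsub>opp_ring R\<^esub> y = x \<oplus>\<^bsub>R\<^esub> y"
  by (simp_all add: opp_ring_def)

lemma ring_opp_ring:
  assumes "ring R" shows "ring (opp_ring R)"
proof -
  interpret ring R by fact
  show ?thesis
  proof (rule ringI)
    show "abelian_group (opp_ring R)"
      by (rule abelian_groupI) (auto intro: a_assoc a_comm l_neg)
    show "monoid (opp_ring R)"
      by (rule monoidI) (auto simp: m_assoc)
  qed (auto simp: l_distr r_distr)
qed

lemma opp_ring_opp_ring: "opp_ring (opp_ring R) = R"
  by (simp add: opp_ring_def)


section \<open>Right ideals and chain conditions\<close>

definition right_ideal :: "('a, 'r) ring_scheme \<Rightarrow> 'a set \<Rightarrow> bool" where
  "right_ideal R I \<longleftrightarrow>
     additive_subgroup I R \<and> (\<forall>x\<in>I. \<forall>r\<in>carrier R. x \<otimes>\<^bsub>R\<^esub> r \<in> I)"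

definition right_annihilator :: "('a, 'r) ring_scheme \<Rightarrow> 'a set \<Rightarrow> bool" where
  "right_annihilator R A \<longleftrightarrow>
     (\<exists>X \<subseteq> carrier R. A = {r \<in> carrier R. \<forall>x\<in>X. x \<otimes>\<^bsub>R\<^esub> r = \<zero>\<^bsub>R\<^esub>})"

definition ACC :: "('a set \<Rightarrow> bool) \<Rightarrow> bool" where
  "ACC P \<longleftrightarrow> (\<forall>A :: nat \<Rightarrow> 'a set.
     (\<forall>n. P (A n) \<and> A n \<subseteq> A (Suc n)) \<longrightarrow> (\<exists>N. \<forall>n\<ge>N. A n = A N))"

definition DCC :: "('a set \<Rightarrow> bool) \<Rightarrow> bool" where
  "DCC P \<longleftrightarrow> (\<forall>A :: nat \<Rightarrow> 'a set.
     (\<forall>n. P (A n) \<and> A (Suc n) \<subseteq> A n) \<longrightarrow> (\<exists>N. \<forall>n\<ge>N. A n = A N))"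

definition right_artinian :: "('a, 'r) ring_scheme \<Rightarrow> bool" where
  "right_artinian R \<longleftrightarrow> DCC (right_ideal R)"

definition left_artinian :: "('a, 'r) ring_scheme \<Rightarrow> bool" where
  "left_artinian R \<longleftrightarrow> right_artinian (opp_ring R)"

definition small_right_ideal :: "('a, 'r) ring_scheme \<Rightarrow> 'a set \<Rightarrow> bool" where
  "small_right_ideal R I \<longleftrightarrow> right_ideal R I \<and>
     (\<forall>K. right_ideal R K \<and> K \<noteq> carrier R \<longrightarrow> I <+>\<^bsub>R\<^esub> K \<noteq> carrier R)"

definition essential_right_ideal :: "('a, 'r) ring_scheme \<Rightarrow> 'a set \<Rightarrow> bool" where
  "essential_right_ideal R I \<longleftrightarrow> right_ideal R I \<and>
     (\<forall>K. right_ideal R K \<and> K \<noteq> {\<zero>\<^bsub>R\<^esub>} \<longrightarrow> I \<inter> K \<noteq> {\<zero>\<^bsub>R\<^esub>})"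

definition minimal_right_ideal :: "('a, 'r) ring_scheme \<Rightarrow> 'a set \<Rightarrow> bool" where
  "minimal_right_ideal R I \<longleftrightarrow> right_ideal R I \<and> I \<noteq> {\<zero>\<^bsub>R\<^esub>} \<and>
     (\<forall>K. right_ideal R K \<and> K \<subseteq> I \<longrightarrow> K = {\<zero>\<^bsub>R\<^esub>} \<or> K = I)"

definition maximal_right_ideal :: "('a, 'r) ring_scheme \<Rightarrow> 'a set \<Rightarrow> bool" where
  "maximal_right_ideal R I \<longleftrightarrow> right_ideal R I \<and> I \<noteq> carrier R \<and>
     (\<forall>K. right_ideal R K \<and> I \<subseteq> K \<longrightarrow> K = I \<or> K = carrier R)"

text \<open>
  The sum of all minimal right ideals, written as the least right ideal containing each of them.
\<close>

definition right_socle :: "('a, 'r) ring_scheme \<Rightarrow> 'a set" where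
  "right_socle R =
     \<Inter>{I. right_ideal R I \<and> (\<forall>S. minimal_right_ideal R S \<longrightarrow> S \<subseteq> I)}"

text \<open>
  Intersecting with the carrier only matters for the zero ring, which has no maximal right ideal.
\<close>

definition jacobson_radical :: "('a, 'r) ring_scheme \<Rightarrow> 'a set" where
  "jacobson_radical R = carrier R \<inter> \<Inter>{M. maximal_right_ideal R M}"


section \<open>Right modules and injectivity\<close>

text \<open>
  A right module is stored in the library record of left modules: the field \<open>smult\<close> takes
  the scalar first, so that the right action \<open>m \<cdot> a\<close> is \<open>a \<odot> m\<close>.
  The ring part of the record contributes only its carrier and its additive group.
\<close>

definition right_module ::
    "('a, 'r) ring_scheme \<Rightarrow> ('a, 'm) module \<Rightarrow> bool" where
  "right_module R M \<longleftrightarrow> abelian_group M \<and>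
     (\<forall>a\<in>carrier R. \<forall>m\<in>carrier M. a \<odot>\<^bsub>M\<^esub> m \<in> carrier M) \<and>
     (\<forall>a\<in>carrier R. \<forall>b\<in>carrier R. \<forall>m\<in>carrier M.
        (a \<oplus>\<^bsub>R\<^esub> b) \<odot>\<^bsub>M\<^esub> m = a \<odot>\<^bsub>M\<^esub> m \<oplus>\<^bsub>M\<^esub> b \<odot>\<^bsub>M\<^esub> m) \<and>
     (\<forall>a\<in>carrier R. \<forall>m\<in>carrier M. \<forall>n\<in>carrier M.
        a \<odot>\<^bsub>M\<^esub> (m \<oplus>\<^bsub>M\<^esub> n) = a \<odot>\<^bsub>M\<^esub> m \<oplus>\<^bsub>M\<^esub> a \<odot>\<^bsub>M\<^esub> n) \<and>
     (\<forall>a\<in>carrier R. \<forall>b\<in>carrier R. \<forall>m\<in>carrier M.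
        (a \<otimes>\<^bsub>R\<^esub> b) \<odot>\<^bsub>M\<^esub> m = b \<odot>\<^bsub>M\<^esub> (a \<odot>\<^bsub>M\<^esub> m)) \<and>
     (\<forall>m\<in>carrier M. \<one>\<^bsub>R\<^esub> \<odot>\<^bsub>M\<^esub> m = m)"

definition right_module_hom ::
    "('a, 'r) ring_scheme \<Rightarrow> ('a, 'm) module \<Rightarrow> ('a, 'n) module \<Rightarrow> ('m \<Rightarrow> 'n) set" where
  "right_module_hom R M N = {h \<in> carrier M \<rightarrow> carrier N.
     (\<forall>x\<in>carrier M. \<forall>y\<in>carrier M. h (x \<oplus>\<^bsub>M\<^esub> y) = h x \<oplus>\<^bsub>N\<^esub> h y) \<and>
     (\<forall>a\<in>carrier R. \<forall>x\<in>carrier M. h (a \<odot>\<^bsub>M\<^esub> x) = a \<odot>\<^bsub>N\<^esub> h x)}"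

text \<open>
  The right module \<open>I\<^sub>R\<close> for a right ideal \<open>I\<close>; in particular
  \<open>R\<^sub>R\<close> for \<open>I = carrier R\<close>.
\<close>

definition right_ideal_module :: "('a, 'r) ring_scheme \<Rightarrow> 'a set \<Rightarrow> ('a, 'a) module" where
  "right_ideal_module R I =
     \<lparr>carrier = I, mult = mult R, one = one R, zero = zero R, add = add R,
      smult = (\<lambda>a x. x \<otimes>\<^bsub>R\<^esub> a)\<rparr>"

abbreviation right_regular_module :: "('a, 'r) ring_scheme \<Rightarrow> ('a, 'a) module" where
  "right_regular_module R \<equiv> right_ideal_module R (carrier R)"

lemma right_module_right_ideal_module:
  assumes "ring R" and "right_ideal R I"
  shows "right_module R (right_ideal_module R I)"
proof -
  interpret ring R by fact
  interpret I: additive_subgroup I R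
    using assms(2) by (simp add: right_ideal_def)
  have "abelian_group (right_ideal_module R I)"
  proof (rule abelian_groupI)
    fix x assume "x \<in> carrier (right_ideal_module R I)"
    then have x: "x \<in> I" by (simp add: right_ideal_module_def)
    then have "\<ominus>\<^bsub>R\<^esub> x \<in> I" "\<ominus>\<^bsub>R\<^esub> x \<oplus>\<^bsub>R\<^esub> x = \<zero>\<^bsub>R\<^esub>" by (auto intro: l_neg)
    then show "\<exists>y\<in>carrier (right_ideal_module R I).
        y \<oplus>\<^bsub>right_ideal_module R I\<^esub> x = \<zero>\<^bsub>right_ideal_module R I\<^esub>"
      by (auto simp: right_ideal_module_def)
  qed (auto simp: right_ideal_module_def a_ac)
  then show ?thesis
    using assms(2)
    by (auto simp: right_module_def right_ideal_module_def right_ideal_def l_distr r_distr m_assoc)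
qed

text \<open>
  Injectivity quantifies over all monomorphisms of right modules. A definition in HOL cannot
  quantify over types, so the carrier type \<open>'m\<close> of the test modules is a parameter.
  Every type \<open>'b\<close> and the type \<open>'a\<close> of the ring embed into
  \<open>'a + 'b\<close>, so a statement for \<open>'m = 'a + 'b\<close> with \<open>'b\<close> arbitrary
  reaches modules of any size. In a type too small to hold the ring the condition could be vacuous.
\<close>

definition injective_right_module ::
    "'m itself \<Rightarrow> ('a, 'r) ring_scheme \<Rightarrow> ('a, 'q) module \<Rightarrow> bool" where
  "injective_right_module T R Q \<longleftrightarrow> right_module R Q \<and>
     (\<forall>(A :: ('a, 'm) module) (B :: ('a, 'm) module) i f.
        right_module R A \<and> right_module R B \<and>
        i \<in> right_module_hom R A B \<and> inj_on i (carrier A) \<and>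
        f \<in> right_module_hom R A Q \<longrightarrow>
        (\<exists>g\<in>right_module_hom R B Q. \<forall>x\<in>carrier A. g (i x) = f x))"

definition right_self_injective :: "'m itself \<Rightarrow> ('a, 'r) ring_scheme \<Rightarrow> bool" where
  "right_self_injective T R \<longleftrightarrow> injective_right_module T R (right_regular_module R)"

definition left_self_injective :: "'m itself \<Rightarrow> ('a, 'r) ring_scheme \<Rightarrow> bool" where
  "left_self_injective T R \<longleftrightarrow> right_self_injective T (opp_ring R)"

definition right_small_injective :: "('a, 'r) ring_scheme \<Rightarrow> bool" where
  "right_small_injective R \<longleftrightarrow>
     (\<forall>I. small_right_ideal R I \<longrightarrow>
       (\<forall>f\<in>right_module_hom R (right_ideal_module R I) (right_regular_module R).
          \<exists>g\<in>right_module_hom R (right_regular_module R) (right_regular_module R).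
            \<forall>x\<in>I. g x = f x))"

definition left_small_injective :: "('a, 'r) ring_scheme \<Rightarrow> bool" where
  "left_small_injective R \<longleftrightarrow> right_small_injective (opp_ring R)"

definition quasi_Frobenius :: "'m itself \<Rightarrow> ('a, 'r) ring_scheme \<Rightarrow> bool" where
  "quasi_Frobenius T R \<longleftrightarrow>
     (left_artinian R \<or> right_artinian R) \<and>
     (left_self_injective T R \<or> right_self_injective T R)"


section \<open>Semilocal, semiregular and perfect rings\<close>

text \<open>Semisimple means that \<open>R\<^sub>R\<close> is a sum of simple submodules.\<close>

definition semisimple_artinian :: "('a, 'r) ring_scheme \<Rightarrow> bool" where
  "semisimple_artinian R \<longleftrightarrow> right_socle R = carrier R \<and> right_artinian R"

definition semilocal :: "('a, 'r) ring_scheme \<Rightarrow> bool" where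
  "semilocal R \<longleftrightarrow> semisimple_artinian (R Quot jacobson_radical R)"

definition von_Neumann_regular :: "('a, 'r) ring_scheme \<Rightarrow> bool" where
  "von_Neumann_regular R \<longleftrightarrow>
     (\<forall>x\<in>carrier R. \<exists>y\<in>carrier R. x \<otimes>\<^bsub>R\<^esub> y \<otimes>\<^bsub>R\<^esub> x = x)"

definition idempotents_lift :: "('a, 'r) ring_scheme \<Rightarrow> 'a set \<Rightarrow> bool" where
  "idempotents_lift R I \<longleftrightarrow>
     (\<forall>x\<in>carrier R. x \<otimes>\<^bsub>R\<^esub> x \<ominus>\<^bsub>R\<^esub> x \<in> I \<longrightarrow>
        (\<exists>e\<in>carrier R. e \<otimes>\<^bsub>R\<^esub> e = e \<and> e \<ominus>\<^bsub>R\<^esub> x \<in> I))"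

definition semiregular :: "('a, 'r) ring_scheme \<Rightarrow> bool" where
  "semiregular R \<longleftrightarrow>
     von_Neumann_regular (R Quot jacobson_radical R) \<and> idempotents_lift R (jacobson_radical R)"

text \<open>\<open>rev_prod R a n\<close> is \<open>a (n - 1) \<otimes> \<dots> \<otimes> a 1 \<otimes> a 0\<close>.\<close>

primrec rev_prod :: "('a, 'r) ring_scheme \<Rightarrow> (nat \<Rightarrow> 'a) \<Rightarrow> nat \<Rightarrow> 'a" where
  "rev_prod R a 0 = \<one>\<^bsub>R\<^esub>"
| "rev_prod R a (Suc n) = a n \<otimes>\<^bsub>R\<^esub> rev_prod R a n"

definition right_T_nilpotent :: "('a, 'r) ring_scheme \<Rightarrow> 'a set \<Rightarrow> bool" where
  "right_T_nilpotent R I \<longleftrightarrow>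
     (\<forall>a :: nat \<Rightarrow> 'a. (\<forall>n. a n \<in> I) \<longrightarrow> (\<exists>n. rev_prod R a n = \<zero>\<^bsub>R\<^esub>))"

text \<open>
  Perfect rings are defined as in Lam, A First Course in Noncommutative Rings, Section 23.
\<close>

definition right_perfect :: "('a, 'r) ring_scheme \<Rightarrow> bool" where
  "right_perfect R \<longleftrightarrow> semilocal R \<and> right_T_nilpotent R (jacobson_radical R)"

definition left_perfect :: "('a, 'r) ring_scheme \<Rightarrow> bool" where
  "left_perfect R \<longleftrightarrow> right_perfect (opp_ring R)"

end

theory Submission
  imports Defs
begin

text \<open>
  Call \<open>R\<close> right Baer if every homomorphism from a right ideal to \<open>R\<^sub>R\<close> is a left
  multiplication. Modulo the radical \<open>J\<close> of a semilocal ring every right ideal splits off, so a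
  homomorphism on a right ideal \<open>I\<close> can be glued from its values on an idempotent generator of
  \<open>I\<close> modulo \<open>J\<close> and an extension from the small right ideal \<open>I \<inter> J\<close>: semilocal right
  small injective rings are right Baer, hence right self-injective. Conditions (4) and (5) are
  reduced to (3) by showing that \<open>R\<close> is semilocal: in (4) the radical is the left annihilator
  of finitely many elements of minimal right ideals, in (5) an infinite chain of idempotents would
  give a chain of right annihilators.

  In a right Baer ring finitely generated left ideals are annihilators and \<open>J\<close> is the right
  singular ideal. Either chain condition on right annihilators makes \<open>J\<close> nilpotent, so every
  nonzero right ideal meets the left annihilator of \<open>J\<close>. A right Baer semilocal ring with this
  property is right Kasch, so all right ideals are annihilators too, and the annihilator
  correspondence turns the chain condition into two-sided artinianness and left self-injectivity.

  For (2), T-nilpotence of \<open>J\<close> on one side gives the Kasch property first on one side and then,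
  because \<open>J\<close> is the annihilator of the socle from both sides, on the other, so that all
  one-sided ideals are annihilators. A right ideal \<open>I\<close> with \<open>I/IJ\<close> of infinite length would
  contradict this duality, and T-nilpotence lifts generators from \<open>I/IJ\<close> to \<open>I\<close>; hence
  \<open>R\<close> is right noetherian and (3) applies.
\<close>

text \<open>Self-injectivity carries a type of test modules, \<open>right_baer\<close> does not;
  Baer's criterion, at the type \<open>'a + 'c\<close> in one direction, is the only bridge between
  them. The quotient by \<open>J\<close> is likewise left at once for \<open>radical_split\<close>,
  whose left-right symmetry lets the opposite ring supply the left-handed facts. The obstacle in (3)
  to (5) is that the hypotheses sit on the right: left injectivity has to be manufactured from the
  two identities \<open>l(r(L)) = L\<close> and \<open>r(l(I)) = I\<close>. The second needs a
  nonzero left annihilator for each maximal right ideal, hence \<open>r(l(J)) = J\<close>. One-sided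
  injectivity directly yields only the mirror statement, that the left annihilator of
  \<open>l(J)\<close> is \<open>J\<close>. The missing side comes from an indirect chain argument on
  two-sided ideals above \<open>J\<close>, which is the least standard step of the proof.\<close>

declare opp_ring_opp_ring [simp]

section \<open>Chain conditions\<close>

text \<open>Failure would yield, by dependent choice, a strictly ascending sequence. The second
  predicate \<open>Q\<close> restricts the search to a subfamily for which no chain condition has to
  be proved.\<close>

lemma ACC_maximal:
  assumes "ACC P" "P A" "Q A"
  obtains B where "P B" "Q B" "\<And>C. P C \<Longrightarrow> Q C \<Longrightarrow> B \<subseteq> C \<Longrightarrow> C = B"
proof (rule ccontr)
  assume "\<not> thesis"
  note n = this that
  have step: "\<exists>C. (P C \<and> Q C) \<and> B \<subset> C" if "P B \<and> Q B" for B
  proof (rule ccontr)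
    assume c: "\<not> ?thesis"
    have "C = B" if "P C" "Q C" "B \<subseteq> C" for C using c that by blast
    with n(1) show False using n(2)[of B] \<open>P B \<and> Q B\<close> by blast
  qed
  obtain F where F: "F 0 = A" "\<And>n. (P (F n) \<and> Q (F n)) \<and> F n \<subset> F (Suc n)"
  proof -
    define F where "F = rec_nat A (\<lambda>_ B. SOME C. (P C \<and> Q C) \<and> B \<subset> C)"
    have S: "F (Suc n) = (SOME C. (P C \<and> Q C) \<and> F n \<subset> C)" for n by (simp add: F_def)
    have "P (F n) \<and> Q (F n)" for n
    proof (induction n)
      case 0 show ?case using assms by (simp add: F_def)
    next
      case (Suc n) then show ?case unfolding S using someI_ex[OF step[OF Suc]] by blast
    qed
    moreover have "F n \<subset> F (Suc n)" for n unfolding S using someI_ex[OF step] calculation by blast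
    moreover have "F 0 = A" by (simp add: F_def)
    ultimately show thesis using that[of F] by blast
  qed
  then have "\<And>n. P (F n) \<and> F n \<subseteq> F (Suc n)" by blast
  then obtain N where N: "\<And>n. n \<ge> N \<Longrightarrow> F n = F N" using assms(1) unfolding ACC_def by blast
  show False using N[of "Suc N"] F(2)[of N] by auto
qed

text \<open>Taking complements of sets reverses inclusion and reduces this to
  \<open>ACC_maximal\<close>.\<close>

lemma DCC_minimal:
  assumes "DCC P" "P A" "Q A"
  obtains B where "P B" "Q B" "\<And>C. P C \<Longrightarrow> Q C \<Longrightarrow> C \<subseteq> B \<Longrightarrow> C = B"
proof -
  have a: "ACC (\<lambda>X. P (- X))"
    unfolding ACC_def
  proof (intro allI impI)
    fix F :: "nat \<Rightarrow> 'a set"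
    assume "\<forall>n. P (- F n) \<and> F n \<subseteq> F (Suc n)"
    then have "\<forall>n. P (- F n) \<and> - F (Suc n) \<subseteq> - F n" by blast
    then obtain N where "\<forall>n\<ge>N. - F n = - F N"
      using assms(1)[unfolded DCC_def, rule_format, of "\<lambda>n. - F n"] by blast
    then show "\<exists>N. \<forall>n\<ge>N. F n = F N" by auto
  qed
  obtain B where "P (- B)" "Q (- B)" "\<And>C. P (- C) \<Longrightarrow> Q (- C) \<Longrightarrow> B \<subseteq> C \<Longrightarrow> C = B"
    using ACC_maximal[OF a, of "- A" "\<lambda>X. Q (- X)"] assms by auto
  then show thesis using that[of "- B"] by (metis Compl_subset_Compl_iff double_complement)
qed

lemma ACC_mono: "ACC P \<Longrightarrow> (\<And>X. Q X \<Longrightarrow> P X) \<Longrightarrow> ACC Q"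
  unfolding ACC_def by meson

lemma DCC_mono: "DCC P \<Longrightarrow> (\<And>X. Q X \<Longrightarrow> P X) \<Longrightarrow> DCC Q"
  unfolding DCC_def by meson

lemma DCC_stable:
  "DCC P \<Longrightarrow> (\<And>n. P (A n)) \<Longrightarrow> (\<And>n. A (Suc n) \<subseteq> A n) \<Longrightarrow> \<exists>N. \<forall>n\<ge>N. A n = A N"
  unfolding DCC_def by blast

lemma ACC_stable:
  "ACC P \<Longrightarrow> (\<And>n. P (A n)) \<Longrightarrow> (\<And>n. A n \<subseteq> A (Suc n)) \<Longrightarrow> \<exists>N. \<forall>n\<ge>N. A n = A N"
  unfolding ACC_def by blast

section \<open>Right ideals and the radical\<close>

text \<open>
  This says that every right ideal of \<open>R/J\<close> is generated by an idempotent, i.e. that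
  \<open>R\<close> is semilocal, without mentioning the quotient ring.
\<close>

definition radical_split :: "('a, 'r) ring_scheme \<Rightarrow> bool" where
  "radical_split R \<longleftrightarrow> (\<forall>I. right_ideal R I \<longrightarrow>
     (\<exists>f\<in>I. \<forall>a\<in>I. a \<ominus>\<^bsub>R\<^esub> f \<otimes>\<^bsub>R\<^esub> a \<in> jacobson_radical R))"

definition over_J :: "('a, 'r) ring_scheme \<Rightarrow> 'a set \<Rightarrow> bool" where
  "over_J R I \<longleftrightarrow> right_ideal R I \<and> jacobson_radical R \<subseteq> I"

text \<open>
  Homomorphisms \<open>I \<rightarrow> R\<^sub>R\<close> as functions on elements; those extending to \<open>R\<^sub>R\<close> are the left multiplications.
\<close>

definition linear_on :: "('a, 'r) ring_scheme \<Rightarrow> 'a set \<Rightarrow> ('a \<Rightarrow> 'a) \<Rightarrow> bool" where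
  "linear_on R I f \<longleftrightarrow> (\<forall>x\<in>I. f x \<in> carrier R) \<and>
     (\<forall>x\<in>I. \<forall>y\<in>I. f (x \<oplus>\<^bsub>R\<^esub> y) = f x \<oplus>\<^bsub>R\<^esub> f y) \<and>
     (\<forall>x\<in>I. \<forall>r\<in>carrier R. f (x \<otimes>\<^bsub>R\<^esub> r) = f x \<otimes>\<^bsub>R\<^esub> r)"

text \<open>The condition is kept for a single right ideal because small and minimal right ideals
  satisfy it before the ring is known to be right Baer.\<close>

definition extends_from :: "('a, 'r) ring_scheme \<Rightarrow> 'a set \<Rightarrow> bool" where
  "extends_from R I \<longleftrightarrow>
     (\<forall>f. linear_on R I f \<longrightarrow> (\<exists>c\<in>carrier R. \<forall>x\<in>I. f x = c \<otimes>\<^bsub>R\<^esub> x))"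

definition right_baer :: "('a, 'r) ring_scheme \<Rightarrow> bool" where
  "right_baer R \<longleftrightarrow> (\<forall>I. right_ideal R I \<longrightarrow> extends_from R I)"

lemma module_hom_iff_linear_on:
  "f \<in> right_module_hom R (right_ideal_module R I) (right_regular_module R) \<longleftrightarrow> linear_on R I f"
  by (auto simp: right_module_hom_def right_ideal_module_def linear_on_def)

definition lann :: "('a, 'r) ring_scheme \<Rightarrow> 'a set \<Rightarrow> 'a set" where
  "lann R X = {a \<in> carrier R. \<forall>x\<in>X. a \<otimes>\<^bsub>R\<^esub> x = \<zero>\<^bsub>R\<^esub>}"

definition rann :: "('a, 'r) ring_scheme \<Rightarrow> 'a set \<Rightarrow> 'a set" where
  "rann R X = {a \<in> carrier R. \<forall>x\<in>X. x \<otimes>\<^bsub>R\<^esub> a = \<zero>\<^bsub>R\<^esub>}"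

lemma lann_opp [simp]: "lann (opp_ring R) X = rann R X"
  by (simp add: lann_def rann_def)

lemma rann_opp [simp]: "rann (opp_ring R) X = lann R X"
  by (simp add: lann_def rann_def)

text \<open>Only products are taken, where the ideal power would contain their sums: both have the
  same annihilators and vanish together, and finite sums are avoided.\<close>

primrec J_prods :: "('a, 'r) ring_scheme \<Rightarrow> nat \<Rightarrow> 'a set" where
  "J_prods R 0 = {\<one>\<^bsub>R\<^esub>}"
| "J_prods R (Suc n) = {a \<otimes>\<^bsub>R\<^esub> p | a p. a \<in> jacobson_radical R \<and> p \<in> J_prods R n}"

definition J_nilpotent :: "('a, 'r) ring_scheme \<Rightarrow> bool" where
  "J_nilpotent R \<longleftrightarrow> (\<exists>n. J_prods R n \<subseteq> {\<zero>\<^bsub>R\<^esub>})"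

lemma right_annihilator_iff: "right_annihilator R A \<longleftrightarrow> (\<exists>X \<subseteq> carrier R. A = rann R X)"
  by (simp add: right_annihilator_def rann_def)

context ring
begin

section \<open>Arithmetic in the ring and in its opposite\<close>

lemma ring_opp: "ring (opp_ring R)"
  by (rule ring_opp_ring) (rule ring_axioms)

lemma uminus_opp [simp]: "x \<in> carrier R \<Longrightarrow> \<ominus>\<^bsub>opp_ring R\<^esub> x = \<ominus> x"
proof -
  interpret op: ring "opp_ring R" by (rule ring_opp)
  assume x: "x \<in> carrier R"
  have "\<ominus>\<^bsub>opp_ring R\<^esub> x \<oplus> x = \<zero>" using op.l_neg[of x] x by simp
  moreover have "\<ominus>\<^bsub>opp_ring R\<^esub> x \<in> carrier R" using op.a_inv_closed[of x] x by simp
  ultimately show ?thesis using x by (metis minus_equality)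
qed

lemma minus_opp [simp]:
  "x \<in> carrier R \<Longrightarrow> y \<in> carrier R \<Longrightarrow> x \<ominus>\<^bsub>opp_ring R\<^esub> y = x \<ominus> y"
  by (simp add: a_minus_def)

lemma eq_iff_minus_zero: "x \<in> carrier R \<Longrightarrow> y \<in> carrier R \<Longrightarrow> x = y \<longleftrightarrow> x \<ominus> y = \<zero>"
  by (metis a_minus_def add.inv_closed add.inv_equality minus_minus r_neg)

lemma minus_add_cancel: "x \<in> carrier R \<Longrightarrow> y \<in> carrier R \<Longrightarrow> x \<ominus> y \<oplus> y = x"
  by (simp add: a_minus_def a_assoc l_neg)

lemma add_minus_minus: "x \<in> carrier R \<Longrightarrow> y \<in> carrier R \<Longrightarrow> y \<oplus> (x \<ominus> y) = x"
  by (metis minus_add_cancel a_comm minus_closed)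

lemma l_distr_minus:
  "x \<in> carrier R \<Longrightarrow> y \<in> carrier R \<Longrightarrow> z \<in> carrier R \<Longrightarrow> (x \<ominus> y) \<otimes> z = x \<otimes> z \<ominus> y \<otimes> z"
  by (simp add: a_minus_def l_distr l_minus)

lemma r_distr_minus:
  "x \<in> carrier R \<Longrightarrow> y \<in> carrier R \<Longrightarrow> z \<in> carrier R \<Longrightarrow> z \<otimes> (x \<ominus> y) = z \<otimes> x \<ominus> z \<otimes> y"
  by (simp add: a_minus_def r_distr r_minus)

lemma minus_minus_cancel:
  "x \<in> carrier R \<Longrightarrow> y \<in> carrier R \<Longrightarrow> x \<ominus> (x \<ominus> y) = y"
  by (simp add: a_minus_def minus_add a_assoc[symmetric] r_neg)

lemma minus_trans:
  "x \<in> carrier R \<Longrightarrow> y \<in> carrier R \<Longrightarrow> z \<in> carrier R \<Longrightarrow> (x \<ominus> y) \<oplus> (y \<ominus> z) = x \<ominus> z"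
  by (simp add: a_minus_def a_assoc r_neg1)

section \<open>Elementary theory of right ideals\<close>

lemma right_idealI:
  assumes "I \<subseteq> carrier R" "\<zero> \<in> I" "\<And>x y. x \<in> I \<Longrightarrow> y \<in> I \<Longrightarrow> x \<oplus> y \<in> I"
    "\<And>x r. x \<in> I \<Longrightarrow> r \<in> carrier R \<Longrightarrow> x \<otimes> r \<in> I"
  shows "right_ideal R I"
proof -
  \<comment> \<open>Negation is right multiplication by \<open>-1\<close>.\<close>
  have "\<ominus> x \<in> I" if "x \<in> I" for x
    using assms(4)[OF that, of "\<ominus> \<one>"] that assms(1) by (auto simp: r_minus)
  then have "subgroup I (add_monoid R)"
    using assms(1-3) by (intro add.subgroupI) auto
  then show ?thesis using assms(4) by (simp add: right_ideal_def additive_subgroup_def)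
qed

lemma right_ideal_subset: "right_ideal R I \<Longrightarrow> I \<subseteq> carrier R"
  by (simp add: right_ideal_def additive_subgroup.a_subset)

lemma right_ideal_carr: "right_ideal R I \<Longrightarrow> x \<in> I \<Longrightarrow> x \<in> carrier R"
  using right_ideal_subset by blast

lemma right_ideal_zero: "right_ideal R I \<Longrightarrow> \<zero> \<in> I"
  by (simp add: right_ideal_def additive_subgroup.zero_closed)

lemma right_ideal_add: "right_ideal R I \<Longrightarrow> x \<in> I \<Longrightarrow> y \<in> I \<Longrightarrow> x \<oplus> y \<in> I"
  by (simp add: right_ideal_def additive_subgroup.a_closed)

lemma right_ideal_mult: "right_ideal R I \<Longrightarrow> x \<in> I \<Longrightarrow> r \<in> carrier R \<Longrightarrow> x \<otimes> r \<in> I"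
  by (simp add: right_ideal_def)

lemma right_ideal_uminus: "right_ideal R I \<Longrightarrow> x \<in> I \<Longrightarrow> \<ominus> x \<in> I"
  by (auto simp: right_ideal_def intro: additive_subgroup.a_inv_closed)

lemma right_ideal_minus: "right_ideal R I \<Longrightarrow> x \<in> I \<Longrightarrow> y \<in> I \<Longrightarrow> x \<ominus> y \<in> I"
  by (simp add: a_minus_def right_ideal_add right_ideal_uminus)

lemmas right_ideal_simps = right_ideal_carr right_ideal_zero right_ideal_add right_ideal_mult
  right_ideal_uminus right_ideal_minus

lemma right_ideal_minus_cancel:
  assumes "right_ideal R I" "x \<ominus> y \<in> I" "x \<in> carrier R" "y \<in> carrier R"
  shows "x \<in> I \<longleftrightarrow> y \<in> I"
  using assms by (metis minus_add_cancel minus_minus_cancel right_ideal_add right_ideal_minus)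

lemma right_ideal_add_cancel:
  assumes "right_ideal R I" "x \<oplus> y \<in> I" "x \<in> carrier R" "y \<in> I"
  shows "x \<in> I"
proof -
  have "(x \<oplus> y) \<ominus> y = x"
    using assms by (simp add: a_minus_def a_assoc r_neg right_ideal_carr)
  then show ?thesis using right_ideal_minus[OF assms(1,2,4)] by simp
qed

lemma right_ideal_one: "right_ideal R I \<Longrightarrow> \<one> \<in> I \<longleftrightarrow> I = carrier R"
  by (metis l_one one_closed right_ideal_mult right_ideal_subset subsetI subset_antisym)

lemma right_ideal_carrier: "right_ideal R (carrier R)"
  by (rule right_idealI) auto

lemma right_ideal_trivial: "right_ideal R {\<zero>}"
  by (rule right_idealI) auto

lemma right_ideal_Int: "right_ideal R I \<Longrightarrow> right_ideal R K \<Longrightarrow> right_ideal R (I \<inter> K)"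
  by (rule right_idealI) (auto simp: right_ideal_simps)

lemma right_ideal_Inter:
  assumes "\<And>I. I \<in> F \<Longrightarrow> right_ideal R I"
  shows "right_ideal R (carrier R \<inter> \<Inter>F)"
  by (rule right_idealI) (auto simp: right_ideal_simps assms)

lemma right_ideal_Union:
  assumes "F \<noteq> {}" and "\<And>I. I \<in> F \<Longrightarrow> right_ideal R I"
    and "\<And>I K. I \<in> F \<Longrightarrow> K \<in> F \<Longrightarrow> I \<subseteq> K \<or> K \<subseteq> I"
  shows "right_ideal R (\<Union>F)"
proof (rule right_idealI)
  fix x y assume "x \<in> \<Union>F" "y \<in> \<Union>F"
  then obtain I K where IK: "I \<in> F" "K \<in> F" "x \<in> I" "y \<in> K" by blast
  show "x \<oplus> y \<in> \<Union>F"
  proof (cases "I \<subseteq> K")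
    case True then show ?thesis using IK assms(2) right_ideal_add[of K x y] by blast
  next
    case False then show ?thesis using IK assms(2,3) right_ideal_add[of I x y] by blast
  qed
next
  show "\<Union>F \<subseteq> carrier R" using assms(2) right_ideal_subset by blast
  show "\<zero> \<in> \<Union>F" using assms(1,2) right_ideal_zero by blast
next
  fix x r assume "x \<in> \<Union>F" "r \<in> carrier R"
  then show "x \<otimes> r \<in> \<Union>F" using assms(2) right_ideal_mult by blast
qed

lemma right_ideal_UN_mono:
  fixes A :: "nat \<Rightarrow> 'a set"
  assumes "\<And>n. right_ideal R (A n)" "\<And>n. A n \<subseteq> A (Suc n)"
  shows "right_ideal R (\<Union>n. A n)"
proof (rule right_ideal_Union)
  fix I K assume "I \<in> range A" "K \<in> range A"
  then obtain m n where "I = A m" "K = A n" by blast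
  moreover have "A i \<subseteq> A j" if "i \<le> j" for i j using lift_Suc_mono_le[of A, OF assms(2) that] .
  ultimately show "I \<subseteq> K \<or> K \<subseteq> I" using nat_le_linear[of m n] by blast
next
  show "right_ideal R I" if "I \<in> range A" for I using that assms(1) by blast
qed simp

lemma set_add_mem: "x \<in> I <+>\<^bsub>R\<^esub> K \<longleftrightarrow> (\<exists>a\<in>I. \<exists>b\<in>K. x = a \<oplus> b)"
  by (auto simp: set_add_def')

lemma set_add_I: "a \<in> I \<Longrightarrow> b \<in> K \<Longrightarrow> a \<oplus> b \<in> I <+>\<^bsub>R\<^esub> K"
  by (auto simp: set_add_def')

lemma right_ideal_set_add:
  assumes "right_ideal R I" "right_ideal R K"
  shows "right_ideal R (I <+>\<^bsub>R\<^esub> K)"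
proof (rule right_idealI)
  show "I <+>\<^bsub>R\<^esub> K \<subseteq> carrier R" using assms by (auto simp: set_add_mem right_ideal_simps)
  have "\<zero> \<oplus> \<zero> \<in> I <+>\<^bsub>R\<^esub> K" using assms by (intro set_add_I) (auto simp: right_ideal_simps)
  then show "\<zero> \<in> I <+>\<^bsub>R\<^esub> K" by simp
next
  fix x y assume "x \<in> I <+>\<^bsub>R\<^esub> K" "y \<in> I <+>\<^bsub>R\<^esub> K"
  then obtain a b c d where h: "a \<in> I" "b \<in> K" "c \<in> I" "d \<in> K" "x = a \<oplus> b" "y = c \<oplus> d"
    by (auto simp: set_add_mem)
  note carr = right_ideal_carr[OF assms(1)] right_ideal_carr[OF assms(2)]
  have "x \<oplus> y = (a \<oplus> c) \<oplus> (b \<oplus> d)" using h carr by (simp add: a_ac)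
  then show "x \<oplus> y \<in> I <+>\<^bsub>R\<^esub> K" using h assms by (simp add: set_add_I right_ideal_add)
next
  fix x r assume "x \<in> I <+>\<^bsub>R\<^esub> K" "r \<in> carrier R"
  moreover from this obtain a b where h: "a \<in> I" "b \<in> K" "x = a \<oplus> b"
    by (auto simp: set_add_mem)
  ultimately show "x \<otimes> r \<in> I <+>\<^bsub>R\<^esub> K"
    using assms by (simp add: l_distr right_ideal_carr set_add_I right_ideal_mult)
qed

lemma set_add_ge1: "right_ideal R I \<Longrightarrow> right_ideal R K \<Longrightarrow> I \<subseteq> I <+>\<^bsub>R\<^esub> K"
proof
  fix x assume h: "right_ideal R I" "right_ideal R K" "x \<in> I"
  then have "x \<oplus> \<zero> \<in> I <+>\<^bsub>R\<^esub> K" by (intro set_add_I right_ideal_zero)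
  then show "x \<in> I <+>\<^bsub>R\<^esub> K" using h by (simp add: right_ideal_carr)
qed

lemma set_add_ge2: "right_ideal R I \<Longrightarrow> right_ideal R K \<Longrightarrow> K \<subseteq> I <+>\<^bsub>R\<^esub> K"
proof
  fix x assume h: "right_ideal R I" "right_ideal R K" "x \<in> K"
  then have "\<zero> \<oplus> x \<in> I <+>\<^bsub>R\<^esub> K" by (intro set_add_I right_ideal_zero)
  then show "x \<in> I <+>\<^bsub>R\<^esub> K" using h by (simp add: right_ideal_carr)
qed

lemma set_add_le: "right_ideal R L \<Longrightarrow> I \<subseteq> L \<Longrightarrow> K \<subseteq> L \<Longrightarrow> I <+>\<^bsub>R\<^esub> K \<subseteq> L"
  unfolding set_add_def' by (blast intro: right_ideal_add)

definition rPIdl :: "'a \<Rightarrow> 'a set" where "rPIdl x = (\<lambda>r. x \<otimes> r) ` carrier R"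

lemma rPIdl_mem: "x \<in> carrier R \<Longrightarrow> x \<in> rPIdl x"
  unfolding rPIdl_def by (metis imageI one_closed r_one)

lemma right_ideal_rPIdl: "x \<in> carrier R \<Longrightarrow> right_ideal R (rPIdl x)"
proof (rule right_idealI)
  assume x: "x \<in> carrier R"
  show "\<zero> \<in> rPIdl x" unfolding rPIdl_def using x by (metis imageI r_null zero_closed)
  show "a \<oplus> b \<in> rPIdl x" if "a \<in> rPIdl x" "b \<in> rPIdl x" for a b
    using that x by (auto simp: rPIdl_def r_distr[symmetric])
  show "a \<otimes> r \<in> rPIdl x" if "a \<in> rPIdl x" "r \<in> carrier R" for a r
    using that x by (auto simp: rPIdl_def m_assoc)
qed (auto simp: rPIdl_def)

lemma rPIdl_le: "right_ideal R I \<Longrightarrow> x \<in> I \<Longrightarrow> rPIdl x \<subseteq> I"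
  by (auto simp: rPIdl_def right_ideal_mult)

lemma right_ideal_preimage:
  assumes "right_ideal R I" "a \<in> carrier R"
  shows "right_ideal R {r \<in> carrier R. a \<otimes> r \<in> I}"
  using assms by (intro right_idealI) (auto simp: right_ideal_simps r_distr m_assoc[symmetric])

lemma ex_maximal_right_ideal:
  assumes "right_ideal R I" "I \<noteq> carrier R"
  obtains M where "maximal_right_ideal R M" "I \<subseteq> M"
proof -
  \<comment> \<open>Properness is expressed by \<open>\<one> \<notin> K\<close>, which survives the
    union of a chain.\<close>
  define F where "F = {K. right_ideal R K \<and> I \<subseteq> K \<and> \<one> \<notin> K}"
  have "I \<in> F" using assms by (simp add: F_def right_ideal_one)
  moreover have "\<Union>C \<in> F" if "C \<noteq> {}" "subset.chain F C" for C
  proof -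
    have "right_ideal R (\<Union>C)"
      using that by (intro right_ideal_Union) (auto simp: F_def subset.chain_def)
    then show ?thesis using that by (auto simp: F_def subset.chain_def)
  qed
  ultimately obtain M where M: "M \<in> F" "\<And>X. X \<in> F \<Longrightarrow> M \<subseteq> X \<Longrightarrow> X = M"
    using subset_Zorn_nonempty[of F] by blast
  have "maximal_right_ideal R M"
    unfolding maximal_right_ideal_def
  proof (intro conjI allI impI)
    show "right_ideal R M" "M \<noteq> carrier R" using M(1) by (auto simp: F_def)
    fix K assume "right_ideal R K \<and> M \<subseteq> K"
    moreover from this have "\<one> \<in> K \<Longrightarrow> K = carrier R" by (simp add: right_ideal_one)
    moreover have "I \<subseteq> M" using M(1) by (simp add: F_def)
    ultimately show "K = M \<or> K = carrier R" using M(2)[of K] by (auto simp: F_def)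
  qed
  then show thesis using that M(1) by (auto simp: F_def)
qed

lemma maximal_right_idealD:
  assumes "maximal_right_ideal R M"
  shows "right_ideal R M" "M \<noteq> carrier R" "\<one> \<notin> M"
    "\<And>K. right_ideal R K \<Longrightarrow> M \<subseteq> K \<Longrightarrow> K = M \<or> K = carrier R"
  using assms right_ideal_one by (auto simp: maximal_right_ideal_def)

lemma maximal_right_ideal_split:
  assumes M: "maximal_right_ideal R M" and x: "x \<in> carrier R" "x \<notin> M" and y: "y \<in> carrier R"
  obtains m r where "m \<in> M" "r \<in> carrier R" "y = m \<oplus> x \<otimes> r"
proof -
  note MD = maximal_right_idealD[OF M]
  have rp: "right_ideal R (rPIdl x)" by (rule right_ideal_rPIdl) (rule x)
  have "M <+>\<^bsub>R\<^esub> rPIdl x \<noteq> M" using set_add_ge2[OF MD(1) rp] rPIdl_mem x by blast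
  then have "M <+>\<^bsub>R\<^esub> rPIdl x = carrier R"
    using MD(4)[OF right_ideal_set_add[OF MD(1) rp] set_add_ge1[OF MD(1) rp]] by blast
  then have "y \<in> M <+>\<^bsub>R\<^esub> rPIdl x" using y by simp
  then show thesis using that by (auto simp: set_add_mem rPIdl_def)
qed

section \<open>The Jacobson radical and its left-right symmetry\<close>

abbreviation J :: "'a set" where "J \<equiv> jacobson_radical R"

lemma J_right: "right_ideal R J"
  unfolding jacobson_radical_def by (rule right_ideal_Inter) (simp add: maximal_right_idealD)

lemma J_carr: "x \<in> J \<Longrightarrow> x \<in> carrier R"
  by (simp add: jacobson_radical_def)

lemma J_le_maximal: "maximal_right_ideal R M \<Longrightarrow> J \<subseteq> M"
  by (auto simp: jacobson_radical_def)

text \<open>If \<open>1 - x r\<close> had no right inverse, it would lie in a maximal right ideal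
  together with \<open>x r\<close>, and so would \<open>1\<close>. If \<open>x\<close> misses a
  maximal right ideal \<open>M\<close>, then \<open>1 = m + x r\<close> with \<open>m\<close> in
  \<open>M\<close>, and right invertibility of \<open>m = 1 - x r\<close> would put \<open>1\<close>
  in \<open>M\<close>.\<close>

lemma J_iff_right_inverse:
  "x \<in> J \<longleftrightarrow> x \<in> carrier R \<and> (\<forall>r\<in>carrier R. \<exists>y\<in>carrier R. (\<one> \<ominus> x \<otimes> r) \<otimes> y = \<one>)"
    (is "?L \<longleftrightarrow> ?P")
proof
  assume x: ?L
  then have xc: "x \<in> carrier R" by (rule J_carr)
  have "\<exists>y\<in>carrier R. (\<one> \<ominus> x \<otimes> r) \<otimes> y = \<one>" if r: "r \<in> carrier R" for r
  proof (rule ccontr)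
    assume n: "\<not> ?thesis"
    let ?u = "\<one> \<ominus> x \<otimes> r"
    have u: "?u \<in> carrier R" using xc r by simp
    have rp: "right_ideal R (rPIdl ?u)" using u by (rule right_ideal_rPIdl)
    have "\<one> \<notin> rPIdl ?u" using n by (auto simp: rPIdl_def)
    then have "rPIdl ?u \<noteq> carrier R" by auto
    then obtain M where M: "maximal_right_ideal R M" "rPIdl ?u \<subseteq> M"
      using ex_maximal_right_ideal[OF rp] by blast
    note MD = maximal_right_idealD[OF M(1)]
    have "x \<otimes> r \<in> M" using J_le_maximal[OF M(1)] x r MD(1) by (auto intro: right_ideal_mult)
    moreover have "?u \<in> M" using M(2) rPIdl_mem u by blast
    ultimately have "?u \<oplus> x \<otimes> r \<in> M" using MD(1) by (simp add: right_ideal_add)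
    then show False using MD(3) xc r by (simp add: minus_add_cancel)
  qed
  then show ?P using xc by blast
next
  assume P: ?P
  have "x \<in> M" if M: "maximal_right_ideal R M" for M
  proof (rule ccontr)
    assume "x \<notin> M"
    note MD = maximal_right_idealD[OF M]
    obtain m r where mr: "m \<in> M" "r \<in> carrier R" "\<one> = m \<oplus> x \<otimes> r"
      using maximal_right_ideal_split[OF M _ \<open>x \<notin> M\<close>, of \<one>] P by blast
    have mc: "m \<in> carrier R" using mr MD(1) right_ideal_carr by blast
    have "m = \<one> \<ominus> x \<otimes> r" using mr P mc by (simp add: a_minus_def a_assoc r_neg)
    then obtain y where "y \<in> carrier R" "m \<otimes> y = \<one>" using P mr(2) by blast
    then have "\<one> \<in> M" using mr(1) MD(1) right_ideal_mult by metis
    then show False using MD(3) by simp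
  qed
  then show ?L using P by (auto simp: jacobson_radical_def)
qed

text \<open>A right inverse of \<open>1 - x r\<close> has itself the form \<open>1 - x r'\<close>,
  so it is right invertible as well; hence the inverse is two-sided.\<close>

lemma J_unit_right:
  assumes "x \<in> J" "r \<in> carrier R"
  shows "\<one> \<ominus> x \<otimes> r \<in> Units R"
proof -
  have xc: "x \<in> carrier R" using assms J_carr by blast
  let ?u = "\<one> \<ominus> x \<otimes> r"
  have u: "?u \<in> carrier R" using xc assms by simp
  obtain v where v: "v \<in> carrier R" "?u \<otimes> v = \<one>" using assms J_iff_right_inverse by blast
  have "v \<ominus> x \<otimes> r \<otimes> v = \<one>" using v xc assms by (simp add: l_distr_minus)
  then have "v = \<one> \<oplus> x \<otimes> r \<otimes> v" using v(1) xc assms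
    by (metis m_closed minus_add_cancel)
  also have "\<dots> = \<one> \<ominus> x \<otimes> (\<ominus> (r \<otimes> v))"
    using v xc assms by (simp add: a_minus_def r_minus m_assoc)
  finally have v': "v = \<one> \<ominus> x \<otimes> (\<ominus> (r \<otimes> v))" .
  obtain w where w: "w \<in> carrier R" "v \<otimes> w = \<one>"
    using assms v(1) v' J_iff_right_inverse[of x] by (metis a_inv_closed m_closed)
  have "?u = w" using u v w by (metis m_assoc l_one r_one)
  then show ?thesis using u v w by (auto simp: Units_def)
qed

lemma J_unit_left:
  assumes "x \<in> J" "r \<in> carrier R"
  shows "\<one> \<ominus> r \<otimes> x \<in> Units R"
proof -
  have xc: "x \<in> carrier R" using assms J_carr by blast
  obtain v where v: "v \<in> carrier R" "(\<one> \<ominus> x \<otimes> r) \<otimes> v = \<one>" "v \<otimes> (\<one> \<ominus> x \<otimes> r) = \<one>"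
    using J_unit_right[OF assms] by (auto simp: Units_def)
  \<comment> \<open>The familiar formula: if \<open>v\<close> inverts \<open>1 - x r\<close>, then
    \<open>1 + r v x\<close> inverts \<open>1 - r x\<close>.\<close>
  let ?w = "\<one> \<oplus> r \<otimes> v \<otimes> x"
  have "(\<one> \<ominus> r \<otimes> x) \<otimes> ?w = \<one> \<ominus> r \<otimes> x \<oplus> r \<otimes> ((\<one> \<ominus> x \<otimes> r) \<otimes> v) \<otimes> x"
    using assms xc v(1) by (simp add: ring_simprules)
  also have "\<dots> = \<one>" using v xc assms by (simp add: minus_add_cancel)
  finally have 1: "(\<one> \<ominus> r \<otimes> x) \<otimes> ?w = \<one>" .
  have "?w \<otimes> (\<one> \<ominus> r \<otimes> x) = \<one> \<ominus> r \<otimes> x \<oplus> r \<otimes> (v \<otimes> (\<one> \<ominus> x \<otimes> r)) \<otimes> x"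
    using assms xc v(1) by (simp add: ring_simprules)
  also have "\<dots> = \<one>" using v xc assms by (simp add: minus_add_cancel)
  finally have 2: "?w \<otimes> (\<one> \<ominus> r \<otimes> x) = \<one>" .
  show ?thesis using 1 2 xc assms v(1) by (auto simp: Units_def)
qed

lemma J_le_J_opp: "J \<subseteq> jacobson_radical (opp_ring R)"
proof
  fix x assume x: "x \<in> J"
  interpret op: ring "opp_ring R" by (rule ring_opp)
  have "x \<in> carrier R" using x by (rule J_carr)
  then show "x \<in> jacobson_radical (opp_ring R)"
    using J_unit_left[OF x] by (fastforce simp: op.J_iff_right_inverse Units_def)
qed

text \<open>The inclusion just proved, applied to the opposite ring, gives the other one. From here
  on every result about \<open>J\<close> transfers to left ideals by interpreting the locale at
  \<open>opp_ring R\<close>.\<close>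

lemma J_opp [simp]: "jacobson_radical (opp_ring R) = J"
proof
  interpret op: ring "opp_ring R" by (rule ring_opp)
  show "jacobson_radical (opp_ring R) \<subseteq> J" using op.J_le_J_opp by simp
qed (rule J_le_J_opp)

lemma J_left: "right_ideal (opp_ring R) J"
proof -
  interpret op: ring "opp_ring R" by (rule ring_opp)
  show ?thesis using op.J_right by simp
qed

lemma J_mult_left: "x \<in> J \<Longrightarrow> r \<in> carrier R \<Longrightarrow> r \<otimes> x \<in> J"
  using J_left by (auto simp: right_ideal_def)

lemma J_mult_right: "x \<in> J \<Longrightarrow> r \<in> carrier R \<Longrightarrow> x \<otimes> r \<in> J"
  using right_ideal_mult[OF J_right] .

lemma J_zero: "\<zero> \<in> J" using J_right by (rule right_ideal_zero)
lemma J_add: "x \<in> J \<Longrightarrow> y \<in> J \<Longrightarrow> x \<oplus> y \<in> J" using J_right by (rule right_ideal_add)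
lemma J_minus: "x \<in> J \<Longrightarrow> y \<in> J \<Longrightarrow> x \<ominus> y \<in> J" using J_right by (rule right_ideal_minus)

lemma ideal_J: "ideal J R"
proof (rule idealI)
  show "subgroup J (add_monoid R)"
    using J_right by (simp add: right_ideal_def additive_subgroup_def)
qed (auto simp: ring_axioms J_mult_left J_mult_right)

lemma small_of_le_J:
  assumes "right_ideal R I" "I \<subseteq> J"
  shows "small_right_ideal R I"
  unfolding small_right_ideal_def
proof (intro conjI allI impI)
  fix K assume K: "right_ideal R K \<and> K \<noteq> carrier R"
  then obtain M where M: "maximal_right_ideal R M" "K \<subseteq> M"
    using ex_maximal_right_ideal by blast
  have "I <+>\<^bsub>R\<^esub> K \<subseteq> M"
    using M assms J_le_maximal by (intro set_add_le) (auto simp: maximal_right_idealD)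
  then show "I <+>\<^bsub>R\<^esub> K \<noteq> carrier R" using maximal_right_idealD[OF M(1)] by blast
qed (rule assms)

text \<open>Equality in \<open>R/J\<close>, expressed by elements of \<open>R\<close> so that
  calculations need no cosets; the carrier conditions are included so that they travel along chains
  of congruences.\<close>

definition cong :: "'a \<Rightarrow> 'a \<Rightarrow> bool" where
  "cong x y \<longleftrightarrow> x \<in> carrier R \<and> y \<in> carrier R \<and> x \<ominus> y \<in> J"

lemma cong_refl: "x \<in> carrier R \<Longrightarrow> cong x x"
  by (simp add: cong_def a_minus_def r_neg J_zero)

lemma cong_sym: "cong x y \<Longrightarrow> cong y x"
proof -
  assume h: "cong x y"
  have "y \<ominus> x = \<ominus> (x \<ominus> y)" using h by (simp add: cong_def a_minus_def minus_add a_comm)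
  then show ?thesis using h right_ideal_uminus[OF J_right] by (simp add: cong_def)
qed

lemma cong_trans [trans]: "cong x y \<Longrightarrow> cong y z \<Longrightarrow> cong x z"
  by (metis J_add cong_def minus_trans)

lemma cong_add: "cong x y \<Longrightarrow> cong z w \<Longrightarrow> cong (x \<oplus> z) (y \<oplus> w)"
proof -
  assume h: "cong x y" "cong z w"
  have "(x \<oplus> z) \<ominus> (y \<oplus> w) = (x \<ominus> y) \<oplus> (z \<ominus> w)"
    using h by (simp add: cong_def ring_simprules)
  then show ?thesis using h J_add by (simp add: cong_def)
qed

lemma cong_minus: "cong x y \<Longrightarrow> cong z w \<Longrightarrow> cong (x \<ominus> z) (y \<ominus> w)"
proof -
  assume h: "cong x y" "cong z w"
  have "(x \<ominus> z) \<ominus> (y \<ominus> w) = (x \<ominus> y) \<ominus> (z \<ominus> w)"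
    using h by (simp add: cong_def ring_simprules)
  then show ?thesis using h J_minus by (simp add: cong_def)
qed

lemma cong_mult: "cong x y \<Longrightarrow> cong z w \<Longrightarrow> cong (x \<otimes> z) (y \<otimes> w)"
proof -
  assume h: "cong x y" "cong z w"
  have "x \<otimes> z \<ominus> y \<otimes> w = ((x \<ominus> y) \<otimes> z) \<oplus> (y \<otimes> (z \<ominus> w))"
    using h by (simp add: cong_def l_distr_minus r_distr_minus minus_trans)
  then show ?thesis using h by (simp add: cong_def J_add J_mult_left J_mult_right)
qed

lemma cong_zero: "cong x \<zero> \<longleftrightarrow> x \<in> J"
  by (auto simp: cong_def a_minus_def J_carr)

lemma cong_J: "cong x y \<Longrightarrow> x \<in> J \<longleftrightarrow> y \<in> J"
  using right_ideal_minus_cancel[OF J_right] by (auto simp: cong_def)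

lemma cong_mem: "cong x y \<Longrightarrow> right_ideal R I \<Longrightarrow> J \<subseteq> I \<Longrightarrow> x \<in> I \<longleftrightarrow> y \<in> I"
  using right_ideal_minus_cancel[of I x y] by (auto simp: cong_def)


section \<open>Semilocal rings\<close>

lemma add_minus_cancel: "x \<in> carrier R \<Longrightarrow> y \<in> carrier R \<Longrightarrow> (x \<oplus> y) \<ominus> x = y"
  by (simp add: a_minus_def a_comm[of x y] a_assoc r_neg)

lemma radical_splitE:
  assumes "radical_split R" "right_ideal R I"
  obtains f where "f \<in> I" "f \<in> carrier R" "\<And>a. a \<in> I \<Longrightarrow> cong a (f \<otimes> a)"
proof -
  obtain f where "f \<in> I" "\<forall>a\<in>I. a \<ominus> f \<otimes> a \<in> J" using assms by (auto simp: radical_split_def)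
  then show thesis using that assms(2) right_ideal_carr by (auto simp: cong_def)
qed

lemma radical_split_ex:
  "radical_split R \<Longrightarrow> right_ideal R I \<Longrightarrow> \<exists>f\<in>I. \<forall>a\<in>I. cong a (f \<otimes> a)"
  by (rule radical_splitE) auto

text \<open>Write \<open>1 = f + k\<close> with \<open>f\<close> in \<open>I\<close> and
  \<open>k\<close> in \<open>K\<close>. For \<open>a\<close> in \<open>I\<close> the element
  \<open>a - f a = k a\<close> lies in \<open>I \<inter> K\<close>.\<close>

lemma radical_splitI:
  assumes "\<And>I. right_ideal R I \<Longrightarrow> \<exists>K. right_ideal R K \<and> I <+>\<^bsub>R\<^esub> K = carrier R \<and> I \<inter> K \<subseteq> J"
  shows "radical_split R"
  unfolding radical_split_def
proof (intro allI impI)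
  fix I assume I: "right_ideal R I"
  then obtain K where K: "right_ideal R K" "I <+>\<^bsub>R\<^esub> K = carrier R" "I \<inter> K \<subseteq> J"
    using assms by blast
  have "\<one> \<in> I <+>\<^bsub>R\<^esub> K" using K(2) by simp
  then obtain f k where fk: "f \<in> I" "k \<in> K" "\<one> = f \<oplus> k" by (auto simp: set_add_mem)
  have c: "f \<in> carrier R" "k \<in> carrier R" using fk I K right_ideal_carr by blast+
  have "a \<ominus> f \<otimes> a \<in> J" if a: "a \<in> I" for a
  proof -
    have ac: "a \<in> carrier R" using a I right_ideal_carr by blast
    have "a = f \<otimes> a \<oplus> k \<otimes> a" using arg_cong[OF fk(3), of "\<lambda>z. z \<otimes> a"] c ac by (simp add: l_distr)
    then have "a \<ominus> f \<otimes> a = (f \<otimes> a \<oplus> k \<otimes> a) \<ominus> f \<otimes> a" by simp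
    also have "\<dots> = k \<otimes> a" using c ac by (simp add: add_minus_cancel)
    finally have "a \<ominus> f \<otimes> a = k \<otimes> a" .
    moreover have "a \<ominus> f \<otimes> a \<in> I" using a fk I ac by (intro right_ideal_minus right_ideal_mult)
    moreover have "k \<otimes> a \<in> K" using fk K ac by (intro right_ideal_mult)
    ultimately show ?thesis using K(3) by auto
  qed
  then show "\<exists>f\<in>I. \<forall>a\<in>I. a \<ominus> f \<otimes> a \<in> J" using fk(1) by blast
qed

text \<open>
  A supplement \<open>K\<close> of \<open>I\<close> can be cut down by any maximal right ideal not containing
  \<open>I \<inter> K\<close>, so a minimal supplement meets \<open>I\<close> inside \<open>J\<close>.
\<close>

lemma comaximal_shrink:
  assumes I: "right_ideal R I" and K: "right_ideal R K" and IK: "I <+>\<^bsub>R\<^esub> K = carrier R"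
    and M: "maximal_right_ideal R M" and a: "a \<in> I" "a \<in> K" "a \<notin> M"
  shows "I <+>\<^bsub>R\<^esub> (K \<inter> M) = carrier R"
proof
  have MR: "right_ideal R M" using M by (rule maximal_right_idealD)
  show "I <+>\<^bsub>R\<^esub> (K \<inter> M) \<subseteq> carrier R"
    using right_ideal_set_add[OF I right_ideal_Int[OF K MR]] by (rule right_ideal_subset)
  show "carrier R \<subseteq> I <+>\<^bsub>R\<^esub> (K \<inter> M)"
  proof
    fix y assume y: "y \<in> carrier R"
    then obtain i k where ik: "i \<in> I" "k \<in> K" "y = i \<oplus> k" using IK set_add_mem by blast
    have c: "a \<in> carrier R" "i \<in> carrier R" "k \<in> carrier R" using a ik I K right_ideal_carr by blast+
    obtain m r where mr: "m \<in> M" "r \<in> carrier R" "k = m \<oplus> a \<otimes> r"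
      using maximal_right_ideal_split[OF M c(1) a(3) c(3)] by blast
    have ar: "a \<otimes> r \<in> K" "a \<otimes> r \<in> I" using a mr K I by (auto intro: right_ideal_mult)
    have mc: "m \<in> carrier R" using mr MR right_ideal_carr by blast
    have "m \<in> K" using right_ideal_add_cancel[OF K, of m "a \<otimes> r"] mr ik ar mc by simp
    moreover have "i \<oplus> a \<otimes> r \<in> I" using ik ar I by (simp add: right_ideal_add)
    moreover have "y = (i \<oplus> a \<otimes> r) \<oplus> m" using ik mr c mc by (simp add: a_ac)
    ultimately show "y \<in> I <+>\<^bsub>R\<^esub> (K \<inter> M)" using mr(1) by (auto simp: set_add_mem)
  qed
qed

lemma set_add_carrier: "right_ideal R I \<Longrightarrow> I <+>\<^bsub>R\<^esub> carrier R = carrier R"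
  using set_add_ge2[OF _ right_ideal_carrier] right_ideal_subset[OF right_ideal_set_add]
    right_ideal_carrier by blast

text \<open>Supplements of \<open>I\<close> are sought among the intersections of subsets of
  \<open>G\<close>. A maximal such subset exists by finiteness and plays the part of a minimal
  supplement.\<close>

lemma radical_split_of_finite_Inter:
  assumes "finite G" "\<And>M. M \<in> G \<Longrightarrow> maximal_right_ideal R M" "carrier R \<inter> \<Inter>G \<subseteq> J"
  shows "radical_split R"
proof (rule radical_splitI)
  fix I assume I: "right_ideal R I"
  let ?K = "\<lambda>H. carrier R \<inter> \<Inter>H"
  define F where "F = {H. H \<subseteq> G \<and> I <+>\<^bsub>R\<^esub> ?K H = carrier R}"
  have "{} \<in> F" using I set_add_carrier by (simp add: F_def)
  moreover have "F \<subseteq> Pow G" by (auto simp: F_def)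
  then have "finite F" using assms(1) by (simp add: finite_subset)
  ultimately have "\<exists>H\<in>F. \<forall>H'\<in>F. H \<subseteq> H' \<longrightarrow> H = H'" by (intro finite_has_maximal) auto
  then obtain H where HF: "H \<in> F" and H': "\<forall>H'\<in>F. H \<subseteq> H' \<longrightarrow> H = H'" ..
  have H: "H \<subseteq> G" "I <+>\<^bsub>R\<^esub> ?K H = carrier R" using HF by (simp_all add: F_def)
  have K: "right_ideal R (?K H)"
    using H(1) assms(2) by (intro right_ideal_Inter) (auto simp: maximal_right_ideal_def)
  have "I \<inter> ?K H \<subseteq> J"
  proof (rule subsetI, rule ccontr)
    fix a assume a: "a \<in> I \<inter> ?K H" "a \<notin> J"
    then obtain M where M: "M \<in> G" "a \<notin> M" using assms(3) by blast
    have "I <+>\<^bsub>R\<^esub> (?K H \<inter> M) = carrier R"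
      using comaximal_shrink[OF I K H(2) assms(2)[OF M(1)] _ _ M(2)] a by simp
    moreover have "?K H \<inter> M = ?K (insert M H)" by auto
    ultimately have "insert M H \<in> F" using H(1) M(1) by (simp add: F_def)
    then have "H = insert M H" using H' by blast
    then have "M \<in> H" by blast
    then show False using a M by blast
  qed
  then show "\<exists>K. right_ideal R K \<and> I <+>\<^bsub>R\<^esub> K = carrier R \<and> I \<inter> K \<subseteq> J"
    using H(2) K by (intro exI[of _ "?K H"] conjI)
qed

text \<open>Supplements above \<open>J\<close> suffice: cutting one down by a maximal right ideal
  keeps it above \<open>J\<close>, so the chain condition is needed only there.\<close>

lemma radical_split_of_DCC:
  assumes "DCC (over_J R)"
  shows "radical_split R"
proof (rule radical_splitI)
  fix I assume I: "right_ideal R I"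
  have "over_J R (carrier R)"
    using right_ideal_carrier right_ideal_subset[OF J_right] by (simp add: over_J_def)
  then obtain K where K: "over_J R K" "I <+>\<^bsub>R\<^esub> K = carrier R"
    "\<And>K'. over_J R K' \<Longrightarrow> I <+>\<^bsub>R\<^esub> K' = carrier R \<Longrightarrow> K' \<subseteq> K \<Longrightarrow> K' = K"
    using DCC_minimal[OF assms, of "carrier R" "\<lambda>K. I <+>\<^bsub>R\<^esub> K = carrier R"]
      set_add_carrier[OF I] by blast
  have "I \<inter> K \<subseteq> J"
  proof (rule subsetI, rule ccontr)
    fix a assume a: "a \<in> I \<inter> K" "a \<notin> J"
    then have "a \<in> carrier R" using I right_ideal_carr by blast
    then obtain M where M: "maximal_right_ideal R M" "a \<notin> M"
      using a by (auto simp: jacobson_radical_def)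
    have "I <+>\<^bsub>R\<^esub> (K \<inter> M) = carrier R"
      using comaximal_shrink[OF I _ K(2) M(1) _ _ M(2)] a K(1) by (auto simp: over_J_def)
    moreover have "over_J R (K \<inter> M)"
      using K(1) J_le_maximal[OF M(1)] right_ideal_Int[of K M] maximal_right_idealD(1)[OF M(1)]
      by (simp add: over_J_def)
    ultimately have "K \<inter> M = K" using K(3) by blast
    then show False using a M by blast
  qed
  then show "\<exists>K. right_ideal R K \<and> I <+>\<^bsub>R\<^esub> K = carrier R \<and> I \<inter> K \<subseteq> J"
    by (intro exI[of _ K] conjI K(2) K(1)[unfolded over_J_def, THEN conjunct1])
qed

lemma radical_split_of_right_artinian: "right_artinian R \<Longrightarrow> radical_split R"
  unfolding right_artinian_def
  by (rule radical_split_of_DCC, erule DCC_mono) (simp add: over_J_def)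

lemma mem_of_cong_mult:
  "cong a (f \<otimes> a) \<Longrightarrow> f \<in> I \<Longrightarrow> over_J R I \<Longrightarrow> a \<in> I"
  using cong_mem[of a "f \<otimes> a" I] right_ideal_mult[of I f a] by (auto simp: over_J_def cong_def)

text \<open>Modulo \<open>J\<close> the union of the chain is generated by one element, which occurs
  at a finite stage.\<close>

lemma radical_split_ACC:
  assumes "radical_split R"
  shows "ACC (over_J R)"
  unfolding ACC_def
proof (intro allI impI)
  fix A :: "nat \<Rightarrow> 'a set" assume A: "\<forall>n. over_J R (A n) \<and> A n \<subseteq> A (Suc n)"
  have "right_ideal R (\<Union>n. A n)"
  proof (rule right_ideal_UN_mono)
    show "right_ideal R (A n)" for n using A unfolding over_J_def by blast
    show "A n \<subseteq> A (Suc n)" for n using A by blast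
  qed
  from radical_split_ex[OF assms this]
  obtain f where f: "f \<in> (\<Union>n. A n)" "\<forall>a\<in>(\<Union>n. A n). cong a (f \<otimes> a)" ..
  from f(1) obtain N where N: "f \<in> A N" by (rule UN_E)
  have mono: "A i \<subseteq> A j" if "i \<le> j" for i j
    using lift_Suc_mono_le[of A, OF A[rule_format, THEN conjunct2] that] .
  have le: "A n \<subseteq> A N" for n
  proof
    fix a assume "a \<in> A n"
    then have "cong a (f \<otimes> a)" using f(2) by blast
    then show "a \<in> A N" by (rule mem_of_cong_mult) (use N A in blast)+
  qed
  have "\<forall>n\<ge>N. A n = A N" using mono le by (meson subset_antisym)
  then show "\<exists>N. \<forall>n\<ge>N. A n = A N" by blast
qed

text \<open>
  Choosing the next idempotent in \<open>R f\<close>, where \<open>f\<close> is the previous one, makes the complements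
  \<open>{x. f x \<in> J}\<close> ascend.
\<close>

lemma radical_split_DCC:
  assumes S: "radical_split R"
  shows "DCC (over_J R)"
  unfolding DCC_def
proof (intro allI impI)
  fix A :: "nat \<Rightarrow> 'a set" assume A: "\<forall>n. over_J R (A n) \<and> A (Suc n) \<subseteq> A n"
  have AR: "right_ideal R (A n)" for n using A by (simp add: over_J_def)
  have anti: "A j \<subseteq> A i" if "i \<le> j" for i j
    using lift_Suc_antimono_le[of A, OF A[rule_format, THEN conjunct2] that] .
  let ?P = "\<lambda>n f. f \<in> A n \<and> (\<forall>a\<in>A n. cong a (f \<otimes> a))"
  have "\<exists>g. ?P n g" for n using radical_split_ex[OF S AR[of n]] by blast
  then obtain g where g: "\<And>n. ?P n (g n)" by metis
  have gc: "g n \<in> carrier R" for n using g AR right_ideal_carr by blast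
  define f where "f = rec_nat (g 0) (\<lambda>n h. g (Suc n) \<otimes> h)"
  have f0: "f 0 = g 0" and fS: "f (Suc n) = g (Suc n) \<otimes> f n" for n by (simp_all add: f_def)
  have fc: "f n \<in> carrier R" for n by (induction n) (simp_all add: f0 fS gc)
  have f: "?P n (f n)" for n
  proof (induction n)
    case 0 show ?case using g f0 by simp
  next
    case (Suc n)
    have "cong a (f (Suc n) \<otimes> a)" if a: "a \<in> A (Suc n)" for a
    proof -
      have ac: "a \<in> carrier R" using a AR right_ideal_carr by blast
      have "a \<in> A n" using a anti[of n "Suc n"] by auto
      then have fa: "cong (f n \<otimes> a) a" using Suc cong_sym by blast
      have "cong a (g (Suc n) \<otimes> a)" using g a by blast
      also have "cong \<dots> (g (Suc n) \<otimes> (f n \<otimes> a))"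
        using cong_sym[OF fa] cong_refl[OF gc] by (intro cong_mult)
      finally show ?thesis using gc fc ac by (simp add: fS m_assoc)
    qed
    moreover have "f (Suc n) \<in> A (Suc n)" unfolding fS using g fc AR by (intro right_ideal_mult) auto
    ultimately show ?case by blast
  qed
  define D where "D n = {x \<in> carrier R. f n \<otimes> x \<in> J}" for n
  have DR: "over_J R (D n)" for n
    using right_ideal_preimage[OF J_right fc[of n]] fc
    by (auto simp: over_J_def D_def J_carr J_mult_left)
  have "D n \<subseteq> D (Suc n)" for n
    using gc fc by (auto simp: D_def fS m_assoc J_mult_left)
  then obtain N where N: "\<And>n. n \<ge> N \<Longrightarrow> D n = D N"
    using radical_split_ACC[OF S] DR unfolding ACC_def by blast
  \<comment> \<open>For \<open>a\<close> in \<open>A N\<close> the element \<open>a - f n a\<close>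
    is sent into \<open>J\<close> by \<open>f n\<close>, hence by \<open>f N\<close> as
    \<open>D n = D N\<close>. But \<open>f N\<close> fixes it modulo \<open>J\<close>, since it lies
    in \<open>A N\<close>; so it is in \<open>J\<close>.\<close>
  have "A N \<subseteq> A n" if n: "n \<ge> N" for n
  proof
    fix a assume a: "a \<in> A N"
    have ac: "a \<in> carrier R" using a AR right_ideal_carr by blast
    have mem: "a \<ominus> f n \<otimes> a \<in> A N"
      using a f[of n] anti[OF n] AR[of N] ac by (blast intro: right_ideal_minus right_ideal_mult)
    have fn: "cong (f n) (f n \<otimes> f n)" using f by blast
    have "cong (f n \<otimes> a) ((f n \<otimes> f n) \<otimes> a)" using fn ac by (intro cong_mult cong_refl)
    then have "f n \<otimes> (a \<ominus> f n \<otimes> a) \<in> J"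
      using fc ac by (simp add: cong_def r_distr_minus m_assoc)
    then have "a \<ominus> f n \<otimes> a \<in> D n" using fc ac by (simp add: D_def)
    then have "a \<ominus> f n \<otimes> a \<in> D N" unfolding N[OF n] .
    then have "f N \<otimes> (a \<ominus> f n \<otimes> a) \<in> J" by (simp add: D_def)
    moreover have "cong (a \<ominus> f n \<otimes> a) (f N \<otimes> (a \<ominus> f n \<otimes> a))" using f mem by blast
    ultimately have "a \<ominus> f n \<otimes> a \<in> J" using cong_J by blast
    then have "cong a (f n \<otimes> a)" using ac fc by (simp add: cong_def)
    then show "a \<in> A n" using mem_of_cong_mult f A by blast
  qed
  then have "\<forall>n\<ge>N. A n = A N" using anti by blast
  then show "\<exists>N. \<forall>n\<ge>N. A n = A N" by blast
qed

text \<open>The element splitting off \<open>b R\<close> has the form \<open>b s\<close> and fixes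
  \<open>b\<close> modulo \<open>J\<close>.\<close>

lemma radical_split_regular:
  assumes "radical_split R" "b \<in> carrier R"
  obtains s where "s \<in> carrier R" "cong b (b \<otimes> s \<otimes> b)"
proof -
  from radical_split_ex[OF assms(1) right_ideal_rPIdl[OF assms(2)]]
  obtain f where f: "f \<in> rPIdl b" "\<forall>a\<in>rPIdl b. cong a (f \<otimes> a)" ..
  then obtain s where "s \<in> carrier R" "f = b \<otimes> s" by (auto simp: rPIdl_def)
  then show thesis using that f(2)[rule_format, OF rPIdl_mem[OF assms(2)]] by simp
qed

lemma left_ideal_simps:
  assumes "right_ideal (opp_ring R) L"
  shows "x \<in> L \<Longrightarrow> x \<in> carrier R" "\<zero> \<in> L" "x \<in> L \<Longrightarrow> y \<in> L \<Longrightarrow> x \<oplus> y \<in> L"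
    "x \<in> L \<Longrightarrow> r \<in> carrier R \<Longrightarrow> r \<otimes> x \<in> L" "x \<in> L \<Longrightarrow> y \<in> L \<Longrightarrow> x \<ominus> y \<in> L"
proof -
  interpret op: ring "opp_ring R" by (rule ring_opp)
  show a: "x \<in> L \<Longrightarrow> x \<in> carrier R" for x using op.right_ideal_carr[OF assms] by simp
  show "\<zero> \<in> L" "x \<in> L \<Longrightarrow> y \<in> L \<Longrightarrow> x \<oplus> y \<in> L" "x \<in> L \<Longrightarrow> r \<in> carrier R \<Longrightarrow> r \<otimes> x \<in> L"
    using op.right_ideal_simps[OF assms] by simp_all
  show "x \<in> L \<Longrightarrow> y \<in> L \<Longrightarrow> x \<ominus> y \<in> L"
    using op.right_ideal_minus[OF assms, of x y] by (simp add: a)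
qed

lemma cong_opp [simp]: "ring.cong (opp_ring R) x y \<longleftrightarrow> cong x y"
proof -
  interpret op: ring "opp_ring R" by (rule ring_opp)
  show ?thesis by (auto simp: op.cong_def cong_def)
qed

text \<open>
  For a left ideal \<open>L\<close> take \<open>f \<in> L\<close> idempotent modulo \<open>J\<close> with \<open>{x. f x \<in> J}\<close> minimal. If
  \<open>b = a - a f \<notin> J\<close> with \<open>a \<in> L\<close> and \<open>b s b \<equiv> b\<close>, then \<open>g = s b\<close> enlarges \<open>f\<close> to
  \<open>f + g - f g\<close>.
\<close>

lemma radical_split_opp:
  assumes S: "radical_split R"
  shows "radical_split (opp_ring R)"
  unfolding radical_split_def
proof (intro allI impI)
  fix L assume L: "right_ideal (opp_ring R) L"
  note Ls = left_ideal_simps[OF L]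
  define D where "D f = {x \<in> carrier R. f \<otimes> x \<in> J}" for f
  have DR: "over_J R (D f)" if "f \<in> carrier R" for f
    using right_ideal_preimage[OF J_right that] that by (auto simp: over_J_def D_def J_carr J_mult_left)
  let ?Q = "\<lambda>X. \<exists>f\<in>L. cong (f \<otimes> f) f \<and> X = D f"
  have "?Q (D \<zero>)" using Ls(2) by (intro bexI[of _ \<zero>]) (simp_all add: cong_refl)
  then obtain X where X: "over_J R X" "?Q X" "\<And>Y. over_J R Y \<Longrightarrow> ?Q Y \<Longrightarrow> Y \<subseteq> X \<Longrightarrow> Y = X"
    using DCC_minimal[OF radical_split_DCC[OF S], of "D \<zero>" ?Q] DR[OF zero_closed] by blast
  then obtain f where f: "f \<in> L" "cong (f \<otimes> f) f" "X = D f" by blast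
  have fc: "f \<in> carrier R" using f(1) by (rule Ls(1))
  have "a \<ominus> a \<otimes> f \<in> J" if a: "a \<in> L" for a
  proof (rule ccontr)
    assume nJ: "a \<ominus> a \<otimes> f \<notin> J"
    define b where "b = a \<ominus> a \<otimes> f"
    have ac: "a \<in> carrier R" using a by (rule Ls(1))
    have bc: "b \<in> carrier R" using ac fc by (simp add: b_def)
    have bL: "b \<in> L" unfolding b_def using a f(1) ac by (intro Ls(5) Ls(4))
    have "cong (b \<otimes> f) (a \<otimes> f \<ominus> a \<otimes> f)"
    proof -
      have "b \<otimes> f = a \<otimes> f \<ominus> a \<otimes> (f \<otimes> f)" using ac fc by (simp add: b_def l_distr_minus m_assoc)
      also have "cong \<dots> (a \<otimes> f \<ominus> a \<otimes> f)"
        using ac fc f(2) by (intro cong_minus cong_mult cong_refl) auto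
      finally show ?thesis .
    qed
    then have bf: "cong (b \<otimes> f) \<zero>" using ac fc by (simp add: a_minus_def r_neg)
    obtain s where s: "s \<in> carrier R" "cong b (b \<otimes> s \<otimes> b)" using radical_split_regular[OF S bc] by blast
    define g where "g = s \<otimes> b"
    have gc: "g \<in> carrier R" and gL: "g \<in> L" using s bc bL by (simp_all add: g_def Ls(4))
    have bg: "cong (b \<otimes> g) b" using s bc cong_sym by (auto simp: g_def m_assoc)
    have gf: "cong (g \<otimes> f) \<zero>"
      using cong_mult[OF cong_refl[OF s(1)] bf] s bc fc by (simp add: g_def m_assoc)
    have gg: "cong (g \<otimes> g) g"
      using cong_mult[OF cong_refl[OF s(1)] bg] s bc gc by (simp add: g_def m_assoc)
    \<comment> \<open>Modulo \<open>J\<close>, \<open>f h = f\<close> makes \<open>D h\<close> part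
      of \<open>D f\<close>, \<open>g h = g\<close> with \<open>b g = b\<close> makes
      \<open>b\<close> send \<open>D h\<close> to zero, and both together make \<open>h\<close>
      idempotent.\<close>
    define h where "h = f \<oplus> (g \<ominus> f \<otimes> g)"
    have hc: "h \<in> carrier R" using fc gc by (simp add: h_def)
    have hL: "h \<in> L" unfolding h_def using f(1) gL fc gc by (intro Ls(3) Ls(5) Ls(4))
    have fh: "cong (f \<otimes> h) f"
    proof -
      have "f \<otimes> h = f \<otimes> f \<oplus> (f \<otimes> g \<ominus> f \<otimes> f \<otimes> g)"
        using fc gc by (simp add: h_def r_distr r_distr_minus m_assoc)
      also have "cong \<dots> (f \<oplus> (f \<otimes> g \<ominus> f \<otimes> g))"
        using fc gc f(2) by (intro cong_add cong_minus cong_mult cong_refl) auto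
      finally show ?thesis using fc gc by (simp add: a_minus_def r_neg)
    qed
    have gh: "cong (g \<otimes> h) g"
    proof -
      have "g \<otimes> h = g \<otimes> f \<oplus> (g \<otimes> g \<ominus> g \<otimes> f \<otimes> g)"
        using fc gc by (simp add: h_def r_distr r_distr_minus m_assoc)
      also have "cong \<dots> (\<zero> \<oplus> (g \<ominus> \<zero> \<otimes> g))"
        using fc gc gg gf by (intro cong_add cong_minus cong_mult cong_refl) auto
      finally show ?thesis using gc by (simp add: a_minus_def)
    qed
    have "cong (h \<otimes> h) h"
    proof -
      have "h \<otimes> h = f \<otimes> h \<oplus> (g \<otimes> h \<ominus> f \<otimes> (g \<otimes> h))"
        using fc gc hc h_def l_distr l_distr_minus m_assoc by (metis m_closed minus_closed)
      also have "cong \<dots> (f \<oplus> (g \<ominus> f \<otimes> g))"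
        using fc gc fh gh by (intro cong_add cong_minus cong_mult cong_refl) auto
      finally show ?thesis by (simp add: h_def)
    qed
    then have Q: "?Q (D h)" using hL by blast
    have DhJ: "f \<otimes> x \<in> J" "b \<otimes> x \<in> J" if x: "x \<in> D h" for x
    proof -
      have xc: "x \<in> carrier R" and hx: "h \<otimes> x \<in> J" using x by (auto simp: D_def)
      have "cong (f \<otimes> h \<otimes> x) (f \<otimes> x)" using fh xc by (intro cong_mult cong_refl)
      moreover have "f \<otimes> h \<otimes> x \<in> J" using hx fc hc xc by (simp add: m_assoc J_mult_left)
      ultimately show "f \<otimes> x \<in> J" using cong_J by blast
      have "cong (b \<otimes> (g \<otimes> h)) (b \<otimes> g)" using gh bc by (intro cong_mult cong_refl)
      also have "cong \<dots> b" by (rule bg)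
      finally have "cong (b \<otimes> (g \<otimes> h) \<otimes> x) (b \<otimes> x)" using xc by (intro cong_mult cong_refl)
      moreover have "b \<otimes> (g \<otimes> h) \<otimes> x \<in> J"
        using hx bc gc hc xc by (simp add: m_assoc J_mult_left)
      ultimately show "b \<otimes> x \<in> J" using cong_J by blast
    qed
    have "D h \<subseteq> X" using DhJ by (auto simp: f(3) D_def)
    then have "D h = X" using X(3) DR[OF hc] Q by blast
    \<comment> \<open>This element shows that \<open>D h\<close> is strictly smaller: it lies in
      \<open>D f\<close>, but \<open>b (1 - f)\<close> is congruent to \<open>b\<close>, which is
      not in \<open>J\<close>.\<close>
    moreover have "\<one> \<ominus> f \<in> D f"
      using cong_sym[OF f(2)] fc by (simp add: D_def cong_def r_distr_minus)
    ultimately have "\<one> \<ominus> f \<in> D h" using f(3) by simp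
    then have "b \<otimes> (\<one> \<ominus> f) \<in> J" by (rule DhJ)
    moreover have "cong (b \<otimes> (\<one> \<ominus> f)) (b \<ominus> \<zero>)"
      using bf bc fc cong_minus[OF cong_refl bf, of b] by (simp add: r_distr_minus)
    ultimately have "b \<ominus> \<zero> \<in> J" using cong_J by blast
    then show False using nJ bc by (simp add: a_minus_def b_def)
  qed
  then show "\<exists>f\<in>L. \<forall>a\<in>L. a \<ominus>\<^bsub>opp_ring R\<^esub> f \<otimes>\<^bsub>opp_ring R\<^esub> a \<in> jacobson_radical (opp_ring R)"
    using f(1) Ls(1) by auto
qed

lemma radical_split_opp_iff: "radical_split (opp_ring R) \<longleftrightarrow> radical_split R"
proof -
  interpret op: ring "opp_ring R" by (rule ring_opp)
  show ?thesis using radical_split_opp op.radical_split_opp by auto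
qed


section \<open>The quotient \<open>R/J\<close>, read through right ideals of \<open>R\<close> above
  \<open>J\<close>\<close>

abbreviation quot :: "'a set ring" where "quot \<equiv> R Quot J"
abbreviation proj :: "'a \<Rightarrow> 'a set" where "proj x \<equiv> J +>\<^bsub>R\<^esub> x"

lemma ring_quot: "ring quot"
  using ideal_J by (rule ideal.quotient_is_ring)

lemma carrier_quot: "carrier quot = proj ` carrier R"
  by (auto simp: FactRing_simps)

lemma mult_quot: "x \<in> carrier R \<Longrightarrow> y \<in> carrier R \<Longrightarrow> proj x \<otimes>\<^bsub>quot\<^esub> proj y = proj (x \<otimes> y)"
  using ideal.rcoset_mult_add[OF ideal_J] by (simp add: FactRing_def)

lemma add_quot: "x \<in> carrier R \<Longrightarrow> y \<in> carrier R \<Longrightarrow> proj x \<oplus>\<^bsub>quot\<^esub> proj y = proj (x \<oplus> y)"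
  using ring_hom_add[OF ideal.rcos_ring_hom[OF ideal_J]] by simp

lemma proj_eq: "x \<in> carrier R \<Longrightarrow> y \<in> carrier R \<Longrightarrow> proj x = proj y \<longleftrightarrow> cong x y"
proof -
  assume c: "x \<in> carrier R" "y \<in> carrier R"
  interpret I: abelian_subgroup J R
    using ideal_J by (simp add: abelian_subgroupI3 ideal.axioms(1) is_abelian_group)
  have "x \<in> proj y \<longleftrightarrow> cong x y"
    using I.a_rcos_module_minus[OF ring_axioms c(2,1)] c by (simp add: cong_def)
  moreover have "proj x = proj y \<longleftrightarrow> x \<in> proj y"
    using I.a_rcos_self[OF c(1)] a_repr_independence[OF _ c(2) I.a_subgroup, of x] by blast
  ultimately show ?thesis by simp
qed

lemma zero_quot: "\<zero>\<^bsub>quot\<^esub> = proj \<zero>"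
  by (simp add: FactRing_def a_coset_add_zero right_ideal_subset[OF J_right])

lemma right_ideal_proj_image:
  assumes "right_ideal R I"
  shows "right_ideal quot (proj ` I)"
proof (rule ring.right_idealI[OF ring_quot])
  note c = right_ideal_carr[OF assms]
  show "proj ` I \<subseteq> carrier quot" using right_ideal_subset[OF assms] by (auto simp: carrier_quot)
  show "\<zero>\<^bsub>quot\<^esub> \<in> proj ` I" using right_ideal_zero[OF assms] by (simp add: zero_quot)
  show "x \<oplus>\<^bsub>quot\<^esub> y \<in> proj ` I" if "x \<in> proj ` I" "y \<in> proj ` I" for x y
    using that by (auto simp: add_quot c right_ideal_add[OF assms])
  show "x \<otimes>\<^bsub>quot\<^esub> r \<in> proj ` I" if "x \<in> proj ` I" "r \<in> carrier quot" for x r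
    using that by (auto simp: carrier_quot mult_quot c right_ideal_mult[OF assms])
qed

lemma proj_mem_image:
  assumes "over_J R I" "x \<in> carrier R"
  shows "proj x \<in> proj ` I \<longleftrightarrow> x \<in> I"
proof
  assume "proj x \<in> proj ` I"
  then obtain y where y: "y \<in> I" "proj x = proj y" by blast
  have "y \<in> carrier R" using y(1) assms(1) by (auto simp: over_J_def right_ideal_carr)
  then have "cong x y" using y(2) assms(2) by (simp add: proj_eq)
  then show "x \<in> I" using y(1) assms(1) cong_mem by (simp add: over_J_def)
qed simp

definition lift_ideal :: "'a set set \<Rightarrow> 'a set" where
  "lift_ideal K = {x \<in> carrier R. proj x \<in> K}"

lemma over_J_lift:
  assumes "right_ideal quot K"
  shows "over_J R (lift_ideal K)"
proof -
  interpret Q: ring quot by (rule ring_quot)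
  note Ks = Q.right_ideal_zero[OF assms] Q.right_ideal_add[OF assms] Q.right_ideal_mult[OF assms]
  have "right_ideal R (lift_ideal K)"
  proof (rule right_idealI)
    show "\<zero> \<in> lift_ideal K" using Ks(1) by (simp add: lift_ideal_def zero_quot)
    show "x \<oplus> y \<in> lift_ideal K" if "x \<in> lift_ideal K" "y \<in> lift_ideal K" for x y
      using that Ks(2)[of "proj x" "proj y"] by (simp add: lift_ideal_def add_quot)
    show "x \<otimes> r \<in> lift_ideal K" if "x \<in> lift_ideal K" "r \<in> carrier R" for x r
      using that Ks(3)[of "proj x" "proj r"] by (simp add: lift_ideal_def mult_quot carrier_quot)
  qed (auto simp: lift_ideal_def)
  moreover have "x \<in> lift_ideal K" if "x \<in> J" for x
  proof -
    have "proj x = proj \<zero>" using that by (simp add: proj_eq J_carr cong_zero)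
    then show ?thesis using that Ks(1) by (simp add: lift_ideal_def J_carr zero_quot)
  qed
  ultimately show ?thesis by (auto simp: over_J_def)
qed

lemma proj_lift: "right_ideal quot K \<Longrightarrow> proj ` lift_ideal K = K"
proof -
  assume "right_ideal quot K"
  then have "K \<subseteq> proj ` carrier R" using ring.right_ideal_subset[OF ring_quot] carrier_quot by blast
  then show ?thesis by (auto simp: lift_ideal_def)
qed

lemma lift_proj: "over_J R I \<Longrightarrow> lift_ideal (proj ` I) = I"
  using right_ideal_carr[of I] proj_mem_image[of I] by (auto simp: lift_ideal_def over_J_def)

lemma right_artinian_quot: "right_artinian quot \<longleftrightarrow> DCC (over_J R)"
proof
  assume a: "right_artinian quot"
  show "DCC (over_J R)"
    unfolding DCC_def
  proof (intro allI impI)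
    fix A :: "nat \<Rightarrow> 'a set" assume A: "\<forall>n. over_J R (A n) \<and> A (Suc n) \<subseteq> A n"
    have "\<exists>N. \<forall>n\<ge>N. proj ` A n = proj ` A N"
      using A right_ideal_proj_image
      by (intro DCC_stable[OF a[unfolded right_artinian_def], of "\<lambda>n. proj ` A n"] image_mono)
        (simp_all add: over_J_def)
    then obtain N where N: "\<forall>n\<ge>N. proj ` A n = proj ` A N" ..
    have "A n = A N" if "n \<ge> N" for n
      using N[rule_format, OF that] lift_proj A by metis
    then show "\<exists>N. \<forall>n\<ge>N. A n = A N" by blast
  qed
next
  assume a: "DCC (over_J R)"
  show "right_artinian quot"
    unfolding right_artinian_def DCC_def
  proof (intro allI impI)
    fix A :: "nat \<Rightarrow> 'a set set" assume A: "\<forall>n. right_ideal quot (A n) \<and> A (Suc n) \<subseteq> A n"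
    have "\<exists>N. \<forall>n\<ge>N. lift_ideal (A n) = lift_ideal (A N)"
    proof (rule DCC_stable[OF a])
      show "over_J R (lift_ideal (A n))" for n using A over_J_lift by blast
      show "lift_ideal (A (Suc n)) \<subseteq> lift_ideal (A n)" for n using A by (auto simp: lift_ideal_def)
    qed
    then obtain N where N: "\<forall>n\<ge>N. lift_ideal (A n) = lift_ideal (A N)" ..
    have "A n = A N" if "n \<ge> N" for n
      using N[rule_format, OF that] proj_lift A by metis
    then show "\<exists>N. \<forall>n\<ge>N. A n = A N" by blast
  qed
qed

lemma semilocal_imp_radical_split: "semilocal R \<Longrightarrow> radical_split R"
  using radical_split_of_DCC right_artinian_quot by (simp add: semilocal_def semisimple_artinian_def)

text \<open>Let \<open>K\<close> be a proper right ideal of \<open>R/J\<close> containing all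
  minimal ones, and let \<open>f\<close> split off its preimage. Then \<open>D\<close>, the elements
  sent into \<open>J\<close> by \<open>f\<close>, is larger than \<open>J\<close>. A minimal right
  ideal above \<open>J\<close> inside \<open>D\<close> becomes minimal in \<open>R/J\<close>, so it
  lies in \<open>K\<close>; there \<open>f\<close> acts as the identity modulo \<open>J\<close>, on
  \<open>D\<close> as zero.\<close>

lemma radical_split_imp_semilocal:
  assumes S: "radical_split R"
  shows "semilocal R"
proof -
  interpret Q: ring quot by (rule ring_quot)
  have "carrier quot \<subseteq> K"
    if K: "right_ideal quot K" and min: "\<And>T. minimal_right_ideal quot T \<Longrightarrow> T \<subseteq> K" for K
  proof (rule ccontr)
    assume n: "\<not> carrier quot \<subseteq> K"
    let ?I = "lift_ideal K"
    have I: "over_J R ?I" using K by (rule over_J_lift)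
    then have IR: "right_ideal R ?I" by (simp add: over_J_def)
    obtain f where f: "f \<in> ?I" "\<forall>a\<in>?I. cong a (f \<otimes> a)" using radical_split_ex[OF S IR] by blast
    have fc: "f \<in> carrier R" using f(1) by (simp add: lift_ideal_def)
    define D where "D = {x \<in> carrier R. f \<otimes> x \<in> J}"
    have D: "over_J R D" using right_ideal_preimage[OF J_right fc] fc
      by (auto simp: over_J_def D_def J_carr J_mult_left)
    have "\<one> \<ominus> f \<in> D"
      using f fc by (auto simp: D_def cong_def r_distr_minus)
    moreover have "\<one> \<ominus> f \<notin> J"
    proof
      assume "\<one> \<ominus> f \<in> J"
      then have "cong \<one> f" using fc by (simp add: cong_def)
      then have "\<one> \<in> ?I" using cong_mem[of \<one> f ?I] I f(1) by (simp add: over_J_def)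
      then have "?I = carrier R" using IR right_ideal_one by blast
      then show False using n proj_lift[OF K] carrier_quot by simp
    qed
    ultimately have "D \<noteq> J" by blast
    then obtain T where T: "over_J R T" "T \<noteq> J \<and> T \<subseteq> D"
      "\<And>C. over_J R C \<Longrightarrow> C \<noteq> J \<and> C \<subseteq> D \<Longrightarrow> C \<subseteq> T \<Longrightarrow> C = T"
      using DCC_minimal[OF radical_split_DCC[OF S] D, of "\<lambda>C. C \<noteq> J \<and> C \<subseteq> D"] by blast
    have TR: "right_ideal R T" using T(1) by (simp add: over_J_def)
    have JJ: "over_J R J" using J_right by (simp add: over_J_def)
    have "minimal_right_ideal quot (proj ` T)"
      unfolding minimal_right_ideal_def
    proof (intro conjI allI impI)
      show "right_ideal quot (proj ` T)" using TR by (rule right_ideal_proj_image)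
      have "x \<in> lift_ideal {\<zero>\<^bsub>quot\<^esub>} \<longleftrightarrow> x \<in> J" for x
        unfolding lift_ideal_def zero_quot mem_Collect_eq singleton_iff
        using J_carr proj_eq[OF _ zero_closed] cong_zero by metis
      then have z: "lift_ideal {\<zero>\<^bsub>quot\<^esub>} = J" by blast
      then show "proj ` T \<noteq> {\<zero>\<^bsub>quot\<^esub>}" using lift_proj[OF T(1)] T(2) by metis
      fix L assume L: "right_ideal quot L \<and> L \<subseteq> proj ` T"
      have LR: "over_J R (lift_ideal L)" using L by (intro over_J_lift) simp
      have LT: "lift_ideal L \<subseteq> T"
        using L lift_proj[OF T(1)] by (auto simp: lift_ideal_def)
      show "L = {\<zero>\<^bsub>quot\<^esub>} \<or> L = proj ` T"
      proof (cases "lift_ideal L = J")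
        case True
        then have "L = {\<zero>\<^bsub>quot\<^esub>}"
          using z proj_lift[of L] proj_lift[OF Q.right_ideal_trivial] L by metis
        then show ?thesis ..
      next
        case False
        then have "lift_ideal L = T" using T(2,3) LR LT by blast
        then show ?thesis using proj_lift[of L] L by metis
      qed
    qed
    then have "proj ` T \<subseteq> K" by (rule min)
    then have TI: "T \<subseteq> ?I" using right_ideal_subset[OF TR] by (auto simp: lift_ideal_def)
    have "T \<subseteq> J"
    proof
      fix t assume t: "t \<in> T"
      then have "cong t (f \<otimes> t)" using TI f(2) by blast
      moreover have "f \<otimes> t \<in> J" using t T(2) by (auto simp: D_def)
      ultimately show "t \<in> J" using cong_J by blast
    qed
    then show False using T(1,2) by (auto simp: over_J_def)
  qed
  moreover have "right_socle quot \<subseteq> carrier quot"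
    using Q.right_ideal_carrier Q.right_ideal_subset
    by (auto simp: right_socle_def minimal_right_ideal_def)
  ultimately have "right_socle quot = carrier quot" by (auto simp: right_socle_def)
  then show ?thesis
    using right_artinian_quot radical_split_DCC[OF S]
    by (simp add: semilocal_def semisimple_artinian_def)
qed

lemma semilocal_iff: "semilocal R \<longleftrightarrow> radical_split R"
  using semilocal_imp_radical_split radical_split_imp_semilocal by blast

lemma von_Neumann_regular_quot:
  "von_Neumann_regular quot \<longleftrightarrow> (\<forall>x\<in>carrier R. \<exists>y\<in>carrier R. cong (x \<otimes> y \<otimes> x) x)"
  by (simp add: von_Neumann_regular_def carrier_quot mult_quot proj_eq)


section \<open>Injectivity\<close>

lemma linear_on_carrier:
  "linear_on R (carrier R) g \<Longrightarrow> x \<in> carrier R \<Longrightarrow> g x = g \<one> \<otimes> x"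
  unfolding linear_on_def by (metis l_one one_closed)

lemma linear_on_left_mult: "I \<subseteq> carrier R \<Longrightarrow> c \<in> carrier R \<Longrightarrow> linear_on R I (\<lambda>x. c \<otimes> x)"
  by (auto simp: linear_on_def r_distr m_assoc subset_iff)

text \<open>An endomorphism of \<open>R\<close> as right module over itself is left multiplication
  by the image of \<open>1\<close>, so module homomorphisms can be traded for elements.\<close>

lemma extends_iff:
  assumes "right_ideal R I"
  shows "extends_from R I \<longleftrightarrow>
    (\<forall>f\<in>right_module_hom R (right_ideal_module R I) (right_regular_module R).
       \<exists>g\<in>right_module_hom R (right_regular_module R) (right_regular_module R). \<forall>x\<in>I. g x = f x)"
proof -
  have "(\<exists>c\<in>carrier R. \<forall>x\<in>I. f x = c \<otimes> x) \<longleftrightarrow> (\<exists>g. linear_on R (carrier R) g \<and> (\<forall>x\<in>I. g x = f x))"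
    (is "?A \<longleftrightarrow> ?B") for f :: "'a \<Rightarrow> 'a"
  proof
    assume ?A
    then obtain c where c: "c \<in> carrier R" "\<forall>x\<in>I. f x = c \<otimes> x" ..
    then show ?B using linear_on_left_mult[OF subset_refl c(1)] by (intro exI[of _ "\<lambda>x. c \<otimes> x"]) simp
  next
    assume ?B
    then obtain g where g: "linear_on R (carrier R) g" "\<forall>x\<in>I. g x = f x" by blast
    have "f x = g \<one> \<otimes> x" if "x \<in> I" for x
      using linear_on_carrier[OF g(1) right_ideal_carr[OF assms that]] g(2) that by metis
    moreover have "g \<one> \<in> carrier R" using g(1) by (simp add: linear_on_def)
    ultimately show ?A by blast
  qed
  then show ?thesis by (simp add: extends_from_def module_hom_iff_linear_on Bex_def Ball_def)
qed

lemma right_small_injective_iff: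
  "right_small_injective R \<longleftrightarrow> (\<forall>I. small_right_ideal R I \<longrightarrow> extends_from R I)"
  unfolding right_small_injective_def
  using extends_iff by (auto simp: small_right_ideal_def)

lemma right_small_injective_of_baer: "right_baer R \<Longrightarrow> right_small_injective R"
  by (simp add: right_small_injective_iff right_baer_def small_right_ideal_def)

lemma right_baerD:
  assumes "right_baer R" "right_ideal R I" "linear_on R I f"
  obtains c where "c \<in> carrier R" "\<And>x. x \<in> I \<Longrightarrow> f x = c \<otimes> x"
proof -
  have "\<exists>c\<in>carrier R. \<forall>x\<in>I. f x = c \<otimes> x"
    using assms by (simp add: right_baer_def extends_from_def)
  then show thesis using that by metis
qed

lemma baer_of_small_injective:
  assumes S: "radical_split R" and inj: "right_small_injective R"
  shows "right_baer R"
  unfolding right_baer_def extends_from_def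
proof (intro allI impI)
  fix I g assume I: "right_ideal R I" and g: "linear_on R I g"
  obtain f where f: "f \<in> I" "\<forall>a\<in>I. cong a (f \<otimes> a)" using radical_split_ex[OF S I] by blast
  note Ic = right_ideal_carr[OF I]
  have fc: "f \<in> carrier R" using f(1) by (rule Ic)
  have IJ: "small_right_ideal R (I \<inter> J)"
    using I J_right by (intro small_of_le_J right_ideal_Int) auto
  have "linear_on R (I \<inter> J) g" using g by (auto simp: linear_on_def)
  then have "\<exists>c\<in>carrier R. \<forall>x\<in>I \<inter> J. g x = c \<otimes> x"
    using inj IJ unfolding right_small_injective_iff extends_from_def by simp
  then obtain c where c: "c \<in> carrier R" "\<And>x. x \<in> I \<inter> J \<Longrightarrow> g x = c \<otimes> x" by metis
  have gc: "g x \<in> carrier R" and gm: "r \<in> carrier R \<Longrightarrow> g (x \<otimes> r) = g x \<otimes> r" if "x \<in> I" for x r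
    using g that by (auto simp: linear_on_def)
  have ga: "g (x \<oplus> y) = g x \<oplus> g y" if "x \<in> I" "y \<in> I" for x y
    using g that by (auto simp: linear_on_def)
  \<comment> \<open>Split \<open>x = f x + (x - f x)\<close>. The first summand is mapped to
    \<open>g(f) x\<close>; the second lies in \<open>I \<inter> J\<close>, where \<open>g\<close> is
    multiplication by \<open>c\<close>.\<close>
  let ?d = "g f \<oplus> c \<otimes> (\<one> \<ominus> f)"
  have "g x = ?d \<otimes> x" if x: "x \<in> I" for x
  proof -
    have xc: "x \<in> carrier R" using x by (rule Ic)
    have m: "f \<otimes> x \<in> I" "x \<ominus> f \<otimes> x \<in> I"
      using f(1) x xc I by (auto intro!: right_ideal_mult right_ideal_minus)
    have "x \<ominus> f \<otimes> x \<in> J" using f(2) x by (simp add: cong_def)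
    then have 1: "g (x \<ominus> f \<otimes> x) = c \<otimes> (x \<ominus> f \<otimes> x)" using c(2) m by blast
    have "g x = g (f \<otimes> x \<oplus> (x \<ominus> f \<otimes> x))" using xc fc by (simp add: add_minus_minus)
    also have "\<dots> = g f \<otimes> x \<oplus> c \<otimes> (x \<ominus> f \<otimes> x)" using ga[OF m] gm[OF f(1) xc] 1 by simp
    also have "c \<otimes> (x \<ominus> f \<otimes> x) = c \<otimes> (\<one> \<ominus> f) \<otimes> x"
      using c(1) fc xc by (simp add: l_distr_minus m_assoc)
    finally show ?thesis using gc[OF f(1)] c(1) fc xc by (simp add: l_distr)
  qed
  then show "\<exists>c\<in>carrier R. \<forall>x\<in>I. g x = c \<otimes> x"
    using gc[OF f(1)] c(1) fc by (intro bexI[of _ ?d]) auto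
qed

section \<open>Baer's criterion\<close>

lemma right_module_carrier:
  assumes "right_module R M"
  shows "abelian_group M"
    "a \<in> carrier R \<Longrightarrow> m \<in> carrier M \<Longrightarrow> a \<odot>\<^bsub>M\<^esub> m \<in> carrier M"
    "a \<in> carrier R \<Longrightarrow> b \<in> carrier R \<Longrightarrow> m \<in> carrier M \<Longrightarrow>
       (a \<oplus> b) \<odot>\<^bsub>M\<^esub> m = a \<odot>\<^bsub>M\<^esub> m \<oplus>\<^bsub>M\<^esub> b \<odot>\<^bsub>M\<^esub> m"
    "a \<in> carrier R \<Longrightarrow> m \<in> carrier M \<Longrightarrow> n \<in> carrier M \<Longrightarrow>
       a \<odot>\<^bsub>M\<^esub> (m \<oplus>\<^bsub>M\<^esub> n) = a \<odot>\<^bsub>M\<^esub> m \<oplus>\<^bsub>M\<^esub> a \<odot>\<^bsub>M\<^esub> n"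
    "a \<in> carrier R \<Longrightarrow> b \<in> carrier R \<Longrightarrow> m \<in> carrier M \<Longrightarrow>
       (a \<otimes> b) \<odot>\<^bsub>M\<^esub> m = b \<odot>\<^bsub>M\<^esub> (a \<odot>\<^bsub>M\<^esub> m)"
    "m \<in> carrier M \<Longrightarrow> \<one> \<odot>\<^bsub>M\<^esub> m = m"
  using assms by (simp_all add: right_module_def)

lemma right_module_zero:
  assumes M: "right_module R M" and m: "m \<in> carrier M"
  shows "\<zero> \<odot>\<^bsub>M\<^esub> m = \<zero>\<^bsub>M\<^esub>" "(\<ominus> \<one>) \<odot>\<^bsub>M\<^esub> m = \<ominus>\<^bsub>M\<^esub> m"
proof -
  note Mr = right_module_carrier[OF M]
  interpret M: abelian_group M by (rule Mr(1))
  have "\<zero> \<odot>\<^bsub>M\<^esub> m \<oplus>\<^bsub>M\<^esub> \<zero> \<odot>\<^bsub>M\<^esub> m = \<zero> \<odot>\<^bsub>M\<^esub> m"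
    using Mr(3)[of \<zero> \<zero> m] m by simp
  moreover have z: "\<zero> \<odot>\<^bsub>M\<^esub> m \<in> carrier M" using m by (simp add: Mr(2))
  ultimately show 0: "\<zero> \<odot>\<^bsub>M\<^esub> m = \<zero>\<^bsub>M\<^esub>" using M.add.l_cancel_one by blast
  have "(\<ominus> \<one> \<oplus> \<one>) \<odot>\<^bsub>M\<^esub> m = (\<ominus> \<one>) \<odot>\<^bsub>M\<^esub> m \<oplus>\<^bsub>M\<^esub> m"
    using Mr(3)[of "\<ominus> \<one>" \<one> m] m by (simp add: Mr(6))
  then have "(\<ominus> \<one>) \<odot>\<^bsub>M\<^esub> m \<oplus>\<^bsub>M\<^esub> m = \<zero>\<^bsub>M\<^esub>" using 0 by (simp add: l_neg)
  then show "(\<ominus> \<one>) \<odot>\<^bsub>M\<^esub> m = \<ominus>\<^bsub>M\<^esub> m" using m Mr(2) M.minus_equality by simp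
qed

text \<open>Graphs of partial homomorphisms, the objects of the Zorn argument in Baer's criterion.\<close>

definition hom_graph :: "('a, 'm) module \<Rightarrow> ('m \<times> 'a) set \<Rightarrow> bool" where
  "hom_graph B G \<longleftrightarrow> G \<subseteq> carrier B \<times> carrier R \<and>
     (\<forall>b r b' r'. (b, r) \<in> G \<longrightarrow> (b', r') \<in> G \<longrightarrow> (b \<oplus>\<^bsub>B\<^esub> b', r \<oplus> r') \<in> G) \<and>
     (\<forall>b r. \<forall>a\<in>carrier R. (b, r) \<in> G \<longrightarrow> (a \<odot>\<^bsub>B\<^esub> b, r \<otimes> a) \<in> G) \<and>
     (\<forall>r. (\<zero>\<^bsub>B\<^esub>, r) \<in> G \<longrightarrow> r = \<zero>)"

lemma hom_graphD:
  assumes "hom_graph B G"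
  shows "(b, r) \<in> G \<Longrightarrow> b \<in> carrier B" "(b, r) \<in> G \<Longrightarrow> r \<in> carrier R"
    "(b, r) \<in> G \<Longrightarrow> (b', r') \<in> G \<Longrightarrow> (b \<oplus>\<^bsub>B\<^esub> b', r \<oplus> r') \<in> G"
    "a \<in> carrier R \<Longrightarrow> (b, r) \<in> G \<Longrightarrow> (a \<odot>\<^bsub>B\<^esub> b, r \<otimes> a) \<in> G"
    "(\<zero>\<^bsub>B\<^esub>, r) \<in> G \<Longrightarrow> r = \<zero>"
  using assms unfolding hom_graph_def by blast+

lemma hom_graph_uminus:
  assumes B: "right_module R B" and G: "hom_graph B G" and h: "(b, r) \<in> G"
  shows "(\<ominus>\<^bsub>B\<^esub> b, \<ominus> r) \<in> G"
proof -
  have "((\<ominus> \<one>) \<odot>\<^bsub>B\<^esub> b, r \<otimes> (\<ominus> \<one>)) \<in> G" using hom_graphD(4)[OF G _ h] by simp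
  moreover have "r \<otimes> (\<ominus> \<one>) = \<ominus> r" using hom_graphD(2)[OF G h] by (simp add: r_minus)
  ultimately show ?thesis using right_module_zero(2)[OF B hom_graphD(1)[OF G h]] by simp
qed

lemma hom_graph_fun:
  assumes B: "right_module R B" and G: "hom_graph B G" and h: "(b, r) \<in> G" "(b, r') \<in> G"
  shows "r = r'"
proof -
  interpret B: abelian_group B by (rule right_module_carrier(1)[OF B])
  have "(b \<oplus>\<^bsub>B\<^esub> \<ominus>\<^bsub>B\<^esub> b, r \<oplus> \<ominus> r') \<in> G"
    using h hom_graph_uminus[OF B G] hom_graphD(3)[OF G] by blast
  then have "(\<zero>\<^bsub>B\<^esub>, r \<ominus> r') \<in> G" using hom_graphD(1)[OF G h(1)] by (simp add: B.r_neg a_minus_def)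
  then have "r \<ominus> r' = \<zero>" by (rule hom_graphD(5)[OF G])
  then show ?thesis using hom_graphD(2)[OF G] h eq_iff_minus_zero by blast
qed

lemma hom_graph_Union:
  assumes "C \<noteq> {}" "\<And>G. G \<in> C \<Longrightarrow> hom_graph B G"
    "\<And>G H. G \<in> C \<Longrightarrow> H \<in> C \<Longrightarrow> G \<subseteq> H \<or> H \<subseteq> G"
  shows "hom_graph B (\<Union>C)"
  unfolding hom_graph_def
proof (intro conjI allI impI ballI)
  show "\<Union>C \<subseteq> carrier B \<times> carrier R" using assms(2) by (auto dest: hom_graphD)
next
  fix b r b' r' assume "(b, r) \<in> \<Union>C" "(b', r') \<in> \<Union>C"
  then obtain G H where GH: "G \<in> C" "H \<in> C" "(b, r) \<in> G" "(b', r') \<in> H" by blast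
  from assms(3)[OF GH(1,2)] show "(b \<oplus>\<^bsub>B\<^esub> b', r \<oplus> r') \<in> \<Union>C"
  proof
    assume "G \<subseteq> H" then show ?thesis using GH hom_graphD(3)[OF assms(2)[OF GH(2)]] by blast
  next
    assume "H \<subseteq> G" then show ?thesis using GH hom_graphD(3)[OF assms(2)[OF GH(1)]] by blast
  qed
next
  fix b r a assume "a \<in> carrier R" "(b, r) \<in> \<Union>C"
  then show "(a \<odot>\<^bsub>B\<^esub> b, r \<otimes> a) \<in> \<Union>C" using hom_graphD(4)[OF assms(2)] by blast
next
  fix r assume "(\<zero>\<^bsub>B\<^esub>, r) \<in> \<Union>C"
  then show "r = \<zero>" using hom_graphD(5)[OF assms(2)] by blast
qed

text \<open>The scalars \<open>a\<close> for which \<open>b a\<close> is in the domain of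
  \<open>G\<close> form a right ideal, on which the value at \<open>b a\<close> is a linear function
  of \<open>a\<close>. By the Baer property it is \<open>c a\<close> for some \<open>c\<close>, so
  \<open>b\<close> may be sent to \<open>c\<close>. The kernel condition for \<open>H\<close> holds
  because \<open>n + b a = 0\<close> makes \<open>a\<close> such a scalar.\<close>

lemma hom_graph_extend:
  assumes baer: "right_baer R" and B: "right_module R B" and G: "hom_graph B G"
    and z: "(\<zero>\<^bsub>B\<^esub>, \<zero>) \<in> G" and b: "b \<in> carrier B"
  obtains H r where "hom_graph B H" "G \<subseteq> H" "(b, r) \<in> H"
proof -
  note Br = right_module_carrier[OF B]
  interpret B: abelian_group B by (rule Br(1))
  note GD = hom_graphD[OF G]
  note GF = hom_graph_fun[OF B G]
  define I where "I = {a \<in> carrier R. \<exists>r. (a \<odot>\<^bsub>B\<^esub> b, r) \<in> G}"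
  define \<phi> where "\<phi> a = (SOME r. (a \<odot>\<^bsub>B\<^esub> b, r) \<in> G)" for a
  have \<phi>: "(a \<odot>\<^bsub>B\<^esub> b, \<phi> a) \<in> G" if "a \<in> I" for a
    using that unfolding \<phi>_def I_def by (auto intro: someI_ex)
  have \<phi>': "\<phi> a = r" if "(a \<odot>\<^bsub>B\<^esub> b, r) \<in> G" "a \<in> carrier R" for a r
    using GF[OF \<phi> that(1)] that by (auto simp: I_def)
  have add: "((x \<oplus> y) \<odot>\<^bsub>B\<^esub> b, \<phi> x \<oplus> \<phi> y) \<in> G" if "x \<in> I" "y \<in> I" for x y
    using GD(3)[OF \<phi>[OF that(1)] \<phi>[OF that(2)]] Br(3)[of x y b] that b by (simp add: I_def)
  have mul: "((x \<otimes> r) \<odot>\<^bsub>B\<^esub> b, \<phi> x \<otimes> r) \<in> G" if "x \<in> I" "r \<in> carrier R" for x r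
    using GD(4)[OF that(2) \<phi>[OF that(1)]] Br(5)[of x r b] that b by (simp add: I_def)
  have I: "right_ideal R I"
  proof (rule right_idealI)
    show "\<zero> \<in> I" using z right_module_zero(1)[OF B b] by (auto simp: I_def)
    show "x \<oplus> y \<in> I" if "x \<in> I" "y \<in> I" for x y using add[OF that] that by (auto simp: I_def)
    show "x \<otimes> r \<in> I" if "x \<in> I" "r \<in> carrier R" for x r using mul[OF that] that by (auto simp: I_def)
  qed (auto simp: I_def)
  have "linear_on R I \<phi>"
    unfolding linear_on_def
  proof (intro conjI ballI)
    show "\<phi> x \<in> carrier R" if "x \<in> I" for x using GD(2)[OF \<phi>[OF that]] .
    show "\<phi> (x \<oplus> y) = \<phi> x \<oplus> \<phi> y" if "x \<in> I" "y \<in> I" for x y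
      using \<phi>'[OF add[OF that]] that by (simp add: I_def)
    show "\<phi> (x \<otimes> r) = \<phi> x \<otimes> r" if "x \<in> I" "r \<in> carrier R" for x r
      using \<phi>'[OF mul[OF that]] that by (simp add: I_def)
  qed
  then obtain c where c: "c \<in> carrier R" "\<And>x. x \<in> I \<Longrightarrow> \<phi> x = c \<otimes> x"
    using right_baerD[OF baer I] by blast
  define H where "H = {(n \<oplus>\<^bsub>B\<^esub> a \<odot>\<^bsub>B\<^esub> b, g \<oplus> c \<otimes> a) | n g a. (n, g) \<in> G \<and> a \<in> carrier R}"
  have HI: "(n, g) \<in> G \<Longrightarrow> a \<in> carrier R \<Longrightarrow> x = n \<oplus>\<^bsub>B\<^esub> a \<odot>\<^bsub>B\<^esub> b \<Longrightarrow> y = g \<oplus> c \<otimes> a \<Longrightarrow> (x, y) \<in> H"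
    for n g a x y unfolding H_def by blast
  have HE: "(x, y) \<in> H \<Longrightarrow> \<exists>n g a. (n, g) \<in> G \<and> a \<in> carrier R \<and> x = n \<oplus>\<^bsub>B\<^esub> a \<odot>\<^bsub>B\<^esub> b \<and> y = g \<oplus> c \<otimes> a"
    for x y unfolding H_def by blast
  have "hom_graph B H"
    unfolding hom_graph_def
  proof (intro conjI allI impI ballI)
    show "H \<subseteq> carrier B \<times> carrier R"
    proof (rule subrelI)
      fix x y assume "(x, y) \<in> H"
      then obtain n g a where "(n, g) \<in> G" "a \<in> carrier R" "x = n \<oplus>\<^bsub>B\<^esub> a \<odot>\<^bsub>B\<^esub> b" "y = g \<oplus> c \<otimes> a"
        using HE by blast
      then show "(x, y) \<in> carrier B \<times> carrier R" using GD(1,2) Br(2) b c(1) by simp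
    qed
  next
    fix x y x' y' assume "(x, y) \<in> H" "(x', y') \<in> H"
    then obtain n g a n' g' a' where h: "(n, g) \<in> G" "a \<in> carrier R" "x = n \<oplus>\<^bsub>B\<^esub> a \<odot>\<^bsub>B\<^esub> b"
      "y = g \<oplus> c \<otimes> a" "(n', g') \<in> G" "a' \<in> carrier R" "x' = n' \<oplus>\<^bsub>B\<^esub> a' \<odot>\<^bsub>B\<^esub> b" "y' = g' \<oplus> c \<otimes> a'"
      using HE by meson
    have cc: "n \<in> carrier B" "n' \<in> carrier B" "g \<in> carrier R" "g' \<in> carrier R" using h GD(1,2) by blast+
    show "(x \<oplus>\<^bsub>B\<^esub> x', y \<oplus> y') \<in> H"
    proof (rule HI[OF GD(3)[OF h(1,5)]])
      show "a \<oplus> a' \<in> carrier R" using h by simp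
      show "x \<oplus>\<^bsub>B\<^esub> x' = n \<oplus>\<^bsub>B\<^esub> n' \<oplus>\<^bsub>B\<^esub> (a \<oplus> a') \<odot>\<^bsub>B\<^esub> b"
        using h cc b by (simp add: Br(2,3) B.a_ac)
      show "y \<oplus> y' = g \<oplus> g' \<oplus> c \<otimes> (a \<oplus> a')" using h cc c(1) by (simp add: r_distr a_ac)
    qed
  next
    fix x y r assume "(x, y) \<in> H" and r: "r \<in> carrier R"
    then obtain n g a where h: "(n, g) \<in> G" "a \<in> carrier R" "x = n \<oplus>\<^bsub>B\<^esub> a \<odot>\<^bsub>B\<^esub> b" "y = g \<oplus> c \<otimes> a"
      using HE by blast
    have cc: "n \<in> carrier B" "g \<in> carrier R" using h GD(1,2) by blast+
    show "(r \<odot>\<^bsub>B\<^esub> x, y \<otimes> r) \<in> H"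
    proof (rule HI[OF GD(4)[OF r h(1)]])
      show "a \<otimes> r \<in> carrier R" using h r by simp
      show "r \<odot>\<^bsub>B\<^esub> x = r \<odot>\<^bsub>B\<^esub> n \<oplus>\<^bsub>B\<^esub> (a \<otimes> r) \<odot>\<^bsub>B\<^esub> b"
        using h cc b r by (simp add: Br(2,4,5))
      show "y \<otimes> r = g \<otimes> r \<oplus> c \<otimes> (a \<otimes> r)" using h cc c(1) r by (simp add: l_distr m_assoc)
    qed
  next
    fix y assume "(\<zero>\<^bsub>B\<^esub>, y) \<in> H"
    then obtain n g a where h: "(n, g) \<in> G" "a \<in> carrier R" "\<zero>\<^bsub>B\<^esub> = n \<oplus>\<^bsub>B\<^esub> a \<odot>\<^bsub>B\<^esub> b" "y = g \<oplus> c \<otimes> a"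
      using HE by blast
    have cc: "n \<in> carrier B" "g \<in> carrier R" using h GD(1,2) by blast+
    have "a \<odot>\<^bsub>B\<^esub> b \<oplus>\<^bsub>B\<^esub> n = \<zero>\<^bsub>B\<^esub>" using h cc b Br(2) B.a_comm by metis
    then have "a \<odot>\<^bsub>B\<^esub> b = \<ominus>\<^bsub>B\<^esub> n" using B.minus_equality[of "a \<odot>\<^bsub>B\<^esub> b" n] h(2) cc b Br(2) by simp
    then have ab: "(a \<odot>\<^bsub>B\<^esub> b, \<ominus> g) \<in> G" using hom_graph_uminus[OF B G h(1)] by simp
    then have "a \<in> I" using h(2) by (auto simp: I_def)
    then have "c \<otimes> a = \<ominus> g" using \<phi>'[OF ab h(2)] c(2) by metis
    then show "y = \<zero>" using h(4) cc by (simp add: r_neg)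
  qed
  moreover have "G \<subseteq> H"
  proof (rule subrelI)
    fix n g assume h: "(n, g) \<in> G"
    show "(n, g) \<in> H"
      using GD(1,2)[OF h] right_module_zero(1)[OF B b] c(1) by (intro HI[OF h zero_closed]) auto
  qed
  moreover have "(b, c) \<in> H" using b c(1) Br(6)[OF b] by (intro HI[OF z one_closed]) auto
  ultimately show thesis by (rule that)
qed

text \<open>Injectivity of \<open>i\<close> makes the pairs \<open>(i x, f x)\<close> a graph. By
  Zorn it lies in a maximal one, which is defined everywhere since any further element could be
  adjoined.\<close>

lemma injective_of_baer:
  assumes baer: "right_baer R"
  shows "right_self_injective (T :: 'm itself) R"
  unfolding right_self_injective_def injective_right_module_def
proof (intro conjI allI impI)
  let ?Q = "right_regular_module R"
  show "right_module R ?Q"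
    using ring_axioms right_ideal_carrier by (rule right_module_right_ideal_module)
  fix A B :: "('a, 'm) module" and i f
  assume "right_module R A \<and> right_module R B \<and> i \<in> right_module_hom R A B \<and>
    inj_on i (carrier A) \<and> f \<in> right_module_hom R A ?Q"
  then have A: "right_module R A" and B: "right_module R B" and i: "i \<in> right_module_hom R A B"
    and inj: "inj_on i (carrier A)" and f: "f \<in> right_module_hom R A ?Q" by auto
  note Ar = right_module_carrier[OF A] and Br = right_module_carrier[OF B]
  interpret A: abelian_group A by (rule Ar(1))
  interpret B: abelian_group B by (rule Br(1))
  have ic: "i x \<in> carrier B" and fc: "f x \<in> carrier R" if "x \<in> carrier A" for x
    using i f that by (auto simp: right_module_hom_def right_ideal_module_def)
  have ia: "i (x \<oplus>\<^bsub>A\<^esub> y) = i x \<oplus>\<^bsub>B\<^esub> i y" and fa: "f (x \<oplus>\<^bsub>A\<^esub> y) = f x \<oplus> f y"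
    if "x \<in> carrier A" "y \<in> carrier A" for x y
    using i f that by (auto simp: right_module_hom_def right_ideal_module_def)
  have im: "i (a \<odot>\<^bsub>A\<^esub> x) = a \<odot>\<^bsub>B\<^esub> i x" and fm: "f (a \<odot>\<^bsub>A\<^esub> x) = f x \<otimes> a"
    if "x \<in> carrier A" "a \<in> carrier R" for x a
    using i f that by (auto simp: right_module_hom_def right_ideal_module_def)
  have i0: "i \<zero>\<^bsub>A\<^esub> = \<zero>\<^bsub>B\<^esub>" and f0: "f \<zero>\<^bsub>A\<^esub> = \<zero>"
    using im[of "\<zero>\<^bsub>A\<^esub>" \<zero>] fm[of "\<zero>\<^bsub>A\<^esub>" \<zero>] ic fc right_module_zero(1)[OF A A.zero_closed]
      right_module_zero(1)[OF B] by auto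
  define G0 where "G0 = {(i x, f x) | x. x \<in> carrier A}"
  have G0I: "(i x, f x) \<in> G0" if "x \<in> carrier A" for x using that by (auto simp: G0_def)
  have G0: "hom_graph B G0"
    unfolding hom_graph_def
  proof (intro conjI allI impI ballI)
    show "G0 \<subseteq> carrier B \<times> carrier R" using ic fc by (auto simp: G0_def)
  next
    fix b r b' r' assume "(b, r) \<in> G0" "(b', r') \<in> G0"
    then obtain x y where "x \<in> carrier A" "y \<in> carrier A" "b = i x" "r = f x" "b' = i y" "r' = f y"
      by (auto simp: G0_def)
    then show "(b \<oplus>\<^bsub>B\<^esub> b', r \<oplus> r') \<in> G0" using G0I[of "x \<oplus>\<^bsub>A\<^esub> y"] by (simp add: ia fa)
  next
    fix b r a assume "(b, r) \<in> G0" "a \<in> carrier R"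
    moreover from this obtain x where "x \<in> carrier A" "b = i x" "r = f x" by (auto simp: G0_def)
    ultimately show "(a \<odot>\<^bsub>B\<^esub> b, r \<otimes> a) \<in> G0" using G0I[of "a \<odot>\<^bsub>A\<^esub> x"] by (simp add: im fm Ar(2))
  next
    fix r assume "(\<zero>\<^bsub>B\<^esub>, r) \<in> G0"
    then obtain x where x: "x \<in> carrier A" "\<zero>\<^bsub>B\<^esub> = i x" "r = f x" by (auto simp: G0_def)
    then have "x = \<zero>\<^bsub>A\<^esub>" using inj i0 by (simp add: inj_on_def)
    then show "r = \<zero>" using x f0 by simp
  qed
  define F where "F = {G. hom_graph B G \<and> G0 \<subseteq> G}"
  have "G0 \<in> F" using G0 by (simp add: F_def)
  moreover have "\<Union>C \<in> F" if "C \<noteq> {}" "subset.chain F C" for C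
  proof -
    have CF: "C \<subseteq> F" using that(2) by (simp add: subset.chain_def)
    have "hom_graph B (\<Union>C)"
    proof (rule hom_graph_Union[OF that(1)])
      show "hom_graph B G" if "G \<in> C" for G using CF that by (auto simp: F_def)
      show "G \<subseteq> H \<or> H \<subseteq> G" if "G \<in> C" "H \<in> C" for G H
        using \<open>subset.chain F C\<close> that by (meson subset_chain_def)
    qed
    then show ?thesis using CF that(1) by (auto simp: F_def)
  qed
  ultimately obtain G where GF: "G \<in> F" and max: "\<And>X. X \<in> F \<Longrightarrow> G \<subseteq> X \<Longrightarrow> X = G"
    using subset_Zorn_nonempty[of F] by blast
  have G: "hom_graph B G" and G0G: "G0 \<subseteq> G" using GF by (simp_all add: F_def)
  have z: "(\<zero>\<^bsub>B\<^esub>, \<zero>) \<in> G" using G0G G0I[OF A.zero_closed] i0 f0 by auto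
  have "\<exists>r. (b, r) \<in> G" if b: "b \<in> carrier B" for b
  proof -
    obtain H r where H: "hom_graph B H" "G \<subseteq> H" "(b, r) \<in> H"
      by (rule hom_graph_extend[OF baer B G z b])
    then have "H = G" using max G0G by (simp add: F_def)
    then show ?thesis using H(3) by blast
  qed
  then obtain g where g: "\<And>b. b \<in> carrier B \<Longrightarrow> (b, g b) \<in> G" by metis
  note GD = hom_graphD[OF G] and Gf = hom_graph_fun[OF B G]
  have "g \<in> right_module_hom R B ?Q"
    unfolding right_module_hom_def mem_Collect_eq
  proof (intro conjI ballI)
    show "g \<in> carrier B \<rightarrow> carrier ?Q" using GD(2)[OF g] by (auto simp: right_ideal_module_def)
    show "g (x \<oplus>\<^bsub>B\<^esub> y) = g x \<oplus>\<^bsub>?Q\<^esub> g y" if "x \<in> carrier B" "y \<in> carrier B" for x y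
      using Gf[OF g GD(3)[OF g g]] that by (simp add: right_ideal_module_def)
    show "g (a \<odot>\<^bsub>B\<^esub> x) = a \<odot>\<^bsub>?Q\<^esub> g x" if "a \<in> carrier R" "x \<in> carrier B" for a x
      using Gf[OF g GD(4)[OF that(1) g]] that Br(2) by (simp add: right_ideal_module_def)
  qed
  moreover have "g (i x) = f x" if x: "x \<in> carrier A" for x
  proof -
    have "(i x, f x) \<in> G" using G0G x by (auto simp: G0_def)
    then show ?thesis using Gf[OF g[OF ic[OF x]]] by blast
  qed
  ultimately show "\<exists>g\<in>right_module_hom R B ?Q. \<forall>x\<in>carrier A. g (i x) = f x" by blast
qed

text \<open>The test modules for self-injectivity have carrier type \<open>'a + 'c\<close>; right
  ideals are moved into its left summand so that they can serve as such.\<close>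

definition copy_module :: "'a set \<Rightarrow> ('a, 'a + 'c) module" where
  "copy_module I = \<lparr>carrier = Inl ` I, mult = (\<lambda>x y. x), one = Inl \<one>, zero = Inl \<zero>,
     add = (\<lambda>x y. Inl (projl x \<oplus> projl y)), smult = (\<lambda>a x. Inl (projl x \<otimes> a))\<rparr>"

lemma right_module_copy:
  assumes I: "right_ideal R I"
  shows "right_module R (copy_module I :: ('a, 'a + 'c) module)"
proof -
  note Ir = right_ideal_simps[OF I]
  have "abelian_group (copy_module I :: ('a, 'a + 'c) module)"
  proof (rule abelian_groupI)
    fix x assume "x \<in> carrier (copy_module I :: ('a, 'a + 'c) module)"
    then obtain y where y: "y \<in> I" "x = Inl y" by (auto simp: copy_module_def)
    then show "\<exists>y\<in>carrier (copy_module I :: ('a, 'a + 'c) module).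
        y \<oplus>\<^bsub>copy_module I\<^esub> x = \<zero>\<^bsub>copy_module I\<^esub>"
      using Ir(5)[OF y(1)] Ir(1)[OF y(1)]
      by (intro bexI[of _ "Inl (\<ominus> y)"]) (simp_all add: copy_module_def l_neg)
  qed (use Ir(1-4) in \<open>auto simp: copy_module_def a_ac\<close>)
  then show ?thesis
    using Ir(1-4) by (auto simp: right_module_def copy_module_def l_distr r_distr m_assoc)
qed

lemma baer_of_injective:
  assumes inj: "right_self_injective TYPE('a + 'c) R"
  shows "right_baer R"
  unfolding right_baer_def extends_from_def
proof (intro allI impI)
  fix I f assume I: "right_ideal R I" and f: "linear_on R I f"
  let ?A = "copy_module I :: ('a, 'a + 'c) module"
  let ?B = "copy_module (carrier R) :: ('a, 'a + 'c) module"
  have sub: "I \<subseteq> carrier R" using I by (rule right_ideal_subset)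
  have i: "id \<in> right_module_hom R ?A ?B"
    using sub by (auto simp: right_module_hom_def copy_module_def)
  have f': "f \<circ> projl \<in> right_module_hom R ?A (right_regular_module R)"
    using f by (auto simp: right_module_hom_def copy_module_def linear_on_def right_ideal_module_def)
  obtain g where g: "g \<in> right_module_hom R ?B (right_regular_module R)"
    "\<forall>x\<in>carrier ?A. g (id x) = (f \<circ> projl) x"
    using inj[unfolded right_self_injective_def injective_right_module_def, THEN conjunct2, rule_format,
        of ?A ?B id "f \<circ> projl"] right_module_copy[OF I] right_module_copy[OF right_ideal_carrier] i f'
    by auto
  have "linear_on R (carrier R) (\<lambda>x. g (Inl x))"
    using g(1) by (auto simp: right_module_hom_def copy_module_def linear_on_def right_ideal_module_def)
  then have "g (Inl x) = g (Inl \<one>) \<otimes> x" if "x \<in> carrier R" for x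
    using linear_on_carrier[of "\<lambda>x. g (Inl x)" x] that by blast
  moreover have "g (Inl x) = f x" if "x \<in> I" for x using g(2) that by (simp add: copy_module_def)
  moreover have "g (Inl \<one>) \<in> carrier R"
    using g(1) by (auto simp: right_module_hom_def copy_module_def right_ideal_module_def)
  ultimately show "\<exists>c\<in>carrier R. \<forall>x\<in>I. f x = c \<otimes> x" using sub by (metis subsetD)
qed


section \<open>Annihilators\<close>

lemma lann_mem: "a \<in> lann R X \<longleftrightarrow> a \<in> carrier R \<and> (\<forall>x\<in>X. a \<otimes> x = \<zero>)"
  by (simp add: lann_def)

lemma rann_mem: "a \<in> rann R X \<longleftrightarrow> a \<in> carrier R \<and> (\<forall>x\<in>X. x \<otimes> a = \<zero>)"
  by (simp add: rann_def)

lemma lann_antimono: "X \<subseteq> Y \<Longrightarrow> lann R Y \<subseteq> lann R X"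
  unfolding lann_def by blast

lemma rann_antimono: "X \<subseteq> Y \<Longrightarrow> rann R Y \<subseteq> rann R X"
  unfolding rann_def by blast

lemma lann_rann_ge: "X \<subseteq> carrier R \<Longrightarrow> X \<subseteq> lann R (rann R X)"
  by (auto simp: rann_mem lann_mem)

lemma rann_lann_ge: "X \<subseteq> carrier R \<Longrightarrow> X \<subseteq> rann R (lann R X)"
  by (auto simp: rann_mem lann_mem)

lemma rann_lann_rann: "X \<subseteq> carrier R \<Longrightarrow> rann R (lann R (rann R X)) = rann R X"
proof
  assume X: "X \<subseteq> carrier R"
  show "rann R (lann R (rann R X)) \<subseteq> rann R X" using lann_rann_ge[OF X] by (rule rann_antimono)
  show "rann R X \<subseteq> rann R (lann R (rann R X))" by (rule rann_lann_ge) (auto simp: rann_mem)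
qed

lemma right_ideal_rann: "X \<subseteq> carrier R \<Longrightarrow> right_ideal R (rann R X)"
  by (rule right_idealI) (auto simp: rann_mem r_distr subset_iff m_assoc[symmetric])

lemma left_ideal_lann: "X \<subseteq> carrier R \<Longrightarrow> right_ideal (opp_ring R) (lann R X)"
proof -
  interpret op: ring "opp_ring R" by (rule ring_opp)
  assume "X \<subseteq> carrier R"
  then show ?thesis using op.right_ideal_rann[of X] by simp
qed

lemma right_annihilator_rann: "X \<subseteq> carrier R \<Longrightarrow> right_annihilator R (rann R X)"
  by (auto simp: right_annihilator_iff)

lemma right_annihilator_ideal: "right_annihilator R A \<Longrightarrow> right_ideal R A"
  by (auto simp: right_annihilator_iff right_ideal_rann)

lemma add_eq_swap:
  assumes "a \<oplus> b = c \<oplus> d" "a \<in> carrier R" "b \<in> carrier R" "c \<in> carrier R" "d \<in> carrier R"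
  shows "b \<ominus> d = c \<ominus> a"
proof -
  have "b = (c \<oplus> d) \<ominus> a" using add_minus_cancel[of a b] assms by simp
  also have "\<dots> = d \<oplus> (c \<ominus> a)" using assms(2-5) by (simp add: a_minus_def a_ac)
  finally show ?thesis using add_minus_cancel[of d "c \<ominus> a"] assms(2-5) by simp
qed

text \<open>Homomorphisms below are naturally given by expressions like
  \<open>a r \<mapsto> b r\<close>. Their graphs reduce well-definedness to the single condition
  that \<open>0\<close> is related only to \<open>0\<close>.\<close>

lemma extends_graph:
  assumes Gc: "\<And>x y. (x, y) \<in> G \<Longrightarrow> x \<in> carrier R \<and> y \<in> carrier R" and zero: "(\<zero>, \<zero>) \<in> G"
    and add: "\<And>x y x' y'. (x, y) \<in> G \<Longrightarrow> (x', y') \<in> G \<Longrightarrow> (x \<oplus> x', y \<oplus> y') \<in> G"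
    and mult: "\<And>x y r. (x, y) \<in> G \<Longrightarrow> r \<in> carrier R \<Longrightarrow> (x \<otimes> r, y \<otimes> r) \<in> G"
    and ker: "\<And>y. (\<zero>, y) \<in> G \<Longrightarrow> y = \<zero>"
    and ext: "right_ideal R (Domain G) \<Longrightarrow> extends_from R (Domain G)"
  shows "\<exists>c\<in>carrier R. \<forall>x y. (x, y) \<in> G \<longrightarrow> y = c \<otimes> x"
proof -
  have uniq: "y = z" if h: "(x, y) \<in> G" "(x, z) \<in> G" for x y z
  proof -
    have "(x \<oplus> x \<otimes> (\<ominus> \<one>), y \<oplus> z \<otimes> (\<ominus> \<one>)) \<in> G" using add[OF h(1) mult[OF h(2)]] by simp
    then have "(\<zero>, y \<ominus> z) \<in> G" using Gc[OF h(1)] Gc[OF h(2)] by (simp add: r_minus r_neg a_minus_def)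
    then show ?thesis using ker eq_iff_minus_zero Gc[OF h(1)] Gc[OF h(2)] by blast
  qed
  define f where "f x = (SOME y. (x, y) \<in> G)" for x
  have fG: "(x, f x) \<in> G" if "x \<in> Domain G" for x using that unfolding f_def by (auto intro: someI)
  have f: "f x = y" if "(x, y) \<in> G" for x y using uniq[OF fG that] that by blast
  have "right_ideal R (Domain G)"
    using Gc zero add mult by (intro right_idealI) (auto simp: Domain_iff, blast+)
  moreover have "linear_on R (Domain G) f"
    unfolding linear_on_def using Gc[OF fG] f[OF add[OF fG fG]] f[OF mult[OF fG]] by simp
  ultimately obtain c where "c \<in> carrier R" "\<forall>x\<in>Domain G. f x = c \<otimes> x"
    using ext unfolding extends_from_def by meson
  then show ?thesis using f by blast
qed

text \<open>The annihilator hypothesis makes \<open>a r \<mapsto> b r\<close> well defined, and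
  \<open>c\<close> realises it.\<close>

lemma extends_principal:
  assumes ext: "extends_from R (rPIdl a)" and a: "a \<in> carrier R" and b: "b \<in> carrier R"
    and ann: "\<And>r. r \<in> carrier R \<Longrightarrow> a \<otimes> r = \<zero> \<Longrightarrow> b \<otimes> r = \<zero>"
  shows "\<exists>c\<in>carrier R. b = c \<otimes> a"
proof -
  define G where "G = (\<lambda>r. (a \<otimes> r, b \<otimes> r)) ` carrier R"
  have GI: "(a \<otimes> r, b \<otimes> r) \<in> G" if "r \<in> carrier R" for r using that unfolding G_def by blast
  have GE: "\<exists>r\<in>carrier R. x = a \<otimes> r \<and> y = b \<otimes> r" if "(x, y) \<in> G" for x y
    using that unfolding G_def by blast
  have "\<exists>c\<in>carrier R. \<forall>x y. (x, y) \<in> G \<longrightarrow> y = c \<otimes> x"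
  proof (rule extends_graph)
    show "x \<in> carrier R \<and> y \<in> carrier R" if "(x, y) \<in> G" for x y using GE[OF that] a b by auto
    show "(\<zero>, \<zero>) \<in> G" using GI[OF zero_closed] a b by simp
    show "(x \<oplus> x', y \<oplus> y') \<in> G" if h: "(x, y) \<in> G" "(x', y') \<in> G" for x y x' y'
    proof -
      obtain r s where "r \<in> carrier R" "s \<in> carrier R" "x = a \<otimes> r" "y = b \<otimes> r" "x' = a \<otimes> s" "y' = b \<otimes> s"
        using GE[OF h(1)] GE[OF h(2)] by blast
      then show ?thesis using GI[of "r \<oplus> s"] a b by (simp add: r_distr)
    qed
    show "(x \<otimes> t, y \<otimes> t) \<in> G" if h: "(x, y) \<in> G" "t \<in> carrier R" for x y t
    proof -
      obtain r where "r \<in> carrier R" "x = a \<otimes> r" "y = b \<otimes> r" using GE[OF h(1)] by blast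
      then show ?thesis using GI[of "r \<otimes> t"] a b h(2) by (simp add: m_assoc)
    qed
    show "y = \<zero>" if "(\<zero>, y) \<in> G" for y using GE[OF that] ann by metis
    have "Domain G = rPIdl a" unfolding G_def rPIdl_def by auto
    then show "extends_from R (Domain G)" using ext by simp
  qed
  then show ?thesis using GI[OF one_closed] a b by auto
qed

lemma baer_principal:
  assumes "right_baer R" "a \<in> carrier R" "b \<in> carrier R"
    "\<And>r. r \<in> carrier R \<Longrightarrow> a \<otimes> r = \<zero> \<Longrightarrow> b \<otimes> r = \<zero>"
  shows "\<exists>c\<in>carrier R. b = c \<otimes> a"
  using assms right_ideal_rPIdl by (intro extends_principal) (auto simp: right_baer_def)

text \<open>On \<open>A + B\<close> the rule \<open>p + q \<mapsto> a q\<close> is well defined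
  because \<open>a\<close> kills \<open>A \<inter> B\<close>. A multiplier \<open>c\<close>
  realising it kills \<open>A\<close> and agrees with \<open>a\<close> on \<open>B\<close>, so
  \<open>a = c + (a - c)\<close>.\<close>

lemma baer_lann_Int:
  assumes baer: "right_baer R" and A: "right_ideal R A" and B: "right_ideal R B"
    and a: "a \<in> lann R (A \<inter> B)"
  shows "\<exists>u\<in>lann R A. \<exists>v\<in>lann R B. a = u \<oplus> v"
proof -
  note As = right_ideal_simps[OF A] and Bs = right_ideal_simps[OF B]
  have ac: "a \<in> carrier R" using a by (simp add: lann_mem)
  define G where "G = {(p \<oplus> q, a \<otimes> q) | p q. p \<in> A \<and> q \<in> B}"
  have GI: "(p \<oplus> q, a \<otimes> q) \<in> G" if "p \<in> A" "q \<in> B" for p q using that unfolding G_def by blast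
  have GE: "\<exists>p\<in>A. \<exists>q\<in>B. x = p \<oplus> q \<and> y = a \<otimes> q" if "(x, y) \<in> G" for x y
    using that unfolding G_def by blast
  have "\<exists>c\<in>carrier R. \<forall>x y. (x, y) \<in> G \<longrightarrow> y = c \<otimes> x"
  proof (rule extends_graph)
    show "x \<in> carrier R \<and> y \<in> carrier R" if "(x, y) \<in> G" for x y using GE[OF that] ac As(1) Bs(1) by auto
    show "(\<zero>, \<zero>) \<in> G" using GI[OF As(2) Bs(2)] ac by simp
    show "(x \<oplus> x', y \<oplus> y') \<in> G" if h: "(x, y) \<in> G" "(x', y') \<in> G" for x y x' y'
    proof -
      obtain p q p' q' where g: "p \<in> A" "q \<in> B" "x = p \<oplus> q" "y = a \<otimes> q"
        "p' \<in> A" "q' \<in> B" "x' = p' \<oplus> q'" "y' = a \<otimes> q'" using GE[OF h(1)] GE[OF h(2)] by blast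
      then have "x \<oplus> x' = (p \<oplus> p') \<oplus> (q \<oplus> q')" "y \<oplus> y' = a \<otimes> (q \<oplus> q')"
        using ac As(1) Bs(1) by (simp_all add: a_ac r_distr)
      then show ?thesis using GI[OF As(3)[OF g(1,5)] Bs(3)[OF g(2,6)]] by simp
    qed
    show "(x \<otimes> t, y \<otimes> t) \<in> G" if h: "(x, y) \<in> G" "t \<in> carrier R" for x y t
    proof -
      obtain p q where g: "p \<in> A" "q \<in> B" "x = p \<oplus> q" "y = a \<otimes> q" using GE[OF h(1)] by blast
      then have "x \<otimes> t = p \<otimes> t \<oplus> q \<otimes> t" "y \<otimes> t = a \<otimes> (q \<otimes> t)"
        using ac As(1) Bs(1) h(2) by (simp_all add: l_distr m_assoc)
      then show ?thesis using GI[OF As(4)[OF g(1) h(2)] Bs(4)[OF g(2) h(2)]] by simp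
    qed
    show "y = \<zero>" if h: "(\<zero>, y) \<in> G" for y
    proof -
      obtain p q where g: "p \<in> A" "q \<in> B" "\<zero> = p \<oplus> q" "y = a \<otimes> q" using GE[OF h] by blast
      then have "q \<oplus> p = \<zero>" using As(1) Bs(1) a_comm by metis
      then have "q \<in> A" using right_ideal_add_cancel[OF A _ Bs(1)[OF g(2)] g(1)] As(2) by simp
      then show ?thesis using g(2,4) a by (simp add: lann_mem)
    qed
    show "extends_from R (Domain G)" if "right_ideal R (Domain G)" using baer that by (simp add: right_baer_def)
  qed
  then obtain c where c: "c \<in> carrier R" "\<And>x y. (x, y) \<in> G \<Longrightarrow> y = c \<otimes> x" by blast
  have "c \<otimes> p = \<zero>" if "p \<in> A" for p
    using c(2)[OF GI[OF that Bs(2)]] As(1)[OF that] ac by simp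
  moreover have "(a \<ominus> c) \<otimes> q = \<zero>" if "q \<in> B" for q
    using c(2)[OF GI[OF As(2) that]] eq_iff_minus_zero[of "a \<otimes> q" "c \<otimes> q"] Bs(1)[OF that] ac c(1)
    by (simp add: l_distr_minus)
  ultimately have "c \<in> lann R A" "a \<ominus> c \<in> lann R B" using ac c(1) by (simp_all add: lann_mem)
  moreover have "a = c \<oplus> (a \<ominus> c)" using ac c(1) by (simp add: add_minus_minus)
  ultimately show ?thesis by blast
qed

text \<open>The right annihilator of \<open>insert x L\<close> is \<open>r(L) \<inter> r(x)\<close>.
  Its left annihilator is thus contained in \<open>l(r(L)) + l(r(x))\<close>, which is
  \<open>L + R x\<close>: the induction step for adding generators to an annihilator left
  ideal.\<close>

lemma left_closed_insert:
  assumes baer: "right_baer R" and L: "L \<subseteq> carrier R" and LR: "lann R (rann R L) = L"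
    and x: "x \<in> carrier R" and a: "a \<in> lann R (rann R (insert x L))"
  shows "\<exists>u\<in>L. \<exists>r\<in>carrier R. a = u \<oplus> r \<otimes> x"
proof -
  have "rann R (insert x L) = rann R L \<inter> rann R {x}" by (auto simp: rann_mem)
  then have a': "a \<in> lann R (rann R L \<inter> rann R {x})" using a by simp
  have "right_ideal R (rann R {x})" using x by (intro right_ideal_rann) simp
  from baer_lann_Int[OF baer right_ideal_rann[OF L] this a']
  obtain u v where uv: "u \<in> lann R (rann R L)" "v \<in> lann R (rann R {x})" "a = u \<oplus> v" by blast
  have "\<exists>r\<in>carrier R. v = r \<otimes> x"
    using uv(2) x by (intro baer_principal[OF baer x]) (auto simp: rann_mem lann_mem)
  then show ?thesis using uv LR by auto
qed

text \<open>
  Among the annihilator left ideals inside \<open>L\<close> pick one with minimal right annihilator.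
  It cannot be enlarged by an element of \<open>L\<close>.
\<close>

lemma left_closed_of_DCC:
  assumes baer: "right_baer R" and D: "DCC (right_annihilator R)"
    and L: "right_ideal (opp_ring R) L"
  shows "lann R (rann R L) = L"
proof -
  interpret op: ring "opp_ring R" by (rule ring_opp)
  have Lc: "L \<subseteq> carrier R" using op.right_ideal_subset[OF L] by simp
  let ?Q = "\<lambda>A. \<exists>K. K \<subseteq> L \<and> right_ideal (opp_ring R) K \<and> lann R (rann R K) = K \<and> A = rann R K"
  have 0: "rann R {\<zero>} = carrier R" by (auto simp: rann_mem)
  have l0: "lann R (carrier R) = {\<zero>}"
    using r_one[symmetric] by (auto simp: lann_mem) (metis one_closed r_one)
  have "?Q (rann R {\<zero>})"
    using op.right_ideal_trivial op.right_ideal_zero[OF L] 0 l0 by (intro exI[of _ "{\<zero>}"]) auto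
  moreover have "right_annihilator R (rann R {\<zero>})" by (rule right_annihilator_rann) simp
  ultimately obtain B where B: "right_annihilator R B" "?Q B"
    "\<And>C. right_annihilator R C \<Longrightarrow> ?Q C \<Longrightarrow> C \<subseteq> B \<Longrightarrow> C = B"
    using DCC_minimal[OF D, of "rann R {\<zero>}" ?Q] by blast
  from B(2) obtain K where K: "K \<subseteq> L" "right_ideal (opp_ring R) K" "lann R (rann R K) = K" "B = rann R K"
    by blast
  have Kc: "K \<subseteq> carrier R" using K(1) Lc by blast
  have "L \<subseteq> K"
  proof
    fix x assume x: "x \<in> L"
    have xc: "x \<in> carrier R" using x Lc by blast
    let ?K = "lann R (rann R (insert x K))"
    have ic: "insert x K \<subseteq> carrier R" using xc Kc by blast
    have "?K \<subseteq> L"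
    proof
      fix a assume "a \<in> ?K"
      then obtain u r where "u \<in> K" "r \<in> carrier R" "a = u \<oplus> r \<otimes> x"
        using left_closed_insert[OF baer Kc K(3) xc] by blast
      then show "a \<in> L" using x K(1) left_ideal_simps(3,4)[OF L] by blast
    qed
    moreover have rr: "rann R ?K = rann R (insert x K)" using ic by (rule rann_lann_rann)
    moreover have "right_ideal (opp_ring R) ?K" by (rule left_ideal_lann) (auto simp: rann_mem)
    ultimately have "?Q (rann R (insert x K))" by (intro exI[of _ ?K]) simp
    moreover have "rann R (insert x K) \<subseteq> B" unfolding K(4) by (rule rann_antimono) blast
    ultimately have "rann R (insert x K) = B" using B(3) right_annihilator_rann[OF ic] by blast
    then have "?K = K" using K(3,4) by simp
    then show "x \<in> K" using lann_rann_ge[OF ic] by blast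
  qed
  then show ?thesis using K(1,3) by auto
qed

text \<open>Under \<open>closed\<close>, taking right annihilators is injective and reverses
  inclusion.\<close>

lemma left_ACC_of_DCC:
  assumes closed: "\<And>L. right_ideal (opp_ring R) L \<Longrightarrow> lann R (rann R L) = L"
    and D: "DCC (right_annihilator R)"
  shows "ACC (right_ideal (opp_ring R))"
  unfolding ACC_def
proof (intro allI impI)
  interpret op: ring "opp_ring R" by (rule ring_opp)
  fix A assume A: "\<forall>n. right_ideal (opp_ring R) (A n) \<and> A n \<subseteq> A (Suc n)"
  have "\<exists>N. \<forall>n\<ge>N. rann R (A n) = rann R (A N)"
  proof (rule DCC_stable[OF D])
    fix n :: nat
    have "A n \<subseteq> carrier R" using A op.right_ideal_subset[of "A n"] by simp
    then show "right_annihilator R (rann R (A n))" by (rule right_annihilator_rann)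
    show "rann R (A (Suc n)) \<subseteq> rann R (A n)" using A by (intro rann_antimono) blast
  qed
  then show "\<exists>N. \<forall>n\<ge>N. A n = A N" using closed A by metis
qed

text \<open>If \<open>x\<close> killed no nonzero element of \<open>K\<close>, then
  \<open>x k \<mapsto> k\<close> would be a homomorphism on the small right ideal
  \<open>x K\<close>. A multiplier \<open>c\<close> for it gives \<open>(1 - c x) k = 0\<close> with
  \<open>1 - c x\<close> a unit, so \<open>K\<close> would be zero.\<close>

lemma J_singular:
  assumes inj: "right_small_injective R" and x: "x \<in> J"
    and K: "right_ideal R K" "K \<noteq> {\<zero>}"
  shows "\<exists>k\<in>K. k \<noteq> \<zero> \<and> x \<otimes> k = \<zero>"
proof (rule ccontr)
  assume n: "\<not> ?thesis"
  have xc: "x \<in> carrier R" using x by (rule J_carr)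
  note Kr = right_ideal_simps[OF K(1)]
  define G where "G = (\<lambda>k. (x \<otimes> k, k)) ` K"
  have GI: "(x \<otimes> k, k) \<in> G" if "k \<in> K" for k using that unfolding G_def by blast
  have GE: "b \<in> K \<and> a = x \<otimes> b" if "(a, b) \<in> G" for a b using that unfolding G_def by blast
  have "\<exists>c\<in>carrier R. \<forall>a b. (a, b) \<in> G \<longrightarrow> b = c \<otimes> a"
  proof (rule extends_graph)
    show "a \<in> carrier R \<and> b \<in> carrier R" if "(a, b) \<in> G" for a b using GE[OF that] xc Kr(1) by simp
    show "(\<zero>, \<zero>) \<in> G" using GI[OF Kr(2)] xc by simp
    show "(a \<oplus> a', b \<oplus> b') \<in> G" if "(a, b) \<in> G" "(a', b') \<in> G" for a b a' b'
      using GI[of "b \<oplus> b'"] GE[OF that(1)] GE[OF that(2)] xc Kr(1,3) by (simp add: r_distr)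
    show "(a \<otimes> r, b \<otimes> r) \<in> G" if "(a, b) \<in> G" "r \<in> carrier R" for a b r
      using GI[of "b \<otimes> r"] GE[OF that(1)] that(2) xc Kr(1,4) by (simp add: m_assoc)
    show "b = \<zero>" if "(\<zero>, b) \<in> G" for b using GE[OF that] n by metis
    have "Domain G \<subseteq> J" using x Kr(1) by (auto simp: G_def intro: J_mult_right)
    then show "extends_from R (Domain G)" if "right_ideal R (Domain G)"
      using inj small_of_le_J[OF that] by (simp add: right_small_injective_iff)
  qed
  then obtain c where c: "c \<in> carrier R" "\<And>a b. (a, b) \<in> G \<Longrightarrow> b = c \<otimes> a" by blast
  obtain v where v: "v \<in> carrier R" "v \<otimes> (\<one> \<ominus> c \<otimes> x) = \<one>"
    using J_unit_left[OF x c(1)] by (auto simp: Units_def)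
  have "k = \<zero>" if k: "k \<in> K" for k
  proof -
    have kc: "k \<in> carrier R" using k by (rule Kr(1))
    have "k \<ominus> c \<otimes> (x \<otimes> k) = \<zero>"
      using c(2)[OF GI[OF k]] eq_iff_minus_zero[of k "c \<otimes> (x \<otimes> k)"] kc xc c(1) by simp
    then have "(\<one> \<ominus> c \<otimes> x) \<otimes> k = \<zero>" using kc xc c(1) by (simp add: l_distr_minus m_assoc)
    then have "v \<otimes> (\<one> \<ominus> c \<otimes> x) \<otimes> k = \<zero>" using v(1) kc xc c(1) by (simp add: m_assoc)
    then show "k = \<zero>" using v(2) kc by simp
  qed
  then show False using K(2) Kr(2) by blast
qed

text \<open>A nonzero \<open>t\<close> with \<open>(1 - c z) t = 0\<close> has a nonzero multiple
  \<open>k\<close> killed by \<open>z\<close>, whence \<open>k = c z k = 0\<close>. So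
  \<open>1 - c z\<close> has zero right annihilator, and the Baer property makes it left
  invertible.\<close>

lemma J_of_singular:
  assumes baer: "right_baer R" and z: "z \<in> carrier R"
    and ess: "\<And>K. right_ideal R K \<Longrightarrow> K \<noteq> {\<zero>} \<Longrightarrow> \<exists>k\<in>K. k \<noteq> \<zero> \<and> z \<otimes> k = \<zero>"
  shows "z \<in> J"
proof -
  interpret op: ring "opp_ring R" by (rule ring_opp)
  have "\<exists>y\<in>carrier R. y \<otimes> (\<one> \<ominus> c \<otimes> z) = \<one>" if c: "c \<in> carrier R" for c
  proof -
    have u: "\<one> \<ominus> c \<otimes> z \<in> carrier R" using c z by simp
    have "t = \<zero>" if t: "t \<in> carrier R" "(\<one> \<ominus> c \<otimes> z) \<otimes> t = \<zero>" for t
    proof (rule ccontr)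
      assume "t \<noteq> \<zero>"
      then have "rPIdl t \<noteq> {\<zero>}" using rPIdl_mem[OF t(1)] by blast
      then obtain k where k: "k \<in> rPIdl t" "k \<noteq> \<zero>" "z \<otimes> k = \<zero>" using ess right_ideal_rPIdl[OF t(1)] by blast
      then obtain s where s: "s \<in> carrier R" "k = t \<otimes> s" by (auto simp: rPIdl_def)
      have kc: "k \<in> carrier R" using s t by simp
      have "(\<one> \<ominus> c \<otimes> z) \<otimes> k = (\<one> \<ominus> c \<otimes> z) \<otimes> t \<otimes> s" using t(1) s c z by (simp add: m_assoc)
      also have "\<dots> = \<zero>" using t(2) s(1) by simp
      finally have "k \<ominus> c \<otimes> (z \<otimes> k) = \<zero>" using kc c z by (simp add: l_distr_minus m_assoc)
      then show False using k(2,3) kc c by (simp add: a_minus_def)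
    qed
    then have "\<exists>y\<in>carrier R. \<one> = y \<otimes> (\<one> \<ominus> c \<otimes> z)"
      using u by (intro baer_principal[OF baer u]) auto
    then show ?thesis by metis
  qed
  then show ?thesis using z op.J_iff_right_inverse[of z] by simp
qed

section \<open>Nilpotence of the radical\<close>

lemma J_prods_carr: "p \<in> J_prods R n \<Longrightarrow> p \<in> carrier R"
  by (induction n arbitrary: p) (auto simp: J_carr)

text \<open>Factors may be split off at either end, which makes \<open>J_prods\<close> the same for
  the opposite ring.\<close>

lemma J_prods_Suc2: "J_prods R (Suc n) = {p \<otimes> a | a p. a \<in> J \<and> p \<in> J_prods R n}"
proof (induction n)
  case 0
  have "{a \<otimes> \<one> | a. a \<in> J} = J" "{\<one> \<otimes> a | a. a \<in> J} = J"
    using J_carr l_one r_one by (force, force)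
  then show ?case by simp
next
  case (Suc n)
  show ?case
  proof (intro subset_antisym subsetI)
    fix x assume "x \<in> J_prods R (Suc (Suc n))"
    then obtain a q where a: "a \<in> J" "q \<in> J_prods R (Suc n)" "x = a \<otimes> q" by auto
    obtain p b where p: "b \<in> J" "p \<in> J_prods R n" "q = p \<otimes> b" using a(2) unfolding Suc.IH by blast
    have "x = (a \<otimes> p) \<otimes> b" using a p J_carr J_prods_carr by (simp add: m_assoc)
    moreover have "a \<otimes> p \<in> J_prods R (Suc n)" using a(1) p(2) by auto
    ultimately show "x \<in> {p \<otimes> a | a p. a \<in> J \<and> p \<in> J_prods R (Suc n)}" using p(1) by blast
  next
    fix x assume "x \<in> {p \<otimes> a | a p. a \<in> J \<and> p \<in> J_prods R (Suc n)}"
    then obtain b q where b: "b \<in> J" "q \<in> J_prods R (Suc n)" "x = q \<otimes> b" by blast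
    obtain a p where p: "a \<in> J" "p \<in> J_prods R n" "q = a \<otimes> p" using b(2) by auto
    have "x = a \<otimes> (p \<otimes> b)" using b p J_carr J_prods_carr by (simp add: m_assoc)
    moreover have "p \<otimes> b \<in> J_prods R (Suc n)" unfolding Suc.IH using b(1) p(2) by blast
    ultimately show "x \<in> J_prods R (Suc (Suc n))" using p(1) by auto
  qed
qed

lemma J_prods_opp [simp]: "J_prods (opp_ring R) n = J_prods R n"
proof (induction n)
  case (Suc n) show ?case unfolding J_prods_Suc2 using Suc by simp
qed simp

lemma J_nilpotent_opp [simp]: "J_nilpotent (opp_ring R) \<longleftrightarrow> J_nilpotent R"
  by (simp add: J_nilpotent_def)

lemma J_prods_subset: "J_prods R n \<subseteq> carrier R"
  using J_prods_carr by blast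

lemma rann_J_prods_Suc:
  "x \<in> rann R (J_prods R (Suc n)) \<longleftrightarrow> x \<in> carrier R \<and> (\<forall>j\<in>J. j \<otimes> x \<in> rann R (J_prods R n))"
    (is "?L \<longleftrightarrow> ?R")
proof
  have as: "(p \<otimes> j) \<otimes> x = p \<otimes> (j \<otimes> x)" if "x \<in> carrier R" "j \<in> J" "p \<in> J_prods R n" for p j
    using that by (simp add: m_assoc J_carr J_prods_carr)
  show ?R if ?L
  proof (intro conjI ballI)
    show xc: "x \<in> carrier R" using that by (simp only: rann_mem)
    fix j assume j: "j \<in> J"
    have "p \<otimes> (j \<otimes> x) = \<zero>" if p: "p \<in> J_prods R n" for p
    proof -
      have "p \<otimes> j \<in> J_prods R (Suc n)" unfolding J_prods_Suc2 using j p by blast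
      then show ?thesis using \<open>?L\<close> as[OF xc j p] unfolding rann_mem by auto
    qed
    then show "j \<otimes> x \<in> rann R (J_prods R n)" using j xc by (simp add: rann_mem J_carr)
  qed
  show ?L if R: ?R
    unfolding rann_mem
  proof (intro conjI ballI)
    show xc: "x \<in> carrier R" using R ..
    fix q assume "q \<in> J_prods R (Suc n)"
    then obtain p j where "j \<in> J" "p \<in> J_prods R n" "q = p \<otimes> j" unfolding J_prods_Suc2 by blast
    then show "q \<otimes> x = \<zero>" using R as[OF xc] unfolding rann_mem by simp
  qed
qed

lemma rann_J_prods_mono: "rann R (J_prods R n) \<subseteq> rann R (J_prods R (Suc n))"
proof
  fix x assume x: "x \<in> rann R (J_prods R n)"
  then have xc: "x \<in> carrier R" by (simp add: rann_mem)
  have "(a \<otimes> p) \<otimes> x = \<zero>" if "a \<in> J" "p \<in> J_prods R n" for a p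
    using that x xc by (simp add: rann_mem m_assoc J_carr J_prods_carr)
  then show "x \<in> rann R (J_prods R (Suc n))" using xc by (auto simp: rann_mem)
qed

text \<open>Since \<open>J\<close> absorbs factors on the right, these right annihilators are also
  left ideals, so a chain condition on left ideals applies to them.\<close>

lemma left_ideal_rann_J_prods: "right_ideal (opp_ring R) (rann R (J_prods R n))"
proof -
  interpret op: ring "opp_ring R" by (rule ring_opp)
  note Q = right_ideal_simps[OF right_ideal_rann[OF J_prods_subset[of n]]]
  show ?thesis
  proof (rule op.right_idealI)
    fix x r assume x: "x \<in> rann R (J_prods R n)" and r: "r \<in> carrier (opp_ring R)"
    have xc: "x \<in> carrier R" using x by (rule Q(1))
    show "x \<otimes>\<^bsub>opp_ring R\<^esub> r \<in> rann R (J_prods R n)"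
    proof (cases n)
      case 0
      then show ?thesis using x r by (auto simp: rann_mem)
    next
      case (Suc m)
      show ?thesis
        unfolding Suc rann_J_prods_Suc
      proof (intro conjI ballI)
        fix j assume j: "j \<in> J"
        have "j \<otimes> r \<in> J" using j r by (simp add: J_mult_right)
        then have "(j \<otimes> r) \<otimes> x \<in> rann R (J_prods R m)" using x unfolding Suc rann_J_prods_Suc by blast
        then show "j \<otimes> (x \<otimes>\<^bsub>opp_ring R\<^esub> r) \<in> rann R (J_prods R m)"
          using j r xc J_carr by (simp add: m_assoc)
      qed (use xc r in simp)
    qed
  qed (use Q in auto)
qed

lemma J_nilpotent_of_one: "\<one> \<in> rann R (J_prods R n) \<Longrightarrow> J_nilpotent R"
  using J_prods_carr by (fastforce simp: J_nilpotent_def rann_mem)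

text \<open>
  Let \<open>r(J\<^sup>n)\<close> be stationary and choose \<open>a\<close> with \<open>J\<^sup>n a \<noteq> 0\<close> and \<open>r(a)\<close> maximal. Since the
  elements of \<open>J\<close> are singular, \<open>r(x a)\<close> is larger for \<open>x \<in> J\<close>, so \<open>J\<^sup>n\<^sup>+\<^sup>1 a = 0\<close>.
\<close>

lemma J_nilpotent_of_ACC:
  assumes sing: "\<And>x K. x \<in> J \<Longrightarrow> right_ideal R K \<Longrightarrow> K \<noteq> {\<zero>} \<Longrightarrow> \<exists>k\<in>K. k \<noteq> \<zero> \<and> x \<otimes> k = \<zero>"
    and A: "ACC (right_annihilator R)"
  shows "J_nilpotent R"
proof -
  let ?Q = "\<lambda>n. rann R (J_prods R n)"
  obtain N where N: "\<forall>n\<ge>N. ?Q n = ?Q N"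
    using ACC_stable[OF A, of ?Q] right_annihilator_rann[OF J_prods_subset] rann_J_prods_mono by blast
  have "\<one> \<in> ?Q N"
  proof (rule ccontr)
    assume 1: "\<one> \<notin> ?Q N"
    define S where "S = (\<lambda>A. \<exists>a\<in>carrier R. a \<notin> ?Q N \<and> A = rann R {a})"
    have "S (rann R {\<one>})" using 1 unfolding S_def by blast
    moreover have "right_annihilator R (rann R {\<one>})" by (rule right_annihilator_rann) simp
    ultimately obtain B where B: "S B"
      and B2: "\<And>C. right_annihilator R C \<Longrightarrow> S C \<Longrightarrow> B \<subseteq> C \<Longrightarrow> C = B"
      using ACC_maximal[OF A] by metis
    from B obtain a where a: "a \<in> carrier R" "a \<notin> ?Q N" "B = rann R {a}" unfolding S_def by blast
    have "x \<otimes> a \<in> ?Q N" if x: "x \<in> J" for x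
    proof (rule ccontr)
      assume n: "x \<otimes> a \<notin> ?Q N"
      have xc: "x \<in> carrier R" using x by (rule J_carr)
      have "B \<subseteq> rann R {x \<otimes> a}" using a xc by (auto simp: rann_mem m_assoc)
      moreover have "S (rann R {x \<otimes> a})" using n xc a(1) unfolding S_def by (intro bexI[of _ "x \<otimes> a"]) simp_all
      moreover have "right_annihilator R (rann R {x \<otimes> a})"
        using xc a(1) by (intro right_annihilator_rann) simp
      ultimately have eq: "rann R {x \<otimes> a} = rann R {a}" using B2 a(3) by simp
      have "a \<noteq> \<zero>" using a(2) J_prods_carr by (auto simp: rann_mem)
      then have "rPIdl a \<noteq> {\<zero>}" using rPIdl_mem[OF a(1)] by blast
      then obtain k where k: "k \<in> rPIdl a" "k \<noteq> \<zero>" "x \<otimes> k = \<zero>"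
        using sing[OF x right_ideal_rPIdl[OF a(1)]] by blast
      then obtain s where s: "s \<in> carrier R" "k = a \<otimes> s" by (auto simp: rPIdl_def)
      then have "s \<in> rann R {x \<otimes> a}" using k xc a(1) by (simp add: rann_mem m_assoc)
      then have "s \<in> rann R {a}" using eq by simp
      then show False using k s by (simp add: rann_mem)
    qed
    then have "a \<in> ?Q (Suc N)" using a(1) by (simp only: rann_J_prods_Suc) blast
    moreover have "?Q (Suc N) = ?Q N" by (rule N[rule_format]) simp
    ultimately show False using a(2) by blast
  qed
  then show ?thesis by (rule J_nilpotent_of_one)
qed

text \<open>
  If \<open>T = l(r(J\<^sup>n))\<close> is nonzero, \<open>r(J\<^sup>n)\<close> being stationary, then \<open>J T\<close> lies in a maximal left
  subideal of \<open>T\<close>, whose right annihilator is larger than \<open>r(T) = r(J\<^sup>n)\<close> but inside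
  \<open>r(J\<^sup>n\<^sup>+\<^sup>1)\<close>.
\<close>

lemma J_nilpotent_of_left_ACC:
  assumes closed: "\<And>L. right_ideal (opp_ring R) L \<Longrightarrow> lann R (rann R L) = L"
    and A: "ACC (right_ideal (opp_ring R))"
  shows "J_nilpotent R"
proof -
  interpret op: ring "opp_ring R" by (rule ring_opp)
  let ?Q = "\<lambda>n. rann R (J_prods R n)"
  obtain N where N: "\<forall>n\<ge>N. ?Q n = ?Q N"
    using ACC_stable[OF A, of ?Q] left_ideal_rann_J_prods rann_J_prods_mono by blast
  define T where "T = lann R (?Q N)"
  have Qc: "?Q N \<subseteq> carrier R" by (auto simp: rann_mem)
  have T: "right_ideal (opp_ring R) T" unfolding T_def using Qc by (rule left_ideal_lann)
  have PT: "J_prods R N \<subseteq> T" unfolding T_def using J_prods_subset by (rule lann_rann_ge)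
  have "T = {\<zero>}"
  proof (rule ccontr)
    assume T0: "T \<noteq> {\<zero>}"
    have z: "right_ideal (opp_ring R) {\<zero>}" using op.right_ideal_trivial by simp
    have "{\<zero>} \<subseteq> T" using left_ideal_simps(2)[OF T] by blast
    then have "{\<zero>} \<subseteq> T \<and> {\<zero>} \<noteq> T" using T0 by blast
    then obtain M where M: "right_ideal (opp_ring R) M" "M \<subseteq> T \<and> M \<noteq> T"
      "\<And>C. right_ideal (opp_ring R) C \<Longrightarrow> C \<subseteq> T \<and> C \<noteq> T \<Longrightarrow> M \<subseteq> C \<Longrightarrow> C = M"
      using ACC_maximal[OF A z, of "\<lambda>M. M \<subseteq> T \<and> M \<noteq> T"] by blast
    note Ms = left_ideal_simps[OF M(1)] and Ts = left_ideal_simps[OF T]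
    \<comment> \<open>Nakayama's argument: otherwise \<open>M + R j t\<close> is all of
      \<open>T\<close>, so \<open>t = m + r j t\<close>, and invertibility of \<open>1 - r j\<close>
      puts \<open>t\<close> in \<open>M\<close>.\<close>
    have JT: "j \<otimes> t \<in> M" if j: "j \<in> J" and t: "t \<in> T" for j t
    proof (rule ccontr)
      assume n: "j \<otimes> t \<notin> M"
      have jc: "j \<in> carrier R" and tc: "t \<in> carrier R" using j t J_carr Ts(1) by blast+
      let ?C = "M <+>\<^bsub>opp_ring R\<^esub> op.rPIdl (j \<otimes> t)"
      have p: "right_ideal (opp_ring R) (op.rPIdl (j \<otimes> t))" using jc tc by (intro op.right_ideal_rPIdl) simp
      have "op.rPIdl (j \<otimes> t) \<subseteq> T" using op.rPIdl_le[OF T] Ts(4)[OF t jc] by simp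
      then have CT: "?C \<subseteq> T" using op.set_add_le[OF T] M(2) by blast
      have "j \<otimes> t \<in> ?C" using op.set_add_ge2[OF M(1) p] op.rPIdl_mem[of "j \<otimes> t"] jc tc by auto
      then have "?C \<noteq> M" using n by blast
      moreover have "M \<subseteq> ?C" using op.set_add_ge1[OF M(1) p] .
      ultimately have "?C = T" using M(3)[OF op.right_ideal_set_add[OF M(1) p]] CT by blast
      then have "t \<in> ?C" using t by simp
      then obtain m r where m: "m \<in> M" "r \<in> carrier R" "t = m \<oplus> r \<otimes> (j \<otimes> t)"
        by (auto simp: op.set_add_mem op.rPIdl_def)
      obtain v where v: "v \<in> carrier R" "v \<otimes> (\<one> \<ominus> r \<otimes> j) = \<one>"
        using J_unit_left[OF j m(2)] by (auto simp: Units_def)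
      have mc: "m \<in> carrier R" using m(1) by (rule Ms(1))
      have "m = t \<ominus> r \<otimes> (j \<otimes> t)"
        using add_minus_cancel[of "r \<otimes> (j \<otimes> t)" m] m mc jc tc by (simp add: a_comm)
      then have "v \<otimes> m = v \<otimes> (\<one> \<ominus> r \<otimes> j) \<otimes> t"
        using v(1) m(2) jc tc by (simp add: m_assoc l_distr_minus)
      then have "t = v \<otimes> m" using v tc by simp
      then have "t \<in> M" using Ms(4)[OF m(1) v(1)] by simp
      then show False using n Ms(4) jc by blast
    qed
    have "rann R M \<subseteq> ?Q N"
    proof
      fix x assume x: "x \<in> rann R M"
      have "p \<otimes> x = \<zero>" if p: "p \<in> J_prods R (Suc N)" for p
      proof -
        obtain a q where "a \<in> J" "q \<in> J_prods R N" "p = a \<otimes> q" using p by auto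
        then have "p \<in> M" using JT PT by blast
        then show ?thesis using x by (simp add: rann_mem)
      qed
      then have "x \<in> ?Q (Suc N)" using x unfolding rann_mem by blast
      moreover have "?Q (Suc N) = ?Q N" by (rule N[rule_format]) simp
      ultimately show "x \<in> ?Q N" by blast
    qed
    moreover have "?Q N \<subseteq> rann R M"
      using rann_antimono[of M T] M(2) rann_lann_rann[OF J_prods_subset] by (simp add: T_def)
    ultimately have "rann R M = ?Q N" by blast
    then have "M = T" using closed[OF M(1)] by (simp add: T_def)
    then show False using M(2) by blast
  qed
  then show ?thesis using PT by (auto simp: J_nilpotent_def)
qed


section \<open>Socles and Kasch rings\<close>

text \<open>T-nilpotence as an induction principle: a property of \<open>1\<close> that some left
  factor from \<open>J\<close> can always prolong must reach \<open>0\<close>.\<close>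

lemma right_T_nilpotent_choice:
  assumes T: "right_T_nilpotent R J" and one: "Q \<one>"
    and step: "\<And>p. p \<in> carrier R \<Longrightarrow> Q p \<Longrightarrow> \<exists>a\<in>J. Q (a \<otimes> p)"
  shows "Q \<zero>"
proof -
  \<comment> \<open>The choice lies in \<open>J\<close> even where \<open>Q\<close> fails, with
    \<open>0\<close> as default, so that it can be made for every element of the ring.\<close>
  define ch where "ch p = (SOME a. a \<in> J \<and> (Q p \<longrightarrow> Q (a \<otimes> p)))" for p
  have ch: "ch p \<in> J \<and> (Q p \<longrightarrow> Q (ch p \<otimes> p))" if "p \<in> carrier R" for p
  proof -
    have "\<exists>a. a \<in> J \<and> (Q p \<longrightarrow> Q (a \<otimes> p))" using step[OF that] J_zero by blast
    then show ?thesis unfolding ch_def by (rule someI_ex)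
  qed
  define p where "p = rec_nat \<one> (\<lambda>_ p. ch p \<otimes> p)"
  have p0: "p 0 = \<one>" and pS: "p (Suc n) = ch (p n) \<otimes> p n" for n by (simp_all add: p_def)
  have P: "p n \<in> carrier R \<and> Q (p n)" for n
  proof (induction n)
    case 0 show ?case using one by (simp add: p0)
  next
    case (Suc n) then show ?case using ch[of "p n"] J_carr by (simp add: pS)
  qed
  have "rev_prod R (\<lambda>n. ch (p n)) n = p n" for n by (induction n) (simp_all add: p0 pS)
  moreover have "\<forall>n. ch (p n) \<in> J" using ch P by blast
  then obtain n where "rev_prod R (\<lambda>n. ch (p n)) n = \<zero>"
    using T[unfolded right_T_nilpotent_def, rule_format, of "\<lambda>n. ch (p n)"] by auto
  ultimately show ?thesis using P by metis
qed

text \<open>Otherwise every nonzero multiple of \<open>x\<close> could be multiplied by an element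
  of \<open>J\<close> without vanishing, and this would never stop.\<close>

lemma right_T_nilpotent_element:
  assumes T: "right_T_nilpotent R J" and x: "x \<in> carrier R" "x \<noteq> \<zero>"
  shows "\<exists>r\<in>carrier R. r \<otimes> x \<noteq> \<zero> \<and> (\<forall>j\<in>J. j \<otimes> (r \<otimes> x) = \<zero>)"
proof (rule ccontr)
  assume n: "\<not> ?thesis"
  have "\<zero> \<otimes> x \<noteq> \<zero>"
  proof (rule right_T_nilpotent_choice[OF T, where Q = "\<lambda>p. p \<otimes> x \<noteq> \<zero>"])
    show "\<one> \<otimes> x \<noteq> \<zero>" using x by simp
    show "\<exists>a\<in>J. a \<otimes> p \<otimes> x \<noteq> \<zero>" if "p \<in> carrier R" "p \<otimes> x \<noteq> \<zero>" for p
      using n that x J_carr by (metis m_assoc)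
  qed
  then show False using x by simp
qed

lemma right_T_nilpotent_of_nilpotent:
  assumes "J_nilpotent R"
  shows "right_T_nilpotent R J"
  unfolding right_T_nilpotent_def
proof (intro allI impI)
  fix a :: "nat \<Rightarrow> 'a" assume a: "\<forall>n. a n \<in> J"
  have "rev_prod R a n \<in> J_prods R n" for n
    by (induction n) (use a in auto)
  moreover obtain n where "J_prods R n \<subseteq> {\<zero>}" using assms by (auto simp: J_nilpotent_def)
  ultimately show "\<exists>n. rev_prod R a n = \<zero>" by blast
qed

definition two_sided :: "'a set \<Rightarrow> bool" where
  "two_sided B \<longleftrightarrow> over_J R B \<and> right_ideal (opp_ring R) B"

text \<open>Take \<open>h = 1 - f\<close> for \<open>f\<close> splitting off \<open>M\<close>. Its
  use: if \<open>s\<close> kills \<open>J\<close> from the left, then \<open>s h\<close> kills all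
  of \<open>M\<close>.\<close>

lemma maximal_complement:
  assumes S: "radical_split R" and M: "maximal_right_ideal R M"
  shows "\<exists>h\<in>carrier R. h \<notin> M \<and> (\<forall>m\<in>M. h \<otimes> m \<in> J)"
proof -
  note MD = maximal_right_idealD[OF M]
  obtain f where f: "f \<in> M" "\<forall>a\<in>M. cong a (f \<otimes> a)" using radical_split_ex[OF S MD(1)] by blast
  have fc: "f \<in> carrier R" using f(1) right_ideal_carr[OF MD(1)] by blast
  have "\<one> \<ominus> f \<notin> M"
    using right_ideal_add[OF MD(1) _ f(1), of "\<one> \<ominus> f"] MD(3) fc by (auto simp: minus_add_cancel)
  moreover have "(\<one> \<ominus> f) \<otimes> m \<in> J" if "m \<in> M" for m
    using f(2) that fc right_ideal_carr[OF MD(1) that] by (auto simp: cong_def l_distr_minus)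
  ultimately show ?thesis using fc by (intro bexI[of _ "\<one> \<ominus> f"]) auto
qed

text \<open>Suppose \<open>j s\<close> is nonzero; split off its right annihilator by
  \<open>f\<close> and put \<open>h = 1 - f\<close>. Then \<open>s h\<close> is nonzero, and
  singularity of \<open>j\<close> gives \<open>s h y\<close> nonzero with
  \<open>j s h y = 0\<close>. So \<open>h y\<close> is fixed by \<open>f\<close> modulo
  \<open>J\<close>, while \<open>f h\<close> is in \<open>J\<close>; hence \<open>h y\<close> is in
  \<open>J\<close> and \<open>s h y = 0\<close>.\<close>

lemma J_mult_left_socle:
  assumes S: "radical_split R" and inj: "right_small_injective R"
    and s: "s \<in> lann R J" and j: "j \<in> J"
  shows "j \<otimes> s = \<zero>"
proof (rule ccontr)
  assume n: "j \<otimes> s \<noteq> \<zero>"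
  have c: "s \<in> carrier R" "j \<in> carrier R" using s j J_carr by (auto simp: lann_mem)
  have sJ: "s \<otimes> x = \<zero>" if "x \<in> J" for x using s that by (simp add: lann_mem)
  define K where "K = {x \<in> carrier R. (j \<otimes> s) \<otimes> x \<in> {\<zero>}}"
  have K: "right_ideal R K"
    unfolding K_def using right_ideal_trivial c by (intro right_ideal_preimage) auto
  obtain f where f: "f \<in> K" "\<forall>a\<in>K. cong a (f \<otimes> a)" using radical_split_ex[OF S K] by blast
  have fc: "f \<in> carrier R" using f(1) by (simp add: K_def)
  let ?h = "\<one> \<ominus> f"
  have hc: "?h \<in> carrier R" using fc by simp
  have hK: "?h \<notin> K"
  proof
    assume "?h \<in> K"
    then have "\<one> \<in> K" using right_ideal_add[OF K _ f(1)] fc by (metis minus_add_cancel one_closed)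
    then show False using n c by (simp add: K_def)
  qed
  then have sh: "s \<otimes> ?h \<noteq> \<zero>" using c hc by (auto simp: K_def m_assoc)
  then have "rPIdl (s \<otimes> ?h) \<noteq> {\<zero>}" using rPIdl_mem[of "s \<otimes> ?h"] c hc by auto
  then obtain k where k: "k \<in> rPIdl (s \<otimes> ?h)" "k \<noteq> \<zero>" "j \<otimes> k = \<zero>"
    using J_singular[OF inj j, of "rPIdl (s \<otimes> ?h)"] right_ideal_rPIdl c hc by auto
  then obtain y where y: "y \<in> carrier R" "k = s \<otimes> ?h \<otimes> y" by (auto simp: rPIdl_def)
  have hy: "?h \<otimes> y \<in> K" using k y c hc by (simp add: K_def m_assoc)
  then have "cong (?h \<otimes> y) (f \<otimes> (?h \<otimes> y))" using f(2) by blast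
  then have d: "?h \<otimes> y \<ominus> f \<otimes> (?h \<otimes> y) \<in> J" by (simp add: cong_def)
  have ff: "f \<ominus> f \<otimes> f \<in> J" using f by (auto simp: cong_def)
  have "f \<otimes> (?h \<otimes> y) = (f \<ominus> f \<otimes> f) \<otimes> y" using fc y(1) by (simp add: r_distr_minus m_assoc[symmetric])
  then have fJ: "f \<otimes> (?h \<otimes> y) \<in> J" using ff y(1) J_mult_right by simp
  have "?h \<otimes> y \<in> J"
    using J_add[OF d fJ] minus_add_cancel[of "?h \<otimes> y" "f \<otimes> (?h \<otimes> y)"] hc fc y(1) by simp
  then show False using sJ k(2) y c hc by (simp add: m_assoc)
qed

text \<open>By \<open>ess\<close> every nonzero right ideal contains a nonzero element of
  \<open>l(J)\<close>, so a \<open>z\<close> killing \<open>l(J)\<close> is singular.\<close>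

lemma left_socle_faithful:
  assumes baer: "right_baer R"
    and ess: "\<And>x. x \<in> carrier R \<Longrightarrow> x \<noteq> \<zero> \<Longrightarrow> \<exists>r\<in>carrier R. x \<otimes> r \<noteq> \<zero> \<and> x \<otimes> r \<in> lann R J"
    and z: "z \<in> carrier R" "\<And>s. s \<in> lann R J \<Longrightarrow> z \<otimes> s = \<zero>"
  shows "z \<in> J"
proof (rule J_of_singular[OF baer z(1)])
  fix K assume K: "right_ideal R K" "K \<noteq> {\<zero>}"
  then obtain x where x: "x \<in> K" "x \<noteq> \<zero>" using right_ideal_zero[OF K(1)] by blast
  then obtain r where r: "r \<in> carrier R" "x \<otimes> r \<noteq> \<zero>" "x \<otimes> r \<in> lann R J"
    using ess right_ideal_carr[OF K(1)] by blast
  then show "\<exists>k\<in>K. k \<noteq> \<zero> \<and> z \<otimes> k = \<zero>" using z(2) right_ideal_mult[OF K(1) x(1) r(1)] by blast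
qed

text \<open>Here the part of the socle killed by \<open>B\<close> but not by \<open>C\<close> is
  shown to be seen by the annihilator of the part killed by \<open>C\<close>. The pair
  \<open>x\<close>, \<open>s\<close> witnesses strict growth of the operator applied to two-sided
  ideals in \<open>right_socle_faithful\<close>.\<close>

lemma right_socle_faithful_step:
  assumes S: "radical_split R" and baer: "right_baer R"
    and JS: "\<And>j s. j \<in> J \<Longrightarrow> s \<in> lann R J \<Longrightarrow> j \<otimes> s = \<zero>"
    and faith: "\<And>z. z \<in> carrier R \<Longrightarrow> (\<And>s. s \<in> lann R J \<Longrightarrow> z \<otimes> s = \<zero>) \<Longrightarrow> z \<in> J"
    and B: "two_sided B" and C: "two_sided C" and c: "c \<in> C" "c \<notin> B"
  shows "\<exists>x s. x \<in> rann R (lann R J \<inter> rann R C) \<and> s \<in> lann R J \<inter> rann R B \<and> s \<otimes> x \<noteq> \<zero>"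
proof -
  have Br: "right_ideal R B" and Bl: "right_ideal (opp_ring R) B" and JB: "J \<subseteq> B"
    using B by (auto simp: two_sided_def over_J_def)
  have Cr: "right_ideal R C" and Cl: "right_ideal (opp_ring R) C"
    using C by (auto simp: two_sided_def over_J_def)
  note Bs = right_ideal_simps[OF Br] left_ideal_simps(4)[OF Bl]
  note Cs = right_ideal_simps[OF Cr] left_ideal_simps(4)[OF Cl]
  have Sc: "s \<in> carrier R" and SJ: "j \<in> J \<Longrightarrow> s \<otimes> j = \<zero>" if "s \<in> lann R J" for s j
    using that by (auto simp: lann_mem)
  have cc: "c \<in> carrier R" using c(1) by (rule Cs(1))
  obtain f where f: "f \<in> B" "\<forall>a\<in>B. cong a (f \<otimes> a)" using radical_split_ex[OF S Br] by blast
  have fc: "f \<in> carrier R" using f(1) by (rule Bs(1))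
  \<comment> \<open>As \<open>B\<close> is two-sided, \<open>f\<close> also acts as a right identity
    on it modulo \<open>J\<close>: with \<open>y = b - b f\<close>, the product \<open>y s b\<close>
    is in \<open>J\<close> because \<open>s b\<close> lies in \<open>B\<close>, and regularity then
    puts \<open>y\<close> in \<open>J\<close>.\<close>
  have comm: "b \<ominus> b \<otimes> f \<in> J" if b: "b \<in> B" for b
  proof -
    have bc: "b \<in> carrier R" using b by (rule Bs(1))
    let ?y = "b \<ominus> b \<otimes> f"
    have yc: "?y \<in> carrier R" using bc fc by simp
    obtain s where s: "s \<in> carrier R" "cong ?y (?y \<otimes> s \<otimes> ?y)" using radical_split_regular[OF S yc] by blast
    have "s \<otimes> b \<in> B" using b s(1) by (rule Bs(7))
    then have d: "s \<otimes> b \<ominus> f \<otimes> (s \<otimes> b) \<in> J" using f(2) by (auto simp: cong_def)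
    have "?y \<otimes> s \<otimes> b = b \<otimes> (s \<otimes> b \<ominus> f \<otimes> (s \<otimes> b))"
      using bc fc s(1) by (simp add: l_distr_minus r_distr_minus m_assoc)
    then have ysb: "?y \<otimes> s \<otimes> b \<in> J" using d bc J_mult_left by simp
    have "?y \<otimes> s \<otimes> ?y = ?y \<otimes> s \<otimes> b \<ominus> ?y \<otimes> s \<otimes> b \<otimes> f"
      using bc fc s(1) yc by (simp add: r_distr_minus m_assoc)
    then have "?y \<otimes> s \<otimes> ?y \<in> J" using ysb fc J_minus J_mult_right by simp
    then show ?thesis using s(2) cong_J by blast
  qed
  \<comment> \<open>The part of \<open>c\<close> outside \<open>B\<close>: it stays in
    \<open>C\<close>, and \<open>B c'\<close> is contained in \<open>J\<close>, so \<open>B\<close>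
    kills \<open>c' s0\<close> for every \<open>s0\<close> in \<open>l(J)\<close>.\<close>
  define c' where "c' = c \<ominus> f \<otimes> c"
  have c'C: "c' \<in> C" unfolding c'_def using c(1) fc by (intro Cs(6) Cs(7))
  have c'c: "c' \<in> carrier R" using c'C by (rule Cs(1))
  have "c' \<notin> J"
  proof
    assume "c' \<in> J"
    then have "cong c (f \<otimes> c)" using cc fc by (simp add: cong_def c'_def)
    moreover have "f \<otimes> c \<in> B" using f(1) cc by (rule Bs(4))
    ultimately show False using c(2) cong_mem[OF _ Br JB] by blast
  qed
  then obtain s0 where s0: "s0 \<in> lann R J" "c' \<otimes> s0 \<noteq> \<zero>" using faith[OF c'c] by blast
  have s0c: "s0 \<in> carrier R" using s0(1) by (rule Sc)
  define s1 where "s1 = c' \<otimes> s0"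
  have s1c: "s1 \<in> carrier R" using c'c s0c by (simp add: s1_def)
  have s1S: "s1 \<otimes> j = \<zero>" if "j \<in> J" for j
    using SJ[OF s0(1) that] c'c s0c J_carr[OF that] by (simp add: s1_def m_assoc)
  obtain t where t: "t \<in> carrier R" "cong c' (c' \<otimes> t \<otimes> c')" using radical_split_regular[OF S c'c] by blast
  \<comment> \<open>An element of \<open>C\<close> that acts as the identity on \<open>s1\<close>.
    It prevents \<open>s1\<close> from being a left multiple of anything killed by
    \<open>C\<close>.\<close>
  define d where "d = c' \<otimes> t"
  have dC: "d \<in> C" unfolding d_def using c'C t(1) by (rule Cs(4))
  have dc: "d \<in> carrier R" using dC by (rule Cs(1))
  have ds1: "d \<otimes> s1 = s1"
  proof -
    have "(c' \<ominus> c' \<otimes> t \<otimes> c') \<otimes> s0 = \<zero>" using t(2) JS s0(1) by (simp add: cong_def)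
    then have "s1 \<ominus> d \<otimes> s1 = \<zero>" using c'c t(1) s0c by (simp add: d_def s1_def l_distr_minus m_assoc)
    then show ?thesis using eq_iff_minus_zero[of s1 "d \<otimes> s1"] s1c dc by simp
  qed
  have Bs1: "b \<otimes> s1 = \<zero>" if b: "b \<in> B" for b
  proof -
    have bc: "b \<in> carrier R" using b by (rule Bs(1))
    have "b \<otimes> c' = (b \<ominus> b \<otimes> f) \<otimes> c" using bc fc cc by (simp add: c'_def l_distr_minus r_distr_minus m_assoc)
    then have "b \<otimes> c' \<in> J" using comm[OF b] cc J_mult_right by simp
    then have "b \<otimes> c' \<otimes> s0 = \<zero>" using JS s0(1) by blast
    then show ?thesis using bc c'c s0c by (simp add: s1_def m_assoc)
  qed
  \<comment> \<open>Replacing \<open>s1\<close> by \<open>s = s1 h\<close>, with \<open>h\<close>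
    complementary to a maximal \<open>M\<close> above the right annihilator of \<open>s1\<close>,
    gives a nonzero element killed by \<open>M\<close>; it keeps the other properties of
    \<open>s1\<close>.\<close>
  define K where "K = {x \<in> carrier R. s1 \<otimes> x \<in> {\<zero>}}"
  have K: "right_ideal R K"
    unfolding K_def using right_ideal_trivial s1c by (rule right_ideal_preimage)
  have "\<one> \<notin> K" using s0(2) s1c by (simp add: K_def s1_def)
  then have "K \<noteq> carrier R" by blast
  then obtain M where M: "maximal_right_ideal R M" "K \<subseteq> M" using ex_maximal_right_ideal[OF K] by blast
  note MD = maximal_right_idealD[OF M(1)]
  obtain h where h: "h \<in> carrier R" "h \<notin> M" "\<forall>m\<in>M. h \<otimes> m \<in> J"
    using maximal_complement[OF S M(1)] by blast
  have Mc: "m \<in> carrier R" if "m \<in> M" for m using that by (rule right_ideal_carr[OF MD(1)])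
  define s where "s = s1 \<otimes> h"
  have sc: "s \<in> carrier R" using s1c h(1) by (simp add: s_def)
  have s0': "s \<noteq> \<zero>" using M(2) h(1,2) by (auto simp: K_def s_def)
  have sM: "s \<otimes> m = \<zero>" if "m \<in> M" for m
    using s1S h(1,3) that s1c Mc[OF that] by (simp add: s_def m_assoc)
  have sS: "s \<in> lann R J" using sc sM J_le_maximal[OF M(1)] by (auto simp: lann_mem)
  have sB: "s \<in> rann R B"
  proof -
    have "b \<otimes> s = \<zero>" if "b \<in> B" for b
      using Bs1[OF that] Bs(1)[OF that] s1c h(1) by (simp add: s_def m_assoc[symmetric])
    then show ?thesis using sc by (simp add: rann_mem)
  qed
  have ds: "d \<otimes> s = s" using ds1 dc s1c h(1) by (simp add: s_def m_assoc[symmetric])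
  let ?D = "rann R (lann R J \<inter> rann R C)"
  \<comment> \<open>If \<open>s\<close> killed \<open>?D\<close>, then \<open>h\<close> would not be
    in \<open>?D\<close>, since \<open>M\<close> and \<open>h\<close> generate \<open>R\<close>. So
    some \<open>u\<close> in the socle, killed by \<open>C\<close>, has \<open>u h\<close> nonzero
    with right annihilator \<open>M\<close>. Then \<open>s = e u h\<close> for some
    \<open>e\<close>, and \<open>d s = (d e) u h = 0\<close> contradicts
    \<open>d s = s\<close>.\<close>
  have "\<exists>x\<in>?D. s \<otimes> x \<noteq> \<zero>"
  proof (rule ccontr)
    assume n: "\<not> ?thesis"
    have "h \<notin> ?D"
    proof
      assume "h \<in> ?D"
      then have "s \<otimes> h = \<zero>" using n by blast
      define A where "A = {x \<in> carrier R. s \<otimes> x \<in> {\<zero>}}"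
      have A: "right_ideal R A" unfolding A_def using right_ideal_trivial sc by (rule right_ideal_preimage)
      have "M \<subseteq> A" using sM Mc by (auto simp: A_def)
      moreover have "h \<in> A" using h(1) \<open>s \<otimes> h = \<zero>\<close> by (simp add: A_def)
      ultimately have "A = carrier R" using MD(4)[OF A] h(2) by blast
      then have "\<one> \<in> A" by simp
      then show False using s0' sc by (simp add: A_def)
    qed
    then obtain u where u: "u \<in> lann R J" "u \<in> rann R C" "u \<otimes> h \<noteq> \<zero>" using h(1) by (auto simp: rann_mem)
    have uc: "u \<in> carrier R" using u(1) by (rule Sc)
    define A where "A = {x \<in> carrier R. (u \<otimes> h) \<otimes> x \<in> {\<zero>}}"
    have A: "right_ideal R A"
      unfolding A_def using right_ideal_trivial uc h(1) by (intro right_ideal_preimage) auto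
    have "M \<subseteq> A"
      using SJ[OF u(1)] h(1,3) uc Mc by (auto simp: A_def m_assoc)
    moreover have "\<one> \<notin> A" using u(3) uc h(1) by (simp add: A_def)
    ultimately have "A = M" using MD(4)[OF A] by blast
    then have "s \<otimes> r = \<zero>" if "r \<in> carrier R" "u \<otimes> h \<otimes> r = \<zero>" for r
      using sM[of r] that by (auto simp: A_def)
    then obtain e where e: "e \<in> carrier R" "s = e \<otimes> (u \<otimes> h)"
      using baer_principal[OF baer, of "u \<otimes> h" s] uc h(1) sc by auto
    have "d \<otimes> e \<in> C" using dC e(1) by (rule Cs(4))
    then have "d \<otimes> e \<otimes> u = \<zero>" using u(2) by (simp add: rann_mem)
    then have "d \<otimes> s = \<zero>" using e dc uc h(1) by (simp add: m_assoc[symmetric])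
    then show False using ds s0' by simp
  qed
  then show ?thesis using sS sB by blast
qed

text \<open>The set \<open>l(J) \<inter> r(B)\<close> absorbs right factors, so its right
  annihilator is also a left ideal. Thus the operator can be iterated.\<close>

lemma two_sided_annihilator:
  assumes JS: "\<And>j s. j \<in> J \<Longrightarrow> s \<in> lann R J \<Longrightarrow> j \<otimes> s = \<zero>" and B: "two_sided B"
  shows "two_sided (rann R (lann R J \<inter> rann R B))"
proof -
  interpret op: ring "opp_ring R" by (rule ring_opp)
  have Br: "right_ideal R B" using B by (simp add: two_sided_def over_J_def)
  let ?T = "lann R J \<inter> rann R B"
  have Tc: "?T \<subseteq> carrier R" by (auto simp: lann_mem)
  have Bc: "b \<in> carrier R" if "b \<in> B" for b using that by (rule right_ideal_carr[OF Br])
  have Tm: "t \<otimes> r \<in> ?T" if "t \<in> ?T" "r \<in> carrier R" for t r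
  proof -
    have "t \<otimes> r \<otimes> j = \<zero>" if j: "j \<in> J" for j
      using \<open>t \<in> ?T\<close> \<open>r \<in> carrier R\<close> J_mult_left[OF j, of r] J_carr[OF j] by (simp add: lann_mem m_assoc)
    moreover have "b \<otimes> (t \<otimes> r) = \<zero>" if b: "b \<in> B" for b
      using \<open>t \<in> ?T\<close> \<open>r \<in> carrier R\<close> Bc[OF b] b by (simp add: lann_mem rann_mem m_assoc[symmetric])
    ultimately show ?thesis using that by (simp add: lann_mem rann_mem)
  qed
  have D: "right_ideal R (rann R ?T)" using Tc by (rule right_ideal_rann)
  note Ds = right_ideal_simps[OF D]
  have "right_ideal (opp_ring R) (rann R ?T)"
  proof (rule op.right_idealI)
    fix x r assume x: "x \<in> rann R ?T" and r: "r \<in> carrier (opp_ring R)"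
    have "t \<otimes> (r \<otimes> x) = \<zero>" if t: "t \<in> ?T" for t
    proof -
      have "t \<otimes> r \<otimes> x = \<zero>" using Tm[OF t] r x unfolding rann_mem by simp
      then show ?thesis using t Tc r Ds(1)[OF x] by (auto simp: m_assoc subset_iff)
    qed
    then show "x \<otimes>\<^bsub>opp_ring R\<^esub> r \<in> rann R ?T" using Ds(1)[OF x] r by (simp add: rann_mem)
  qed (use Ds in auto)
  moreover have "J \<subseteq> rann R ?T" using J_carr by (auto simp: rann_mem lann_mem)
  ultimately show ?thesis using D by (simp add: two_sided_def over_J_def)
qed

text \<open>
  With \<open>S = l(J)\<close>, the map \<open>\<phi> B = r({s \<in> S. B s = 0})\<close> is strictly increasing on the ideals above
  \<open>J\<close>. If \<open>\<phi> J = r(S)\<close> were larger than \<open>J\<close>, its iterates would form an infinite ascending chain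
  modulo \<open>J\<close>.
\<close>

lemma right_socle_faithful:
  assumes S: "radical_split R" and baer: "right_baer R"
    and JS: "\<And>j s. j \<in> J \<Longrightarrow> s \<in> lann R J \<Longrightarrow> j \<otimes> s = \<zero>"
    and faith: "\<And>z. z \<in> carrier R \<Longrightarrow> (\<And>s. s \<in> lann R J \<Longrightarrow> z \<otimes> s = \<zero>) \<Longrightarrow> z \<in> J"
  shows "rann R (lann R J) \<subseteq> J"
proof (rule ccontr)
  assume n: "\<not> ?thesis"
  define \<phi> where "\<phi> B = rann R (lann R J \<inter> rann R B)" for B
  have ts: "two_sided (\<phi> B)" if "two_sided B" for B
    unfolding \<phi>_def using JS that by (rule two_sided_annihilator)
  have mono: "\<phi> B \<subseteq> \<phi> C" if "B \<subseteq> C" for B C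
    unfolding \<phi>_def using rann_antimono[OF that] by (intro rann_antimono) blast
  have strict: "\<phi> B \<noteq> \<phi> C" if BC: "two_sided B" "two_sided C" "B \<subset> C" for B C
  proof -
    obtain c where c: "c \<in> C" "c \<notin> B" using BC(3) by blast
    obtain x s where "x \<in> \<phi> C" "s \<in> lann R J \<inter> rann R B" "s \<otimes> x \<noteq> \<zero>"
      using right_socle_faithful_step[OF S baer JS faith BC(1,2) c] unfolding \<phi>_def by blast
    then have "x \<notin> \<phi> B" unfolding \<phi>_def rann_mem by blast
    then show ?thesis using \<open>x \<in> \<phi> C\<close> by blast
  qed
  have tJ: "two_sided J" using J_right J_left by (simp add: two_sided_def over_J_def)
  have "lann R J \<inter> rann R J = lann R J" using JS by (auto simp: lann_mem rann_mem)
  then have \<phi>J: "\<phi> J = rann R (lann R J)" by (simp add: \<phi>_def)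
  define F where "F = rec_nat J (\<lambda>_. \<phi>)"
  have F0: "F 0 = J" and FS: "F (Suc n) = \<phi> (F n)" for n by (simp_all add: F_def)
  have Ft: "two_sided (F n)" for n by (induction n) (simp_all add: F0 FS tJ ts)
  have Fs: "F n \<subset> F (Suc n)" for n
  proof (induction n)
    case 0
    have "J \<subseteq> \<phi> J" using ts[OF tJ] by (simp add: two_sided_def over_J_def)
    then show ?case using n \<phi>J by (auto simp: F0 FS)
  next
    case (Suc n)
    then show ?case using mono[of "F n" "F (Suc n)"] strict[OF Ft Ft Suc] by (auto simp: FS)
  qed
  have "\<exists>N. \<forall>n\<ge>N. F n = F N"
    using Ft Fs by (intro ACC_stable[OF radical_split_ACC[OF S]]) (auto simp: two_sided_def)
  then show False using Fs by (metis le_SucI order_refl psubset_eq)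
qed

text \<open>Equivalently, every simple right module embeds in \<open>R\<close>: left multiplication
  by \<open>a\<close> embeds \<open>R/M\<close>.\<close>

definition right_kasch :: bool where
  "right_kasch \<longleftrightarrow> (\<forall>M. maximal_right_ideal R M \<longrightarrow> (\<exists>a\<in>carrier R. a \<noteq> \<zero> \<and> (\<forall>m\<in>M. a \<otimes> m = \<zero>)))"

text \<open>The complement \<open>h\<close> of \<open>M\<close> is not in \<open>J\<close>, so some
  \<open>s\<close> in \<open>X\<close> has \<open>s h\<close> nonzero; and \<open>s h\<close> kills
  \<open>M\<close> because \<open>h M\<close> lies in \<open>J\<close>.\<close>

lemma right_kaschI:
  assumes S: "radical_split R" and X: "X \<subseteq> lann R J" and r: "rann R X \<subseteq> J"
  shows right_kasch
  unfolding right_kasch_def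
proof (intro allI impI)
  fix M assume M: "maximal_right_ideal R M"
  note MD = maximal_right_idealD[OF M]
  obtain h where h: "h \<in> carrier R" "h \<notin> M" "\<forall>m\<in>M. h \<otimes> m \<in> J" using maximal_complement[OF S M] by blast
  have "h \<notin> rann R X" using r h(2) J_le_maximal[OF M] by blast
  then obtain s where s: "s \<in> X" "s \<otimes> h \<noteq> \<zero>" using h(1) by (auto simp: rann_mem)
  have sJ: "s \<in> carrier R" "\<And>j. j \<in> J \<Longrightarrow> s \<otimes> j = \<zero>" using s(1) X by (auto simp: lann_mem)
  have "s \<otimes> h \<otimes> m = \<zero>" if "m \<in> M" for m
    using sJ h that right_ideal_carr[OF MD(1) that] by (simp add: m_assoc)
  then show "\<exists>a\<in>carrier R. a \<noteq> \<zero> \<and> (\<forall>m\<in>M. a \<otimes> m = \<zero>)"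
    using s(2) sJ(1) h(1) by (intro bexI[of _ "s \<otimes> h"]) auto
qed

text \<open>T-nilpotence in the opposite ring puts a nonzero element of \<open>l(J)\<close> into
  every nonzero right ideal. The intermediate facts are exported because the perfect case needs them
  for the other side.\<close>

lemma right_kasch_of_T_nilpotent:
  assumes S: "radical_split R" and baer: "right_baer R" and T: "right_T_nilpotent (opp_ring R) J"
  shows "right_kasch" "rann R (lann R J) \<subseteq> J"
    "\<And>j s. j \<in> J \<Longrightarrow> s \<in> lann R J \<Longrightarrow> j \<otimes> s = \<zero>"
    "\<And>z. z \<in> carrier R \<Longrightarrow> (\<And>s. s \<in> lann R J \<Longrightarrow> z \<otimes> s = \<zero>) \<Longrightarrow> z \<in> J"
proof -
  interpret op: ring "opp_ring R" by (rule ring_opp)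
  show JS: "j \<otimes> s = \<zero>" if "j \<in> J" "s \<in> lann R J" for j s
    using J_mult_left_socle[OF S right_small_injective_of_baer[OF baer] that(2,1)] .
  have ess: "\<exists>r\<in>carrier R. x \<otimes> r \<noteq> \<zero> \<and> x \<otimes> r \<in> lann R J" if "x \<in> carrier R" "x \<noteq> \<zero>" for x
    using op.right_T_nilpotent_element[of x] T that by (auto simp: lann_mem)
  show faith: "z \<in> J" if "z \<in> carrier R" "\<And>s. s \<in> lann R J \<Longrightarrow> z \<otimes> s = \<zero>" for z
    using left_socle_faithful[OF baer ess that] .
  show r: "rann R (lann R J) \<subseteq> J" using right_socle_faithful[OF S baer JS faith] .
  show right_kasch using right_kaschI[OF S subset_refl r] .
qed

text \<open>Suppose \<open>x\<close> is in \<open>r(l(I))\<close> but not in \<open>I\<close>. The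
  \<open>r\<close> with \<open>x r\<close> in \<open>I\<close> lie in a maximal \<open>M\<close>,
  killed by some nonzero \<open>a\<close>. Then \<open>x r + i \<mapsto> a r\<close> is well
  defined, and its multiplier kills \<open>I\<close> but sends \<open>x\<close> to
  \<open>a\<close>.\<close>

lemma right_closed_of_kasch:
  assumes baer: "right_baer R" and k: right_kasch and I: "right_ideal R I"
  shows "rann R (lann R I) = I"
proof
  show "I \<subseteq> rann R (lann R I)" using right_ideal_subset[OF I] by (rule rann_lann_ge)
  show "rann R (lann R I) \<subseteq> I"
  proof (rule subsetI, rule ccontr)
    fix x assume x: "x \<in> rann R (lann R I)" and n: "x \<notin> I"
    have xc: "x \<in> carrier R" using x by (simp add: rann_mem)
    note Is = right_ideal_simps[OF I]
    define N where "N = {r \<in> carrier R. x \<otimes> r \<in> I}"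
    have N: "right_ideal R N" unfolding N_def using I xc by (rule right_ideal_preimage)
    have "\<one> \<notin> N" using n xc by (simp add: N_def)
    then have "N \<noteq> carrier R" by blast
    then obtain M where M: "maximal_right_ideal R M" "N \<subseteq> M" using ex_maximal_right_ideal[OF N] by blast
    obtain a where a: "a \<in> carrier R" "a \<noteq> \<zero>" "\<forall>m\<in>M. a \<otimes> m = \<zero>" using k M(1) unfolding right_kasch_def by blast
    define G where "G = {(x \<otimes> r \<oplus> i, a \<otimes> r) | r i. r \<in> carrier R \<and> i \<in> I}"
    have GI: "(x \<otimes> r \<oplus> i, a \<otimes> r) \<in> G" if "r \<in> carrier R" "i \<in> I" for r i using that unfolding G_def by blast
    have GE: "\<exists>r\<in>carrier R. \<exists>i\<in>I. y = x \<otimes> r \<oplus> i \<and> z = a \<otimes> r" if "(y, z) \<in> G" for y z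
      using that unfolding G_def by blast
    have "\<exists>c\<in>carrier R. \<forall>y z. (y, z) \<in> G \<longrightarrow> z = c \<otimes> y"
    proof (rule extends_graph)
      show "y \<in> carrier R \<and> z \<in> carrier R" if "(y, z) \<in> G" for y z using GE[OF that] xc a(1) Is(1) by auto
      show "(\<zero>, \<zero>) \<in> G" using GI[OF zero_closed Is(2)] xc a(1) by simp
      show "(y \<oplus> y', z \<oplus> z') \<in> G" if h: "(y, z) \<in> G" "(y', z') \<in> G" for y z y' z'
      proof -
        obtain r i r' i' where g: "r \<in> carrier R" "i \<in> I" "y = x \<otimes> r \<oplus> i" "z = a \<otimes> r"
          "r' \<in> carrier R" "i' \<in> I" "y' = x \<otimes> r' \<oplus> i'" "z' = a \<otimes> r'" using GE[OF h(1)] GE[OF h(2)] by blast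
        then have "y \<oplus> y' = x \<otimes> (r \<oplus> r') \<oplus> (i \<oplus> i')" "z \<oplus> z' = a \<otimes> (r \<oplus> r')"
          using xc a(1) Is(1) by (simp_all add: r_distr a_ac)
        then show ?thesis using GI[OF _ Is(3)[OF g(2,6)], of "r \<oplus> r'"] g(1,5) by simp
      qed
      show "(y \<otimes> t, z \<otimes> t) \<in> G" if h: "(y, z) \<in> G" "t \<in> carrier R" for y z t
      proof -
        obtain r i where g: "r \<in> carrier R" "i \<in> I" "y = x \<otimes> r \<oplus> i" "z = a \<otimes> r" using GE[OF h(1)] by blast
        then have "y \<otimes> t = x \<otimes> (r \<otimes> t) \<oplus> i \<otimes> t" "z \<otimes> t = a \<otimes> (r \<otimes> t)"
          using xc a(1) Is(1) h(2) by (simp_all add: l_distr m_assoc)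
        then show ?thesis using GI[OF _ Is(4)[OF g(2) h(2)], of "r \<otimes> t"] g(1) h(2) by simp
      qed
      show "z = \<zero>" if h: "(\<zero>, z) \<in> G" for z
      proof -
        obtain r i where g: "r \<in> carrier R" "i \<in> I" "\<zero> = x \<otimes> r \<oplus> i" "z = a \<otimes> r" using GE[OF h] by blast
        then have "x \<otimes> r \<in> I" using right_ideal_add_cancel[OF I, of "x \<otimes> r" i] Is(2) xc by simp
        then show ?thesis using M(2) a(3) g(1,4) by (auto simp: N_def)
      qed
      show "extends_from R (Domain G)" if "right_ideal R (Domain G)" using baer that by (simp add: right_baer_def)
    qed
    then obtain c where c: "c \<in> carrier R" "\<And>y z. (y, z) \<in> G \<Longrightarrow> z = c \<otimes> y" by blast
    have "c \<otimes> i = \<zero>" if i: "i \<in> I" for i using c(2)[OF GI[OF zero_closed i]] xc a(1) Is(1)[OF i] by simp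
    then have "c \<in> lann R I" using c(1) by (simp add: lann_mem)
    then have "c \<otimes> x = \<zero>" using x by (simp add: rann_mem)
    moreover have "c \<otimes> x = a" using c(2)[OF GI[OF one_closed Is(2)]] xc a(1) by simp
    ultimately show False using a(2) by simp
  qed
qed


section \<open>Quasi-Frobenius rings\<close>

text \<open>For a right ideal \<open>U\<close> this says that \<open>U\<close> is artinian as a
  module; intersecting chains of arbitrary right ideals avoids speaking of submodules of
  \<open>U\<close>.\<close>

definition DCC_inside :: "'a set \<Rightarrow> bool" where
  "DCC_inside U \<longleftrightarrow> (\<forall>A :: nat \<Rightarrow> 'a set. (\<forall>n. right_ideal R (A n)) \<longrightarrow> (\<forall>n. A (Suc n) \<subseteq> A n) \<longrightarrow>
     (\<exists>N. \<forall>n\<ge>N. A n \<inter> U = A N \<inter> U))"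

text \<open>As \<open>x J\<close> lies in \<open>W\<close>, the module \<open>(W + x R)/W\<close> is
  a quotient of \<open>R/J\<close>, which is artinian. The proof is the usual one for extensions,
  with right ideals above \<open>J\<close> recording the images in the quotient.\<close>

lemma DCC_inside_extend:
  assumes S: "radical_split R" and W: "right_ideal R W" and dW: "DCC_inside W"
    and x: "x \<in> carrier R" and xJ: "\<And>j. j \<in> J \<Longrightarrow> x \<otimes> j \<in> W"
  shows "DCC_inside (W <+>\<^bsub>R\<^esub> rPIdl x)"
  unfolding DCC_inside_def
proof (intro allI impI)
  fix A :: "nat \<Rightarrow> 'a set"
  assume AR: "\<forall>n. right_ideal R (A n)" and Ad: "\<forall>n. A (Suc n) \<subseteq> A n"
  let ?U = "W <+>\<^bsub>R\<^esub> rPIdl x"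
  have U: "right_ideal R ?U" using W right_ideal_rPIdl[OF x] by (rule right_ideal_set_add)
  have WU: "W \<subseteq> ?U" using W right_ideal_rPIdl[OF x] by (rule set_add_ge1)
  have anti: "A j \<subseteq> A i" if "i \<le> j" for i j
    using lift_Suc_antimono_le[of A, OF Ad[rule_format] that] .
  have AU: "right_ideal R (A n \<inter> ?U)" for n using AR U right_ideal_Int by blast
  have V: "right_ideal R ((A n \<inter> ?U) <+>\<^bsub>R\<^esub> W)" for n using AU W by (rule right_ideal_set_add)
  define I where "I n = {r \<in> carrier R. x \<otimes> r \<in> (A n \<inter> ?U) <+>\<^bsub>R\<^esub> W}" for n
  have "over_J R (I n)" for n
    using right_ideal_preimage[OF V x] xJ set_add_ge2[OF AU W] J_carr by (auto simp: over_J_def I_def)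
  moreover have "I (Suc n) \<subseteq> I n" for n
    using Ad unfolding I_def set_add_mem by blast
  ultimately obtain N1 where N1: "\<forall>n\<ge>N1. I n = I N1"
    using DCC_stable[OF radical_split_DCC[OF S], of I] by blast
  obtain N2 where N2: "\<forall>n\<ge>N2. A n \<inter> W = A N2 \<inter> W"
    using dW[unfolded DCC_inside_def, rule_format, of A] AR Ad by auto
  let ?N = "max N1 N2"
  \<comment> \<open>Both components being stationary, write \<open>a = w + x r\<close>. The right
    ideal \<open>I n\<close> supplies \<open>a'\<close> in \<open>A n\<close> with
    \<open>a - a'\<close> in \<open>W\<close>, and this difference lies in
    \<open>A ?N \<inter> W = A n \<inter> W\<close>.\<close>
  have "A ?N \<inter> ?U \<subseteq> A n" if n: "n \<ge> ?N" for n
  proof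
    fix a assume a: "a \<in> A ?N \<inter> ?U"
    note cA = right_ideal_simps[OF AR[rule_format]] and cW = right_ideal_simps[OF W]
    obtain w r where w: "w \<in> W" "r \<in> carrier R" "a = w \<oplus> x \<otimes> r"
      using a unfolding Int_iff set_add_mem rPIdl_def by blast
    have wc: "w \<in> carrier R" using w(1) by (rule cW(1))
    have ac: "a \<in> carrier R" using a cA(1) by blast
    have "x \<otimes> r = a \<oplus> \<ominus> w" using add_minus_cancel[of w "x \<otimes> r"] w wc x by (simp add: a_minus_def)
    then have "x \<otimes> r \<in> (A ?N \<inter> ?U) <+>\<^bsub>R\<^esub> W" using set_add_I[OF a cW(5)[OF w(1)]] by simp
    then have "r \<in> I ?N" using w(2) by (simp add: I_def)
    moreover have "I ?N = I n" using N1[rule_format, of ?N] N1[rule_format, of n] n by simp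
    ultimately have "r \<in> I n" by blast
    then have "x \<otimes> r \<in> (A n \<inter> ?U) <+>\<^bsub>R\<^esub> W" by (simp add: I_def)
    then obtain a' w' where a': "a' \<in> A n" "w' \<in> W" "x \<otimes> r = a' \<oplus> w'" by (auto simp: set_add_mem)
    have c': "a' \<in> carrier R" "w' \<in> carrier R" using a' cA(1) cW(1) by blast+
    have aa: "a = a' \<oplus> (w \<oplus> w')" using w(3) a'(3) wc c' by (simp add: a_ac)
    then have "a \<ominus> a' = w \<oplus> w'" using add_minus_cancel[of a' "w \<oplus> w'"] c' wc by simp
    moreover have "a \<ominus> a' \<in> A ?N" using a a'(1) anti[OF n] by (intro cA(6)) auto
    ultimately have "w \<oplus> w' \<in> A ?N \<inter> W" using cW(3)[OF w(1) a'(2)] by simp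
    moreover have "A ?N \<inter> W = A n \<inter> W" using N2[rule_format, of ?N] N2[rule_format, of n] n by simp
    ultimately have "w \<oplus> w' \<in> A n" by blast
    then show "a \<in> A n" unfolding aa by (rule cA(3)[OF a'(1)])
  qed
  then have "A n \<inter> ?U = A ?N \<inter> ?U" if "n \<ge> ?N" for n using anti[OF that] that by blast
  then show "\<exists>N. \<forall>n\<ge>N. A n \<inter> ?U = A N \<inter> ?U" by blast
qed

lemma lann_J_prods_Suc:
  "x \<in> lann R (J_prods R (Suc n)) \<longleftrightarrow> x \<in> carrier R \<and> (\<forall>j\<in>J. x \<otimes> j \<in> lann R (J_prods R n))"
proof -
  interpret op: ring "opp_ring R" by (rule ring_opp)
  show ?thesis using op.rann_J_prods_Suc[of x n] by (simp del: J_prods.simps)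
qed

lemma right_ideal_lann_J_prods: "right_ideal R (lann R (J_prods R n))"
proof -
  interpret op: ring "opp_ring R" by (rule ring_opp)
  show ?thesis using op.left_ideal_rann_J_prods[of n] by simp
qed

lemma lann_J_prods_mono: "lann R (J_prods R n) \<subseteq> lann R (J_prods R (Suc n))"
proof -
  interpret op: ring "opp_ring R" by (rule ring_opp)
  show ?thesis using op.rann_J_prods_mono[of n] by (simp del: J_prods.simps)
qed

text \<open>The descending chain condition is transported up the series of left annihilators of \<open>J\<^sup>n\<close>.\<close>

lemma DCC_of_ACC:
  assumes S: "radical_split R" and nil: "J_nilpotent R" and A: "ACC (right_ideal R)"
  shows "DCC (right_ideal R)"
proof -
  let ?P = "\<lambda>n. lann R (J_prods R n)"
  have "DCC_inside (?P n)" for n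
  proof (induction n)
    case 0
    have "?P 0 = {\<zero>}" by (auto simp: lann_mem)
    then have "A n \<inter> ?P 0 = {\<zero>}" if "\<forall>n. right_ideal R (A n)" for A n
      using right_ideal_zero that by blast
    then show ?case unfolding DCC_inside_def by metis
  next
    case (Suc n)
    \<comment> \<open>A maximal artinian right ideal between consecutive terms must be the upper
      one, since any of its elements could be added.\<close>
    define Q where "Q U \<longleftrightarrow> ?P n \<subseteq> U \<and> U \<subseteq> ?P (Suc n) \<and> DCC_inside U" for U
    have "Q (?P n)" using Suc lann_J_prods_mono[of n] by (simp only: Q_def) blast
    then obtain U where U: "right_ideal R U" "Q U"
      "\<And>C. right_ideal R C \<Longrightarrow> Q C \<Longrightarrow> U \<subseteq> C \<Longrightarrow> C = U"
      using ACC_maximal[OF A right_ideal_lann_J_prods[of n]] by metis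
    have "?P (Suc n) \<subseteq> U"
    proof
      fix x assume x: "x \<in> ?P (Suc n)"
      have xc: "x \<in> carrier R" and xJ: "\<And>j. j \<in> J \<Longrightarrow> x \<otimes> j \<in> ?P n"
        using x unfolding lann_J_prods_Suc by blast+
      let ?C = "U <+>\<^bsub>R\<^esub> rPIdl x"
      have px: "right_ideal R (rPIdl x)" using xc by (rule right_ideal_rPIdl)
      have UC: "U \<subseteq> ?C" using U(1) px by (rule set_add_ge1)
      have "DCC_inside ?C"
        using U(2) xJ by (intro DCC_inside_extend[OF S U(1) _ xc]) (auto simp: Q_def)
      moreover have "rPIdl x \<subseteq> ?P (Suc n)" using right_ideal_lann_J_prods x by (rule rPIdl_le)
      then have "?C \<subseteq> ?P (Suc n)"
        using U(2) by (intro set_add_le[OF right_ideal_lann_J_prods]) (simp_all only: Q_def)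
      ultimately have "Q ?C" using U(2) UC unfolding Q_def by blast
      then have "?C = U" using U(3) right_ideal_set_add[OF U(1) px] UC by blast
      then show "x \<in> U" using set_add_ge2[OF U(1) px] rPIdl_mem[OF xc] by blast
    qed
    then have "U = ?P (Suc n)" using U(2) unfolding Q_def by blast
    then show ?case using U(2) unfolding Q_def by blast
  qed
  moreover obtain n where "J_prods R n \<subseteq> {\<zero>}" using nil by (auto simp: J_nilpotent_def)
  then have z: "p = \<zero>" if "p \<in> J_prods R n" for p using that by blast
  have "x \<otimes> p = \<zero>" if "x \<in> carrier R" "p \<in> J_prods R n" for x p
    unfolding z[OF that(2)] using that(1) by simp
  then have "?P n = carrier R" by (auto simp: lann_mem)
  ultimately have d: "DCC_inside (carrier R)" by metis
  show ?thesis
    unfolding DCC_def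
  proof (intro allI impI)
    fix F :: "nat \<Rightarrow> 'a set" assume F: "\<forall>n. right_ideal R (F n) \<and> F (Suc n) \<subseteq> F n"
    have "F n \<inter> carrier R = F n" for n using F right_ideal_subset by blast
    then show "\<exists>N. \<forall>n\<ge>N. F n = F N"
      using d[unfolded DCC_inside_def, rule_format, of F] F by simp
  qed
qed

text \<open>On a maximal left ideal where the homomorphism is a right multiplication nothing can be
  added. The extension step glues two multipliers, using that annihilators turn the intersection of
  left ideals into a sum of right ideals.\<close>

lemma left_baer_of_closed:
  assumes cl: "\<And>L. right_ideal (opp_ring R) L \<Longrightarrow> lann R (rann R L) = L"
    and cr: "\<And>I. right_ideal R I \<Longrightarrow> rann R (lann R I) = I"
    and A: "ACC (right_ideal (opp_ring R))"
  shows "right_baer (opp_ring R)"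
  unfolding right_baer_def extends_from_def
proof (intro allI impI)
  interpret op: ring "opp_ring R" by (rule ring_opp)
  fix L f assume L: "right_ideal (opp_ring R) L" and f: "linear_on (opp_ring R) L f"
  note Ls = left_ideal_simps[OF L]
  have fc: "f x \<in> carrier R" if "x \<in> L" for x using f that by (auto simp: linear_on_def)
  have fa: "f (x \<oplus> y) = f x \<oplus> f y" if "x \<in> L" "y \<in> L" for x y using f that by (auto simp: linear_on_def)
  have fm: "f (r \<otimes> x) = r \<otimes> f x" if "x \<in> L" "r \<in> carrier R" for x r
    using f that by (auto simp: linear_on_def)
  have f0: "f \<zero> = \<zero>" using fm[OF Ls(2) zero_closed] fc[OF Ls(2)] by simp
  define Q where "Q M \<longleftrightarrow> M \<subseteq> L \<and> (\<exists>c\<in>carrier R. \<forall>y\<in>M. f y = y \<otimes> c)" for M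
  have z: "right_ideal (opp_ring R) {\<zero>}" using op.right_ideal_trivial by simp
  have "Q {\<zero>}" using Ls(2) f0 by (auto simp: Q_def)
  then obtain M where M: "right_ideal (opp_ring R) M" "Q M"
    "\<And>C. right_ideal (opp_ring R) C \<Longrightarrow> Q C \<Longrightarrow> M \<subseteq> C \<Longrightarrow> C = M"
    using ACC_maximal[OF A z] by metis
  obtain c where c: "c \<in> carrier R" "\<forall>y\<in>M. f y = y \<otimes> c" and sub: "M \<subseteq> L"
    using M(2) unfolding Q_def by blast
  note Ms = left_ideal_simps[OF M(1)]
  have "L \<subseteq> M"
  proof
    fix x assume x: "x \<in> L"
    have xc: "x \<in> carrier R" using x by (rule Ls(1))
    let ?N = "op.rPIdl x"
    have N: "right_ideal (opp_ring R) ?N" using xc by (intro op.right_ideal_rPIdl) simp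
    have Nm: "y \<in> ?N \<longleftrightarrow> (\<exists>r\<in>carrier R. y = r \<otimes> x)" for y by (auto simp: op.rPIdl_def)
    have Nc: "?N \<subseteq> carrier R" using op.right_ideal_subset[OF N] by simp
    have Mc: "M \<subseteq> carrier R" using Ms(1) by blast
    \<comment> \<open>Whatever kills \<open>x\<close> from the left kills \<open>f x\<close>;
      closedness of \<open>x R\<close> therefore makes \<open>f x\<close> a right multiple of
      \<open>x\<close>.\<close>
    have "f x \<in> rann R (lann R (rPIdl x))"
      unfolding rann_mem
    proof (intro conjI ballI fc[OF x])
      fix a assume a: "a \<in> lann R (rPIdl x)"
      then have "a \<otimes> x = \<zero>" "a \<in> carrier R" using rPIdl_mem[OF xc] by (auto simp: lann_mem)
      then show "a \<otimes> f x = \<zero>" using fm[OF x, of a] f0 by simp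
    qed
    then have "f x \<in> rPIdl x" using cr[OF right_ideal_rPIdl[OF xc]] by simp
    then obtain d where d: "d \<in> carrier R" "f x = x \<otimes> d" by (auto simp: rPIdl_def)
    have fN: "f y = y \<otimes> d" if y: "y \<in> ?N" for y
    proof -
      obtain r where "r \<in> carrier R" "y = r \<otimes> x" using y Nm by blast
      then show ?thesis using fm[OF x] d xc by (simp add: m_assoc)
    qed
    let ?K = "rann R M <+>\<^bsub>R\<^esub> rann R ?N"
    have rM: "right_ideal R (rann R M)" and rN: "right_ideal R (rann R ?N)"
      using Mc Nc by (auto intro: right_ideal_rann)
    have K: "right_ideal R ?K" using rM rN by (rule right_ideal_set_add)
    have "lann R ?K \<subseteq> M \<inter> ?N"
      using lann_antimono[OF set_add_ge1[OF rM rN]] lann_antimono[OF set_add_ge2[OF rM rN]]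
        cl[OF M(1)] cl[OF N] by blast
    \<comment> \<open>The multipliers \<open>c\<close> on \<open>M\<close> and \<open>d\<close> on
      \<open>R x\<close> agree on the intersection, so \<open>c - d = u + v\<close> with
      \<open>u\<close> killed by \<open>M\<close> and \<open>v\<close> by \<open>R x\<close>. Then
      \<open>c - u = d + v\<close> serves both.\<close>
    moreover have "c \<ominus> d \<in> rann R (M \<inter> ?N)"
    proof -
      have "y \<otimes> (c \<ominus> d) = \<zero>" if y: "y \<in> M" "y \<in> ?N" for y
      proof -
        have "y \<otimes> c = y \<otimes> d" using c(2) fN y by metis
        then show ?thesis using eq_iff_minus_zero[of "y \<otimes> c" "y \<otimes> d"] c(1) d(1) Ms(1)[OF y(1)]
          by (simp add: r_distr_minus)
      qed
      then show ?thesis using c(1) d(1) by (simp add: rann_mem)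
    qed
    ultimately have "c \<ominus> d \<in> rann R (lann R ?K)" using rann_antimono by blast
    then have "c \<ominus> d \<in> ?K" using cr[OF K] by simp
    then obtain u v where uv: "u \<in> rann R M" "v \<in> rann R ?N" "c \<ominus> d = u \<oplus> v" by (auto simp: set_add_mem)
    have uc: "u \<in> carrier R" "v \<in> carrier R" using uv by (auto simp: rann_mem)
    have cu: "c \<ominus> u = d \<oplus> v"
    proof -
      have "u \<oplus> (d \<oplus> v) = d \<oplus> (c \<ominus> d)" using uv(3) uc d(1) by (simp add: a_ac)
      also have "\<dots> = c" using c(1) d(1) by (simp add: add_minus_minus)
      finally show ?thesis using add_minus_cancel[of u "d \<oplus> v"] uc d(1) by simp
    qed
    let ?C = "M <+>\<^bsub>opp_ring R\<^esub> ?N"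
    have "f y = y \<otimes> (c \<ominus> u)" if y: "y \<in> ?C" for y
    proof -
      obtain m n where mn: "m \<in> M" "n \<in> ?N" "y = m \<oplus> n" using y by (auto simp: op.set_add_mem)
      have cc: "m \<in> carrier R" "n \<in> carrier R" using mn Mc Nc by blast+
      have "n \<in> L" using mn(2) Nm Ls(4)[OF x] by auto
      then have "f y = m \<otimes> c \<oplus> n \<otimes> d" using mn fa[of m n] sub c(2) fN by auto
      moreover have "m \<otimes> (c \<ominus> u) = m \<otimes> c"
        using uv(1) mn(1) cc uc c(1) by (simp add: rann_mem r_distr_minus) (simp add: a_minus_def)
      moreover have "n \<otimes> (c \<ominus> u) = n \<otimes> d" unfolding cu
        using uv(2) mn(2) cc uc d(1) by (simp add: rann_mem r_distr)
      ultimately show ?thesis using mn(3) cc uc c(1) by (simp add: l_distr)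
    qed
    moreover have "?C \<subseteq> L" using sub op.rPIdl_le[OF L x] by (rule op.set_add_le[OF L])
    ultimately have "Q ?C" unfolding Q_def using uc c(1) by (intro conjI bexI[of _ "c \<ominus> u"]) auto
    then have "?C = M" using M(3) op.right_ideal_set_add[OF M(1) N] op.set_add_ge1[OF M(1) N] by blast
    then show "x \<in> M" using op.set_add_ge2[OF M(1) N] op.rPIdl_mem[of x] xc by auto
  qed
  then show "\<exists>c\<in>carrier (opp_ring R). \<forall>x\<in>L. f x = c \<otimes>\<^bsub>opp_ring R\<^esub> x" using c by auto
qed

text \<open>The conjunction is invariant under passing to the opposite ring, which lets conditions
  on either side be derived from it.\<close>

definition QF_ring :: bool where
  "QF_ring \<longleftrightarrow> radical_split R \<and> J_nilpotent R \<and> right_baer R \<and> right_baer (opp_ring R) \<and>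
     ACC (right_ideal R) \<and> DCC (right_ideal R) \<and>
     ACC (right_ideal (opp_ring R)) \<and> DCC (right_ideal (opp_ring R))"

lemma QF_ring_of_DCC:
  assumes S: "radical_split R" and baer: "right_baer R" and D: "DCC (right_annihilator R)"
  shows QF_ring
proof -
  interpret op: ring "opp_ring R" by (rule ring_opp)
  have cl: "lann R (rann R L) = L" if "right_ideal (opp_ring R) L" for L
    using left_closed_of_DCC[OF baer D that] .
  have Al: "ACC (right_ideal (opp_ring R))" using left_ACC_of_DCC[OF cl D] .
  have nil: "J_nilpotent R" using J_nilpotent_of_left_ACC[OF cl Al] .
  have T: "right_T_nilpotent (opp_ring R) J" using op.right_T_nilpotent_of_nilpotent nil by simp
  have k: right_kasch using right_kasch_of_T_nilpotent(1)[OF S baer T] .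
  have cr: "rann R (lann R I) = I" if "right_ideal R I" for I
    using right_closed_of_kasch[OF baer k that] .
  have Dr: "DCC (right_ideal R)"
  proof (rule DCC_mono[OF D])
    fix X assume X: "right_ideal R X"
    have "lann R X \<subseteq> carrier R" by (auto simp: lann_mem)
    then show "right_annihilator R X" using cr[OF X] right_annihilator_rann by metis
  qed
  have Dl: "DCC (right_ideal (opp_ring R))"
    using op.DCC_of_ACC[OF radical_split_opp[OF S] _ Al] nil by simp
  have Ar: "ACC (right_ideal R)"
    unfolding ACC_def
  proof (intro allI impI)
    fix A :: "nat \<Rightarrow> 'a set" assume A: "\<forall>n. right_ideal R (A n) \<and> A n \<subseteq> A (Suc n)"
    have "\<exists>N. \<forall>n\<ge>N. lann R (A n) = lann R (A N)"
    proof (rule DCC_stable[OF Dl])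
      show "right_ideal (opp_ring R) (lann R (A n))" for n
        using A right_ideal_subset by (intro left_ideal_lann) blast
      show "lann R (A (Suc n)) \<subseteq> lann R (A n)" for n using A by (intro lann_antimono) blast
    qed
    then show "\<exists>N. \<forall>n\<ge>N. A n = A N" using cr A by metis
  qed
  have bl: "right_baer (opp_ring R)" by (rule left_baer_of_closed[OF cl cr Al])
  show ?thesis
    unfolding QF_ring_def by (intro conjI S nil baer bl Ar Dr Al Dl)
qed

text \<open>Once all right ideals are annihilators, the hypothesis makes \<open>R\<close> right
  noetherian. Nilpotence of \<open>J\<close> over a semilocal ring then gives the descending
  condition, which reduces to \<open>QF_ring_of_DCC\<close>.\<close>

lemma QF_ring_of_ACC:
  assumes S: "radical_split R" and baer: "right_baer R" and A: "ACC (right_annihilator R)"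
  shows QF_ring
proof -
  interpret op: ring "opp_ring R" by (rule ring_opp)
  have nil: "J_nilpotent R"
    using J_singular[OF right_small_injective_of_baer[OF baer]] A by (rule J_nilpotent_of_ACC)
  have T: "right_T_nilpotent (opp_ring R) J" using op.right_T_nilpotent_of_nilpotent nil by simp
  have k: right_kasch using right_kasch_of_T_nilpotent(1)[OF S baer T] .
  have "ACC (right_ideal R)"
  proof (rule ACC_mono[OF A])
    fix X assume X: "right_ideal R X"
    have "lann R X \<subseteq> carrier R" by (auto simp: lann_mem)
    then show "right_annihilator R X"
      using right_closed_of_kasch[OF baer k X] right_annihilator_rann by metis
  qed
  then have "DCC (right_ideal R)" using DCC_of_ACC[OF S nil] by blast
  then have "DCC (right_annihilator R)" by (rule DCC_mono) (rule right_annihilator_ideal)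
  then show ?thesis using QF_ring_of_DCC[OF S baer] by blast
qed

lemma QF_ring_opp: "ring.QF_ring (opp_ring R) \<longleftrightarrow> QF_ring"
proof -
  interpret op: ring "opp_ring R" by (rule ring_opp)
  show ?thesis unfolding QF_ring_def op.QF_ring_def by (auto simp: radical_split_opp_iff)
qed


section \<open>Perfect rings\<close>

definition rIdl :: "'a set \<Rightarrow> 'a set" where
  "rIdl X = carrier R \<inter> \<Inter>{K. right_ideal R K \<and> X \<subseteq> K}"

lemma right_ideal_rIdl: "right_ideal R (rIdl X)"
  unfolding rIdl_def by (rule right_ideal_Inter) simp

lemma rIdl_ge: "X \<subseteq> carrier R \<Longrightarrow> X \<subseteq> rIdl X"
  unfolding rIdl_def by blast

lemma rIdl_le: "right_ideal R K \<Longrightarrow> X \<subseteq> K \<Longrightarrow> rIdl X \<subseteq> K"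
  unfolding rIdl_def by blast

lemma rIdl_mono: "Y \<subseteq> carrier R \<Longrightarrow> X \<subseteq> Y \<Longrightarrow> rIdl X \<subseteq> rIdl Y"
  by (rule rIdl_le[OF right_ideal_rIdl]) (use rIdl_ge in blast)

lemma rIdl_Un_le:
  assumes "right_ideal R W" "X \<subseteq> carrier R" "y \<in> rIdl (W \<union> X)"
  shows "\<exists>w\<in>W. \<exists>f\<in>rIdl X. y = w \<oplus> f"
proof -
  have "rIdl (W \<union> X) \<subseteq> W <+>\<^bsub>R\<^esub> rIdl X"
    using right_ideal_set_add[OF assms(1) right_ideal_rIdl]
    by (rule rIdl_le)
      (use set_add_ge1[OF assms(1) right_ideal_rIdl] set_add_ge2[OF assms(1) right_ideal_rIdl]
        rIdl_ge[OF assms(2)] in blast)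
  then show ?thesis using assms(3) by (auto simp: set_add_mem)
qed

lemma rIdl_insert_le:
  assumes "Y \<subseteq> carrier R" "x \<in> carrier R" "y \<in> rIdl (insert x Y)"
  shows "\<exists>z\<in>rIdl Y. \<exists>r\<in>carrier R. y = z \<oplus> x \<otimes> r"
proof -
  have "rIdl (insert x Y) \<subseteq> rIdl Y <+>\<^bsub>R\<^esub> rPIdl x"
    using right_ideal_set_add[OF right_ideal_rIdl right_ideal_rPIdl[OF assms(2)]]
    by (rule rIdl_le)
      (use set_add_ge1[OF right_ideal_rIdl right_ideal_rPIdl[OF assms(2)]]
        set_add_ge2[OF right_ideal_rIdl right_ideal_rPIdl[OF assms(2)]]
        rIdl_ge[OF assms(1)] rPIdl_mem[OF assms(2)] in blast)
  then have "y \<in> rIdl Y <+>\<^bsub>R\<^esub> rPIdl x" using assms(3) by blast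
  then show ?thesis by (auto simp: set_add_mem rPIdl_def)
qed

text \<open>Pick \<open>y\<close> in \<open>I\<close> outside \<open>A\<close>, a maximal
  \<open>M\<close> containing all \<open>r\<close> with \<open>y r\<close> in \<open>A\<close>, and
  \<open>x = y h\<close> for its complement \<open>h\<close>. Modulo \<open>W\<close> the element
  \<open>x\<close> is killed by \<open>M\<close>, so it generates a simple module; and
  \<open>h\<close> outside \<open>M\<close> keeps \<open>x\<close> outside \<open>A\<close>.\<close>

lemma ex_simple_generator:
  assumes S: "radical_split R" and I: "right_ideal R I" and A: "right_ideal R A"
    and IJ: "\<And>y j. y \<in> I \<Longrightarrow> j \<in> J \<Longrightarrow> y \<otimes> j \<in> W" and nle: "\<not> I \<subseteq> A"
  shows "\<exists>x\<in>I. x \<notin> A \<and> (\<forall>r\<in>carrier R. x \<otimes> r \<notin> W \<longrightarrow> (\<exists>s\<in>carrier R. \<exists>w\<in>W. x = x \<otimes> r \<otimes> s \<oplus> w))"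
proof -
  obtain y where y: "y \<in> I" "y \<notin> A" using nle by blast
  have yc: "y \<in> carrier R" using right_ideal_carr[OF I y(1)] .
  define K where "K = {r \<in> carrier R. y \<otimes> r \<in> A}"
  have K: "right_ideal R K" unfolding K_def using A yc by (rule right_ideal_preimage)
  have "\<one> \<notin> K" using y(2) yc by (simp add: K_def)
  then have "K \<noteq> carrier R" by blast
  then obtain M where M: "maximal_right_ideal R M" "K \<subseteq> M" using ex_maximal_right_ideal[OF K] by blast
  note MD = maximal_right_idealD[OF M(1)]
  obtain h where h: "h \<in> carrier R" "h \<notin> M" "\<forall>m\<in>M. h \<otimes> m \<in> J"
    using maximal_complement[OF S M(1)] by blast
  have Mc: "m \<in> carrier R" if "m \<in> M" for m using right_ideal_carr[OF MD(1) that] .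
  let ?x = "y \<otimes> h"
  have "?x \<in> I" using y(1) h(1) by (rule right_ideal_mult[OF I])
  moreover have "?x \<notin> A" using h(1,2) M(2) by (auto simp: K_def)
  moreover have "\<exists>s\<in>carrier R. \<exists>w\<in>W. ?x = ?x \<otimes> r \<otimes> s \<oplus> w" if r: "r \<in> carrier R" "?x \<otimes> r \<notin> W" for r
  proof -
    have "r \<notin> M"
    proof
      assume "r \<in> M"
      then have "y \<otimes> (h \<otimes> r) \<in> W" using IJ[OF y(1)] h(3) by blast
      then show False using r yc h(1) by (simp add: m_assoc)
    qed
    then obtain m s where ms: "m \<in> M" "s \<in> carrier R" "\<one> = m \<oplus> r \<otimes> s"
      using maximal_right_ideal_split[OF M(1) r(1) _ one_closed] by metis
    have "?x = ?x \<otimes> (m \<oplus> r \<otimes> s)" using yc h(1) by (simp flip: ms(3))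
    also have "\<dots> = ?x \<otimes> r \<otimes> s \<oplus> y \<otimes> (h \<otimes> m)"
      using yc h(1) r(1) ms(2) Mc[OF ms(1)] by (simp add: r_distr m_assoc a_comm)
    finally show ?thesis using ms(2) IJ[OF y(1)] h(3) ms(1) by blast
  qed
  ultimately show ?thesis by blast
qed

text \<open>
  Let \<open>A\<^sub>n\<close> and \<open>B\<^sub>n\<close> be generated over \<open>W\<close> by the \<open>x\<^sub>m\<close> with \<open>m < n\<close> and \<open>m \<ge> n\<close>. As the
  \<open>A\<^sub>n\<close> are annihilators, there is a homomorphism on their union that kills \<open>W\<close> and no
  \<open>x\<^sub>n\<close>; it is given by some \<open>c \<in> l(W)\<close>. Simplicity makes the \<open>x\<^sub>n\<close> independent modulo
  \<open>W\<close>, so \<open>W\<close> is the intersection of the \<open>B\<^sub>n\<close> and \<open>l(W)\<close> is the union of the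
  \<open>l(B\<^sub>n)\<close>. But \<open>c\<close> lies in none of these.
\<close>

lemma no_simple_sequence:
  fixes x :: "nat \<Rightarrow> 'a"
  assumes baer: "right_baer R"
    and cl: "\<And>L. right_ideal (opp_ring R) L \<Longrightarrow> lann R (rann R L) = L"
    and cr: "\<And>I. right_ideal R I \<Longrightarrow> rann R (lann R I) = I"
    and W: "right_ideal R W" and xc: "\<And>n. x n \<in> carrier R"
    and xA: "\<And>n. x n \<notin> rIdl (W \<union> x ` {..<n})"
    and simple: "\<And>n r. r \<in> carrier R \<Longrightarrow> x n \<otimes> r \<notin> W \<Longrightarrow>
      \<exists>s\<in>carrier R. \<exists>w\<in>W. x n = x n \<otimes> r \<otimes> s \<oplus> w"
  shows False
proof -
  interpret op: ring "opp_ring R" by (rule ring_opp)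
  have Wc: "W \<subseteq> carrier R" using W by (rule right_ideal_subset)
  have sub: "W \<union> x ` N \<subseteq> carrier R" for N using Wc xc by blast
  define A where "A n = rIdl (W \<union> x ` {..<n})" for n
  have A: "right_ideal R (A n)" for n unfolding A_def by (rule right_ideal_rIdl)
  note As = right_ideal_simps[OF A]
  have WA: "W \<subseteq> A n" for n using rIdl_ge[OF sub] unfolding A_def by blast
  have xA': "x n \<in> A m" if "n < m" for n m using rIdl_ge[OF sub, of "{..<m}"] that unfolding A_def by blast
  have Amono: "A n \<subseteq> A m" if "n \<le> m" for n m
    unfolding A_def using that by (intro rIdl_mono[OF sub]) auto
  have xnA: "x n \<notin> A n" for n using xA unfolding A_def .
  \<comment> \<open>As \<open>A n\<close> is an annihilator not containing \<open>x n\<close>, some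
    \<open>u\<close> kills \<open>A n\<close> but not \<open>x n\<close>; adding it repairs a
    \<open>w\<close> that kills \<open>x n\<close>.\<close>
  have step: "\<exists>v. v \<in> carrier R \<and> v \<ominus> w \<in> lann R (A n) \<and> v \<otimes> x n \<noteq> \<zero>" if w: "w \<in> carrier R" for w n
  proof (cases "w \<otimes> x n = \<zero>")
    case True
    have "x n \<notin> rann R (lann R (A n))" using cr[OF A] xnA by simp
    then obtain u where u: "u \<in> lann R (A n)" "u \<otimes> x n \<noteq> \<zero>" using xc by (auto simp: rann_mem)
    have uc: "u \<in> carrier R" using u(1) by (simp add: lann_mem)
    have "(w \<oplus> u) \<ominus> w = u" "(w \<oplus> u) \<otimes> x n = u \<otimes> x n"
      using w uc xc True by (simp_all add: add_minus_cancel l_distr)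
    then show ?thesis using u w uc by (intro exI[of _ "w \<oplus> u"]) simp
  next
    case False
    have "w \<ominus> w \<in> lann R (A n)" using w As(1) by (auto simp: lann_mem a_minus_def r_neg)
    then show ?thesis using w False by blast
  qed
  then obtain g where g: "\<And>w n. w \<in> carrier R \<Longrightarrow>
      g w n \<in> carrier R \<and> g w n \<ominus> w \<in> lann R (A n) \<and> g w n \<otimes> x n \<noteq> \<zero>" by metis
  \<comment> \<open>Since \<open>w (Suc n)\<close> agrees with \<open>w n\<close> on
    \<open>A n\<close>, these multipliers fit together to one homomorphism on the union.\<close>
  define w where "w = rec_nat \<zero> (\<lambda>n v. g v n)"
  have w0: "w 0 = \<zero>" and wS: "w (Suc n) = g (w n) n" for n by (simp_all add: w_def)
  have wc: "w n \<in> carrier R" for n by (induction n) (simp_all add: w0 wS g)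
  have wx: "w (Suc n) \<otimes> x n \<noteq> \<zero>" for n unfolding wS using g[OF wc] by blast
  have wA: "w (Suc m) \<otimes> a = w m \<otimes> a" if "a \<in> A m" for a m
  proof -
    have "(w (Suc m) \<ominus> w m) \<otimes> a = \<zero>" using g[OF wc, of m m] that unfolding wS by (simp add: lann_mem)
    then show ?thesis
      using eq_iff_minus_zero[of "w (Suc m) \<otimes> a" "w m \<otimes> a"] wc As(1)[OF that] by (simp add: l_distr_minus)
  qed
  have wA': "w (n + k) \<otimes> a = w n \<otimes> a" if "a \<in> A n" for a n k
  proof (induction k)
    case (Suc k)
    have "a \<in> A (n + k)" using that Amono[of n "n + k"] by auto
    then show ?case using wA Suc by simp
  qed simp
  have wA2: "w m \<otimes> a = w n \<otimes> a" if "a \<in> A n" "n \<le> m" for a m n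
    using wA'[OF that(1), of "m - n"] that(2) by simp
  define U where "U = (\<Union>n. A n)"
  have U: "right_ideal R U" unfolding U_def using A Amono by (intro right_ideal_UN_mono) auto
  define G where "G = {(a, w n \<otimes> a) | a n. a \<in> A n}"
  have GI: "(a, w n \<otimes> a) \<in> G" if "a \<in> A n" for a n using that unfolding G_def by blast
  have GE: "\<exists>n. a \<in> A n \<and> z = w n \<otimes> a" if "(a, z) \<in> G" for a z using that unfolding G_def by blast
  have "\<exists>c\<in>carrier R. \<forall>a z. (a, z) \<in> G \<longrightarrow> z = c \<otimes> a"
  proof (rule extends_graph)
    show "a \<in> carrier R \<and> z \<in> carrier R" if "(a, z) \<in> G" for a z using GE[OF that] wc As(1) by auto
    show "(\<zero>, \<zero>) \<in> G" using GI[OF As(2), of 0] by (simp add: w0)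
    show "(a \<oplus> b, y \<oplus> z) \<in> G" if h: "(a, y) \<in> G" "(b, z) \<in> G" for a y b z
    proof -
      obtain m n where g: "a \<in> A m" "y = w m \<otimes> a" "b \<in> A n" "z = w n \<otimes> b"
        using GE[OF h(1)] GE[OF h(2)] by blast
      let ?k = "max m n"
      have ab: "a \<in> A ?k" "b \<in> A ?k" using g Amono[of m ?k] Amono[of n ?k] by auto
      have "y \<oplus> z = w ?k \<otimes> (a \<oplus> b)"
        using g(2,4) wA2[OF g(1), of ?k] wA2[OF g(3), of ?k] wc As(1)[OF ab(1)] As(1)[OF ab(2)]
        by (simp add: r_distr)
      then show ?thesis using GI[OF As(3)[OF ab]] by simp
    qed
    show "(a \<otimes> t, z \<otimes> t) \<in> G" if h: "(a, z) \<in> G" "t \<in> carrier R" for a z t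
    proof -
      obtain n where g: "a \<in> A n" "z = w n \<otimes> a" using GE[OF h(1)] by blast
      then show ?thesis using GI[OF As(4)[OF g(1) h(2)]] wc As(1)[OF g(1)] h(2) by (simp add: m_assoc)
    qed
    show "z = \<zero>" if "(\<zero>, z) \<in> G" for z using GE[OF that] wc by auto
    show "extends_from R (Domain G)" if "right_ideal R (Domain G)" using baer that by (simp add: right_baer_def)
  qed
  then obtain c where c: "c \<in> carrier R" "\<And>a z. (a, z) \<in> G \<Longrightarrow> z = c \<otimes> a" by blast
  have cval: "c \<otimes> a = w n \<otimes> a" if "a \<in> A n" for a n using c(2)[OF GI[OF that]] by simp
  have cW: "c \<in> lann R W"
  proof -
    have "c \<otimes> a = \<zero>" if "a \<in> W" for a
    proof -
      have "a \<in> A 0" using that WA by blast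
      then show ?thesis using cval[of a 0] As(1)[of a 0] w0 by simp
    qed
    then show ?thesis using c(1) by (simp add: lann_mem)
  qed
  have cx: "c \<otimes> x n \<noteq> \<zero>" for n using cval[OF xA'[of n "Suc n"]] wx[of n] by simp
  define B where "B n = rIdl (W \<union> x ` {n..})" for n
  have B: "right_ideal R (B n)" for n unfolding B_def by (rule right_ideal_rIdl)
  have xB: "x n \<in> B n" for n using rIdl_ge[OF sub, of "{n..}"] unfolding B_def by auto
  have BW: "y \<in> W" if y: "\<And>n. y \<in> B n" for y
  proof -
    have "B 0 \<subseteq> U"
      unfolding B_def
    proof (rule rIdl_le[OF U])
      have "x n \<in> U" for n using xA'[of n "Suc n"] unfolding U_def by auto
      moreover have "W \<subseteq> U" using WA unfolding U_def by auto
      ultimately show "W \<union> x ` {0..} \<subseteq> U" by auto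
    qed
    then obtain N where N: "y \<in> A N" using y[of 0] unfolding U_def by blast
    \<comment> \<open>Only finitely many later generators occur at a time. By induction
      \<open>A N\<close> meets \<open>C k\<close> inside \<open>W\<close>: if the term with the last
      generator were outside \<open>W\<close>, simplicity would put that generator into the
      preceding \<open>A\<close>.\<close>
    define C where "C k = rIdl (W \<union> x ` {N..<N + k})" for k
    have CR: "right_ideal R (C k)" for k unfolding C_def by (rule right_ideal_rIdl)
    have CA: "C k \<subseteq> A (N + k)" for k unfolding C_def A_def by (rule rIdl_mono[OF sub]) auto
    have AC: "z \<in> W" if "z \<in> A N" "z \<in> C k" for z k
      using that
    proof (induction k arbitrary: z)
      case 0
      have "C 0 \<subseteq> W" unfolding C_def using W by (intro rIdl_le) auto
      then show ?case using 0 by blast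
    next
      case (Suc k)
      have e: "W \<union> x ` {N..<N + Suc k} = insert (x (N + k)) (W \<union> x ` {N..<N + k})"
        by (auto simp: less_Suc_eq)
      obtain v r where v: "v \<in> C k" "r \<in> carrier R" "z = v \<oplus> x (N + k) \<otimes> r"
        using rIdl_insert_le[where Y = "W \<union> x ` {N..<N + k}" and x = "x (N + k)" and y = z, OF sub xc] Suc.prems(2) unfolding C_def e by blast
      have vc: "v \<in> carrier R" using v(1) by (rule right_ideal_carr[OF CR])
      have zk: "z \<in> A (N + k)" using Suc.prems(1) Amono[of N "N + k"] by auto
      have vk: "v \<in> A (N + k)" using v(1) CA by blast
      have xr: "x (N + k) \<otimes> r = z \<ominus> v" using add_minus_cancel[OF vc, of "x (N + k) \<otimes> r"] v xc by simp
      then have xrA: "x (N + k) \<otimes> r \<in> A (N + k)" using As(6)[OF zk vk] by simp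
      have xrW: "x (N + k) \<otimes> r \<in> W"
      proof (rule ccontr)
        assume "x (N + k) \<otimes> r \<notin> W"
        then obtain s u where su: "s \<in> carrier R" "u \<in> W" "x (N + k) = x (N + k) \<otimes> r \<otimes> s \<oplus> u"
          using simple[OF v(2)] by blast
        have "x (N + k) \<otimes> r \<otimes> s \<oplus> u \<in> A (N + k)" using As(4)[OF xrA su(1)] su(2) WA by (intro As(3)) auto
        then show False using xnA su(3) by metis
      qed
      have "x (N + k) \<otimes> r \<in> A N" using xrW WA by blast
      then have "v \<in> A N" using right_ideal_add_cancel[OF A _ vc] v(3) Suc.prems(1) by blast
      then have "v \<in> W" using Suc.IH v(1) by blast
      then show ?case unfolding v(3) using xrW by (rule right_ideal_add[OF W])
    qed
    have CU: "right_ideal R (\<Union>k. C k)"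
    proof (rule right_ideal_UN_mono[OF CR])
      show "C k \<subseteq> C (Suc k)" for k unfolding C_def by (rule rIdl_mono[OF sub]) auto
    qed
    have "B N \<subseteq> (\<Union>k. C k)"
      unfolding B_def
    proof (rule rIdl_le[OF CU])
      have "x n \<in> C (Suc (n - N))" if "n \<ge> N" for n
        using rIdl_ge[OF sub, of "{N..<N + Suc (n - N)}"] that unfolding C_def by auto
      moreover have "W \<subseteq> C 0" using rIdl_ge[OF sub, of "{N..<N + 0}"] unfolding C_def by blast
      ultimately show "W \<union> x ` {N..} \<subseteq> (\<Union>k. C k)" by blast
    qed
    then show ?thesis using y[of N] N AC by blast
  qed
  define L where "L = (\<Union>n. lann R (B n))"
  have L: "right_ideal (opp_ring R) L"
    unfolding L_def
  proof (rule op.right_ideal_UN_mono)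
    show "right_ideal (opp_ring R) (lann R (B n))" for n
      by (rule left_ideal_lann) (rule right_ideal_subset[OF B])
    show "lann R (B n) \<subseteq> lann R (B (Suc n))" for n
      unfolding B_def by (intro lann_antimono rIdl_mono[OF sub]) auto
  qed
  have "rann R L \<subseteq> W"
  proof
    fix y assume y: "y \<in> rann R L"
    have "y \<in> B n" for n
    proof -
      have "lann R (B n) \<subseteq> L" unfolding L_def by blast
      then show ?thesis using y rann_antimono cr[OF B] by blast
    qed
    then show "y \<in> W" by (rule BW)
  qed
  then have "c \<in> L" using lann_antimono cW cl[OF L] by blast
  then obtain n where "c \<in> lann R (B n)" unfolding L_def by blast
  then have "c \<otimes> x n = \<zero>" using xB by (simp add: lann_mem)
  then show False using cx by blast
qed

text \<open>Otherwise generators simple modulo \<open>W\<close> could be chosen forever, each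
  outside what the earlier ones generate, as \<open>no_simple_sequence\<close> forbids.\<close>

lemma finite_generated_modulo:
  assumes S: "radical_split R" and baer: "right_baer R"
    and cl: "\<And>L. right_ideal (opp_ring R) L \<Longrightarrow> lann R (rann R L) = L"
    and cr: "\<And>I. right_ideal R I \<Longrightarrow> rann R (lann R I) = I"
    and I: "right_ideal R I" and W: "right_ideal R W"
    and IJ: "\<And>y j. y \<in> I \<Longrightarrow> j \<in> J \<Longrightarrow> y \<otimes> j \<in> W"
  shows "\<exists>X. finite X \<and> X \<subseteq> I \<and> I \<subseteq> rIdl (W \<union> X)"
proof (rule ccontr)
  assume n: "\<not> ?thesis"
  define G where "G X x \<longleftrightarrow> x \<in> I \<and> x \<notin> rIdl (W \<union> X) \<and>
    (\<forall>r\<in>carrier R. x \<otimes> r \<notin> W \<longrightarrow> (\<exists>s\<in>carrier R. \<exists>w\<in>W. x = x \<otimes> r \<otimes> s \<oplus> w))" for X x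
  have ex: "\<exists>x. G X x" if "finite X" "X \<subseteq> I" for X
  proof -
    have "\<not> I \<subseteq> rIdl (W \<union> X)" using n that by blast
    then show ?thesis using ex_simple_generator[OF S I right_ideal_rIdl IJ] unfolding G_def by blast
  qed
  \<comment> \<open>The recursion runs on the finite sets chosen so far, because each choice depends
    on all earlier ones.\<close>
  define X where "X = rec_nat {} (\<lambda>_ X. insert (SOME x. G X x) X)"
  have X0: "X 0 = {}" and XS: "X (Suc n) = insert (SOME x. G (X n) x) (X n)" for n by (simp_all add: X_def)
  define x where "x n = (SOME y. G (X n) y)" for n
  have XS': "X (Suc n) = insert (x n) (X n)" for n unfolding XS x_def ..
  have fin: "finite (X n) \<and> X n \<subseteq> I" for n
  proof (induction n)
    case (Suc n)
    then have "\<exists>y. G (X n) y" using ex by blast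
    then have "G (X n) (x n)" unfolding x_def by (rule someI_ex)
    then show ?case using Suc by (simp add: XS' G_def)
  qed (simp add: X0)
  have G: "G (X n) (x n)" for n
  proof -
    have "\<exists>y. G (X n) y" using ex fin by blast
    then show ?thesis unfolding x_def by (rule someI_ex)
  qed
  have "X n = x ` {..<n}" for n by (induction n) (auto simp: X0 XS' lessThan_Suc)
  then have Gx: "G (x ` {..<n}) (x n)" for n using G by metis
  show False
  proof (rule no_simple_sequence[OF baer cl cr W])
    show "x n \<in> carrier R" for n using Gx[of n] right_ideal_carr[OF I] by (simp add: G_def)
    show "x n \<notin> rIdl (W \<union> x ` {..<n})" for n using Gx[of n] by (simp add: G_def)
    show "\<exists>s\<in>carrier R. \<exists>w\<in>W. x n = x n \<otimes> r \<otimes> s \<oplus> w" if "r \<in> carrier R" "x n \<otimes> r \<notin> W" for n r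
      using Gx[of n] that unfolding G_def by blast
  qed
qed

text \<open>Nakayama's lemma for a T-nilpotent radical, without assuming \<open>I\<close> finitely generated.\<close>

lemma finite_generated_of_T_nilpotent:
  assumes T: "right_T_nilpotent R J" and I: "right_ideal R I" and X: "X \<subseteq> I"
    and gen: "I \<subseteq> rIdl (rIdl {y \<otimes> j | y j. y \<in> I \<and> j \<in> J} \<union> X)"
  shows "I \<subseteq> rIdl X"
proof (rule ccontr)
  assume n: "\<not> I \<subseteq> rIdl X"
  let ?F = "rIdl X" and ?W = "rIdl {y \<otimes> j | y j. y \<in> I \<and> j \<in> J}"
  have F: "right_ideal R ?F" by (rule right_ideal_rIdl)
  note Fs = right_ideal_simps[OF F]
  have Ic: "y \<in> carrier R" if "y \<in> I" for y using right_ideal_carr[OF I that] .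
  have Xc: "X \<subseteq> carrier R" using X Ic by blast
  have "\<exists>y\<in>I. y \<otimes> \<zero> \<notin> ?F"
  proof (rule right_T_nilpotent_choice[OF T])
    obtain y where "y \<in> I" "y \<notin> ?F" using n by blast
    then show "\<exists>y\<in>I. y \<otimes> \<one> \<notin> ?F" using Ic by (intro bexI[of _ y]) simp_all
    show "\<exists>a\<in>J. \<exists>y\<in>I. y \<otimes> (a \<otimes> p) \<notin> ?F" if p: "p \<in> carrier R" and Q: "\<exists>y\<in>I. y \<otimes> p \<notin> ?F" for p
    proof (rule ccontr)
      assume n: "\<not> ?thesis"
      \<comment> \<open>If no factor from \<open>J\<close> can prolong the product, this right ideal
        contains \<open>I J\<close>. Splitting \<open>y\<close> in \<open>I\<close> as
        \<open>w + f\<close> with \<open>w\<close> in \<open>?W\<close> and \<open>f\<close> in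
        \<open>?F\<close> then gives \<open>y p\<close> in \<open>?F\<close>, against the assumption
        on \<open>p\<close>.\<close>
      define K where "K = {z \<in> carrier R. \<forall>r\<in>carrier R. z \<otimes> r \<otimes> p \<in> ?F}"
      have K: "right_ideal R K"
      proof (rule right_idealI)
        show "\<zero> \<in> K" using p Fs(2) by (simp add: K_def)
        show "a \<oplus> b \<in> K" if "a \<in> K" "b \<in> K" for a b
          using that p Fs(3) by (simp add: K_def l_distr)
        show "a \<otimes> r \<in> K" if ar: "a \<in> K" "r \<in> carrier R" for a r
        proof -
          have ac: "a \<in> carrier R" and aF: "\<And>s. s \<in> carrier R \<Longrightarrow> a \<otimes> s \<otimes> p \<in> ?F"
            using ar(1) by (auto simp: K_def)
          have "a \<otimes> r \<otimes> s \<otimes> p \<in> ?F" if "s \<in> carrier R" for s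
            using aF[of "r \<otimes> s"] that ac ar(2) by (simp add: m_assoc[of a r s])
          then show ?thesis using ac ar(2) by (simp add: K_def)
        qed
      qed (auto simp: K_def)
      have "y \<otimes> j \<in> K" if y: "y \<in> I" and j: "j \<in> J" for y j
      proof -
        have "y \<otimes> j \<otimes> r \<otimes> p \<in> ?F" if r: "r \<in> carrier R" for r
        proof -
          have "y \<otimes> ((j \<otimes> r) \<otimes> p) \<in> ?F" using n y J_mult_right[OF j r] by blast
          then show ?thesis using Ic[OF y] J_carr[OF j] r p by (simp add: m_assoc)
        qed
        then show ?thesis using Ic[OF y] J_carr[OF j] by (simp add: K_def)
      qed
      then have WK: "?W \<subseteq> K" by (intro rIdl_le[OF K]) blast
      have "y \<otimes> p \<in> ?F" if y: "y \<in> I" for y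
      proof -
        obtain w f where wf: "w \<in> ?W" "f \<in> ?F" "y = w \<oplus> f"
          using rIdl_Un_le[OF right_ideal_rIdl Xc] gen y by blast
        have "w \<in> K" using wf(1) WK by blast
        then have wc: "w \<in> carrier R" and "w \<otimes> \<one> \<otimes> p \<in> ?F" unfolding K_def by blast+
        then have "w \<otimes> p \<in> ?F" by simp
        moreover have "f \<otimes> p \<in> ?F" using wf(2) p by (rule Fs(4))
        ultimately have "w \<otimes> p \<oplus> f \<otimes> p \<in> ?F" by (rule Fs(3))
        then show ?thesis using wf(3) wc Fs(1)[OF wf(2)] p by (simp add: l_distr)
      qed
      then show False using Q by blast
    qed
  qed
  then show False using Ic Fs(2) by auto
qed

lemma ACC_of_finite_generated:
  assumes "\<And>I. right_ideal R I \<Longrightarrow> \<exists>X. finite X \<and> X \<subseteq> I \<and> I \<subseteq> rIdl X"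
  shows "ACC (right_ideal R)"
  unfolding ACC_def
proof (intro allI impI)
  fix A :: "nat \<Rightarrow> 'a set" assume A: "\<forall>n. right_ideal R (A n) \<and> A n \<subseteq> A (Suc n)"
  have AR: "right_ideal R (A n)" and AS: "A n \<subseteq> A (Suc n)" for n using A by auto
  have mono: "A i \<subseteq> A j" if "i \<le> j" for i j using lift_Suc_mono_le[of A, OF AS that] .
  obtain X where X: "finite X" "X \<subseteq> (\<Union>n. A n)" "(\<Union>n. A n) \<subseteq> rIdl X"
    using assms[OF right_ideal_UN_mono[of A, OF AR AS]] by blast
  have "\<exists>N. X \<subseteq> A N"
    using X(1,2)
  proof (induction X rule: finite_induct)
    case (insert x X)
    then obtain N M where "X \<subseteq> A N" "x \<in> A M" by auto
    then have "insert x X \<subseteq> A (max N M)" using mono[of N "max N M"] mono[of M "max N M"] by auto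
    then show ?case ..
  qed simp
  then obtain N where "X \<subseteq> A N" ..
  then have "rIdl X \<subseteq> A N" using rIdl_le[OF AR] by blast
  then have "A n \<subseteq> A N" for n using X(3) by blast
  then have "\<forall>n\<ge>N. A n = A N" using mono by (meson subset_antisym)
  then show "\<exists>N. \<forall>n\<ge>N. A n = A N" ..
qed

text \<open>The socle of the opposite ring is \<open>r(J)\<close>. The exported facts say there that
  \<open>r(J)\<close> lies in \<open>l(J)\<close> and that its right annihilator lies in
  \<open>J\<close>, which is what \<open>right_kaschI\<close> asks for on the other side.\<close>

lemma QF_ring_of_perfect:
  assumes S: "radical_split R" and T: "right_T_nilpotent R J"
    and baer: "right_baer R" and lbaer: "right_baer (opp_ring R)"
  shows QF_ring
proof -
  interpret op: ring "opp_ring R" by (rule ring_opp)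
  have Sop: "radical_split (opp_ring R)" using S by (rule radical_split_opp)
  have T': "right_T_nilpotent (opp_ring (opp_ring R)) op.J" using T by simp
  note k = op.right_kasch_of_T_nilpotent[OF Sop lbaer T']
  have cl: "lann R (rann R L) = L" if "right_ideal (opp_ring R) L" for L
    using op.right_closed_of_kasch[OF lbaer k(1) that] by simp
  have "rann R J \<subseteq> lann R J" using k(3) by (auto simp: lann_mem rann_mem)
  moreover have "rann R (rann R J) \<subseteq> J" using k(4) by (auto simp: rann_mem)
  ultimately have kr: right_kasch by (rule right_kaschI[OF S])
  have cr: "rann R (lann R I) = I" if "right_ideal R I" for I
    using right_closed_of_kasch[OF baer kr that] .
  have "ACC (right_ideal R)"
  proof (rule ACC_of_finite_generated)
    fix I assume I: "right_ideal R I"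
    let ?P = "{y \<otimes> j | y j. y \<in> I \<and> j \<in> J}"
    have "?P \<subseteq> carrier R" using right_ideal_carr[OF I] J_carr by auto
    then have PW: "?P \<subseteq> rIdl ?P" by (rule rIdl_ge)
    have "\<exists>X. finite X \<and> X \<subseteq> I \<and> I \<subseteq> rIdl (rIdl ?P \<union> X)"
    proof (rule finite_generated_modulo[OF S baer cl cr I right_ideal_rIdl])
      show "y \<otimes> j \<in> rIdl ?P" if "y \<in> I" "j \<in> J" for y j using PW that by blast
    qed
    then show "\<exists>X. finite X \<and> X \<subseteq> I \<and> I \<subseteq> rIdl X"
      using finite_generated_of_T_nilpotent[OF T I] by blast
  qed
  then have "ACC (right_annihilator R)" by (rule ACC_mono) (rule right_annihilator_ideal)
  then show ?thesis using QF_ring_of_ACC[OF S baer] by blast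
qed


section \<open>Semiregular rings and rings with essential socle\<close>

lemma cong_inverse_one:
  assumes w: "w \<in> carrier R" "cong w \<one>"
  obtains v where "v \<in> carrier R" "w \<otimes> v = \<one>" "v \<otimes> w = \<one>" "cong v \<one>"
proof -
  have "\<one> \<ominus> w \<in> J" using cong_sym[OF w(2)] by (simp add: cong_def)
  then have "\<one> \<ominus> (\<one> \<ominus> w) \<otimes> \<one> \<in> Units R" by (rule J_unit_right) simp
  moreover have "\<one> \<ominus> (\<one> \<ominus> w) \<otimes> \<one> = w" using w(1) by (simp add: minus_minus_cancel)
  ultimately obtain v where v: "v \<in> carrier R" "w \<otimes> v = \<one>" "v \<otimes> w = \<one>" by (auto simp: Units_def)
  have "cong (v \<otimes> \<one>) (v \<otimes> w)" using cong_sym[OF w(2)] v(1) by (intro cong_mult cong_refl)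
  then have "cong v \<one>" using v by simp
  then show thesis using that v by blast
qed

text \<open>A lift \<open>e\<close> of \<open>x = a y\<close> need not lie in \<open>a R\<close>.
  The unit \<open>w = 1 - (e - x)\<close> satisfies \<open>w e = x e\<close>, so the conjugate of
  \<open>e\<close> by \<open>w\<close> is an idempotent of the form \<open>a s\<close>, still
  congruent to \<open>x\<close>.\<close>

lemma semiregular_idempotent:
  assumes sr: "semiregular R" and a: "a \<in> carrier R"
  shows "\<exists>s\<in>carrier R. (a \<otimes> s) \<otimes> (a \<otimes> s) = a \<otimes> s \<and> a \<ominus> a \<otimes> s \<otimes> a \<in> J"
proof -
  obtain y where y: "y \<in> carrier R" "cong (a \<otimes> y \<otimes> a) a"
    using sr a by (auto simp: semiregular_def von_Neumann_regular_quot)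
  define x where "x = a \<otimes> y"
  have xc: "x \<in> carrier R" using a y by (simp add: x_def)
  have "cong (x \<otimes> x) x"
    using cong_mult[OF y(2) cong_refl[OF y(1)]] a y(1) by (simp add: x_def m_assoc)
  then have "x \<otimes> x \<ominus> x \<in> J" by (simp add: cong_def)
  then obtain e where e: "e \<in> carrier R" "e \<otimes> e = e" "e \<ominus> x \<in> J"
    using sr xc unfolding semiregular_def idempotents_lift_def by blast
  have ex: "cong e x" using e xc by (simp add: cong_def)
  define w where "w = \<one> \<ominus> (e \<ominus> x)"
  have wc: "w \<in> carrier R" using e(1) xc by (simp add: w_def)
  have "cong (e \<ominus> x) \<zero>" using e(3) by (simp add: cong_zero)
  then have "cong w (\<one> \<ominus> \<zero>)" unfolding w_def by (intro cong_minus cong_refl) simp_all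
  then have w1: "cong w \<one>" by (simp add: a_minus_def)
  obtain v where v: "v \<in> carrier R" "w \<otimes> v = \<one>" "v \<otimes> w = \<one>" "cong v \<one>"
    using cong_inverse_one[OF wc w1] by blast
  have "w \<otimes> e = e \<ominus> (e \<ominus> x \<otimes> e)" using e(1,2) xc by (simp add: w_def l_distr_minus)
  then have we: "w \<otimes> e = x \<otimes> e" using e(1) xc by (simp add: minus_minus_cancel)
  define s where "s = y \<otimes> e \<otimes> v"
  have sc: "s \<in> carrier R" using y(1) e(1) v(1) by (simp add: s_def)
  have as: "a \<otimes> s = w \<otimes> e \<otimes> v" unfolding we using a y(1) e(1) v(1) by (simp add: s_def x_def m_assoc)
  have "(a \<otimes> s) \<otimes> (a \<otimes> s) = w \<otimes> e \<otimes> (v \<otimes> w) \<otimes> e \<otimes> v"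
    unfolding as using wc e(1) v(1) by (simp add: m_assoc)
  also have "\<dots> = w \<otimes> (e \<otimes> e) \<otimes> v" using wc e(1) v(1,3) by (simp add: m_assoc)
  finally have id: "(a \<otimes> s) \<otimes> (a \<otimes> s) = a \<otimes> s" unfolding as e(2) .
  have "cong (w \<otimes> e \<otimes> v) (\<one> \<otimes> x \<otimes> \<one>)" using w1 ex v(4) by (intro cong_mult)
  then have "cong (a \<otimes> s) x" unfolding as using xc by simp
  then have "cong (a \<otimes> s \<otimes> a) (x \<otimes> a)" using a by (intro cong_mult cong_refl)
  also have "cong (x \<otimes> a) a" using y(2) by (simp add: x_def)
  finally have "cong (a \<otimes> s \<otimes> a) a" .
  then have "a \<ominus> a \<otimes> s \<otimes> a \<in> J" using cong_sym by (simp add: cong_def)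
  then show ?thesis using sc id by blast
qed

text \<open>For idempotent \<open>f\<close> the annihilator of \<open>1 - f\<close> is
  \<open>f R\<close>; take it maximal with \<open>f\<close> in \<open>I\<close>. If
  \<open>b = a - f a\<close> is not in \<open>J\<close>, an idempotent \<open>g\<close> in
  \<open>b R\<close> has \<open>f g = 0\<close>, and \<open>h = f + g - g f\<close> generates a
  strictly larger right ideal.\<close>

lemma radical_split_of_semiregular:
  assumes sr: "semiregular R" and A: "ACC (right_annihilator R)"
  shows "radical_split R"
  unfolding radical_split_def
proof (intro allI impI)
  fix I assume I: "right_ideal R I"
  note Is = right_ideal_simps[OF I]
  define Q where "Q A \<longleftrightarrow> (\<exists>f\<in>I. f \<otimes> f = f \<and> A = rann R {\<one> \<ominus> f})" for A
  have rm: "x \<in> rann R {\<one> \<ominus> f} \<longleftrightarrow> x \<in> carrier R \<and> f \<otimes> x = x"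
    if "f \<in> carrier R" for f x
  proof -
    have "(\<one> \<ominus> f) \<otimes> x = \<zero> \<longleftrightarrow> f \<otimes> x = x" if "x \<in> carrier R"
      using eq_iff_minus_zero[of x "f \<otimes> x"] \<open>f \<in> carrier R\<close> that by (auto simp: l_distr_minus)
    then show ?thesis by (auto simp: rann_mem)
  qed
  have ra: "right_annihilator R (rann R {\<one> \<ominus> f})" if "f \<in> carrier R" for f
    using that by (intro right_annihilator_rann) simp
  have "Q (rann R {\<one> \<ominus> \<zero>})" using Is(2) unfolding Q_def by (intro bexI[of _ \<zero>]) auto
  then obtain B where B: "Q B" "\<And>C. right_annihilator R C \<Longrightarrow> Q C \<Longrightarrow> B \<subseteq> C \<Longrightarrow> C = B"
    using ACC_maximal[OF A ra[OF zero_closed]] by metis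
  obtain f where f: "f \<in> I" "f \<otimes> f = f" "B = rann R {\<one> \<ominus> f}" using B(1) unfolding Q_def by blast
  have fc: "f \<in> carrier R" using f(1) by (rule Is(1))
  have "a \<ominus> f \<otimes> a \<in> J" if a: "a \<in> I" for a
  proof (rule ccontr)
    assume n: "a \<ominus> f \<otimes> a \<notin> J"
    have ac: "a \<in> carrier R" using a by (rule Is(1))
    define b where "b = a \<ominus> f \<otimes> a"
    have bI: "b \<in> I" unfolding b_def using a f(1) ac by (intro Is(6) Is(4))
    have bc: "b \<in> carrier R" using bI by (rule Is(1))
    have "f \<otimes> b = f \<otimes> a \<ominus> f \<otimes> f \<otimes> a" using ac fc by (simp add: b_def r_distr_minus m_assoc)
    then have fb: "f \<otimes> b = \<zero>" using f(2) ac fc by (simp add: a_minus_def r_neg)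
    obtain s where s: "s \<in> carrier R" "(b \<otimes> s) \<otimes> (b \<otimes> s) = b \<otimes> s" "b \<ominus> b \<otimes> s \<otimes> b \<in> J"
      using semiregular_idempotent[OF sr bc] by blast
    define g where "g = b \<otimes> s"
    have gI: "g \<in> I" unfolding g_def using bI s(1) by (rule Is(4))
    have gc: "g \<in> carrier R" using gI by (rule Is(1))
    have gg: "g \<otimes> g = g" using s(2) by (simp add: g_def)
    have fg: "f \<otimes> g = \<zero>" using fb fc bc s(1) by (simp add: g_def m_assoc[symmetric])
    define h where "h = f \<oplus> (g \<ominus> g \<otimes> f)"
    have hI: "h \<in> I" unfolding h_def using f(1) gI fc by (intro Is(3) Is(6) Is(4))
    have hc: "h \<in> carrier R" using hI by (rule Is(1))
    have hf: "h \<otimes> f = f"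
      using fc gc f(2) by (simp add: h_def l_distr l_distr_minus m_assoc) (simp add: a_minus_def r_neg)
    have hg: "h \<otimes> g = g"
      using fc gc gg fg by (simp add: h_def l_distr l_distr_minus m_assoc) (simp add: a_minus_def)
    have "h \<otimes> h = h \<otimes> f \<oplus> (h \<otimes> g \<ominus> h \<otimes> g \<otimes> f)"
    proof -
      have "h \<otimes> (f \<oplus> (g \<ominus> g \<otimes> f)) = h \<otimes> f \<oplus> (h \<otimes> g \<ominus> h \<otimes> g \<otimes> f)"
        using hc fc gc by (simp add: r_distr r_distr_minus m_assoc)
      then show ?thesis by (simp flip: h_def)
    qed
    then have hh: "h \<otimes> h = h" unfolding hf hg by (simp flip: h_def)
    have "Q (rann R {\<one> \<ominus> h})" unfolding Q_def using hI hh by blast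
    moreover have "B \<subseteq> rann R {\<one> \<ominus> h}"
    proof
      fix x assume "x \<in> B"
      then have x: "x \<in> carrier R" "f \<otimes> x = x" using f(3) rm[OF fc] by auto
      have "h \<otimes> x = h \<otimes> f \<otimes> x" using x hc fc by (simp add: m_assoc)
      then have "h \<otimes> x = x" using hf x(2) by simp
      then show "x \<in> rann R {\<one> \<ominus> h}" using rm[OF hc] x(1) by simp
    qed
    ultimately have "rann R {\<one> \<ominus> h} = B" using B(2) ra[OF hc] by blast
    moreover have "g \<in> rann R {\<one> \<ominus> h}" using rm[OF hc] gc hg by simp
    ultimately have "f \<otimes> g = g" using f(3) rm[OF fc] by simp
    then have "g = \<zero>" using fg by simp
    then have "b \<in> J" using s(3) bc by (simp flip: g_def) (simp add: a_minus_def)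
    then show False using n by (simp add: b_def)
  qed
  then show "\<exists>f\<in>I. \<forall>a\<in>I. a \<ominus> f \<otimes> a \<in> J" using f(1) by blast
qed

section \<open>Minimal right ideals, maximal left ideals and the singular ideal\<close>

lemma minimal_extends:
  assumes inj: "right_small_injective R" and I: "minimal_right_ideal R I"
  shows "extends_from R I"
proof (cases "I \<subseteq> J")
  case True
  then have "small_right_ideal R I" using I by (intro small_of_le_J) (auto simp: minimal_right_ideal_def)
  then show ?thesis using inj by (simp add: right_small_injective_iff)
next
  case False
  have IR: "right_ideal R I" and min: "\<And>K. right_ideal R K \<Longrightarrow> K \<subseteq> I \<Longrightarrow> K = {\<zero>} \<or> K = I"
    using I by (auto simp: minimal_right_ideal_def)
  note Is = right_ideal_simps[OF IR]
  obtain x where x: "x \<in> I" "x \<notin> J" using False by blast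
  have xc: "x \<in> carrier R" using x(1) by (rule Is(1))
  obtain M where M: "maximal_right_ideal R M" "x \<notin> M" using x(2) xc by (auto simp: jacobson_radical_def)
  note MD = maximal_right_idealD[OF M(1)]
  \<comment> \<open>A minimal right ideal outside \<open>J\<close> is a direct summand:
    \<open>M\<close> is a complement, and the component \<open>e\<close> of \<open>1\<close> in
    \<open>I\<close> is a left identity there.\<close>
  have "I \<inter> M = {\<zero>}" using min[OF right_ideal_Int[OF IR MD(1)]] x(1) M(2) by blast
  obtain m r where mr: "m \<in> M" "r \<in> carrier R" "\<one> = m \<oplus> x \<otimes> r"
    using maximal_right_ideal_split[OF M(1) xc M(2) one_closed] by metis
  define e where "e = x \<otimes> r"
  have eI: "e \<in> I" unfolding e_def using x(1) mr(2) by (rule Is(4))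
  have ec: "e \<in> carrier R" using eI by (rule Is(1))
  have mc: "m \<in> carrier R" using mr(1) by (rule right_ideal_carr[OF MD(1)])
  have one: "m \<oplus> e = \<one>" using mr(3) by (simp add: e_def)
  have ey: "e \<otimes> y = y" if y: "y \<in> I" for y
  proof -
    have yc: "y \<in> carrier R" using y by (rule Is(1))
    have "(m \<oplus> e) \<otimes> y = y" unfolding one using yc by simp
    then have s: "e \<otimes> y \<oplus> m \<otimes> y = y" using mc ec yc by (simp add: l_distr a_comm)
    then have "y \<ominus> e \<otimes> y = m \<otimes> y" using add_minus_cancel[of "e \<otimes> y" "m \<otimes> y"] mc ec yc by simp
    moreover have "y \<ominus> e \<otimes> y \<in> I" using y eI yc by (intro Is(6) Is(4))
    moreover have "m \<otimes> y \<in> M" using mr(1) yc by (rule right_ideal_mult[OF MD(1)])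
    ultimately have "m \<otimes> y = \<zero>" using \<open>I \<inter> M = {\<zero>}\<close> by auto
    then show ?thesis using s ec yc by simp
  qed
  show ?thesis
    unfolding extends_from_def
  proof (intro allI impI)
    fix f assume f: "linear_on R I f"
    have "f y = f e \<otimes> y" if y: "y \<in> I" for y
    proof -
      have "f (e \<otimes> y) = f e \<otimes> y" using f eI Is(1)[OF y] by (simp add: linear_on_def)
      then show ?thesis using ey[OF y] by simp
    qed
    moreover have "f e \<in> carrier R" using f eI by (simp add: linear_on_def)
    ultimately show "\<exists>c\<in>carrier R. \<forall>x\<in>I. f x = c \<otimes> x" by blast
  qed
qed

text \<open>Schur's lemma: left multiplication by \<open>c\<close> is injective on the simple module
  \<open>x R\<close>, so it carries it to an isomorphic one.\<close>

lemma minimal_left_mult: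
  assumes x: "x \<in> carrier R" and min: "minimal_right_ideal R (rPIdl x)"
    and c: "c \<in> carrier R" "c \<otimes> x \<noteq> \<zero>"
  shows "\<And>r. r \<in> carrier R \<Longrightarrow> c \<otimes> x \<otimes> r = \<zero> \<Longrightarrow> x \<otimes> r = \<zero>"
    "minimal_right_ideal R (rPIdl (c \<otimes> x))"
proof -
  have px: "right_ideal R (rPIdl x)" using x by (rule right_ideal_rPIdl)
  note Ps = right_ideal_simps[OF px]
  have mn: "K = {\<zero>} \<or> K = rPIdl x" if "right_ideal R K" "K \<subseteq> rPIdl x" for K
    using min that by (auto simp: minimal_right_ideal_def)
  have pre: "right_ideal R (rPIdl x \<inter> {y \<in> carrier R. c \<otimes> y \<in> K})" if "right_ideal R K" for K
    using px right_ideal_preimage[OF that c(1)] by (rule right_ideal_Int)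
  have xp: "x \<in> rPIdl x" using x by (rule rPIdl_mem)
  show inj: "x \<otimes> r = \<zero>" if r: "r \<in> carrier R" "c \<otimes> x \<otimes> r = \<zero>" for r
  proof -
    let ?K = "rPIdl x \<inter> {y \<in> carrier R. c \<otimes> y \<in> {\<zero>}}"
    have "x \<notin> ?K" using c(2) by simp
    then have "?K = {\<zero>}" using mn[OF pre[OF right_ideal_trivial]] xp by blast
    moreover have "x \<otimes> r \<in> ?K" using r x c(1) Ps(4)[OF xp r(1)] by (simp add: m_assoc)
    ultimately show ?thesis by blast
  qed
  have cxc: "c \<otimes> x \<in> carrier R" using c(1) x by simp
  show "minimal_right_ideal R (rPIdl (c \<otimes> x))"
    unfolding minimal_right_ideal_def
  proof (intro conjI allI impI)
    show "right_ideal R (rPIdl (c \<otimes> x))" using cxc by (rule right_ideal_rPIdl)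
    show "rPIdl (c \<otimes> x) \<noteq> {\<zero>}" using rPIdl_mem[OF cxc] c(2) by blast
    fix K assume K: "right_ideal R K \<and> K \<subseteq> rPIdl (c \<otimes> x)"
    let ?K = "rPIdl x \<inter> {y \<in> carrier R. c \<otimes> y \<in> K}"
    show "K = {\<zero>} \<or> K = rPIdl (c \<otimes> x)"
    proof (cases "K = {\<zero>}")
      case False
      then obtain k where k: "k \<in> K" "k \<noteq> \<zero>" using right_ideal_zero K by blast
      then obtain r where r: "r \<in> carrier R" "k = c \<otimes> x \<otimes> r" using K by (auto simp: rPIdl_def)
      have "x \<otimes> r \<in> ?K" using r k x c(1) Ps(4)[OF xp r(1)] by (simp add: m_assoc)
      moreover have "x \<otimes> r \<noteq> \<zero>" using r k x c(1) by (auto simp: m_assoc)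
      ultimately have "?K = rPIdl x" using mn[of ?K] pre[of K] K by blast
      then have "c \<otimes> x \<in> K" using xp by blast
      then have "rPIdl (c \<otimes> x) \<subseteq> K" using K by (intro rPIdl_le) simp_all
      then show ?thesis using K by blast
    qed simp
  qed
qed

text \<open>If \<open>a\<close> does not kill \<open>x\<close>, then \<open>a x \<mapsto> x\<close>
  is a homomorphism on a minimal right ideal, so \<open>x = d a x\<close> for some \<open>d\<close>.
  A left ideal containing \<open>l(x)\<close> and \<open>a\<close> thus contains
  \<open>1 - d a\<close> and \<open>d a\<close>.\<close>

lemma maximal_left_of_minimal:
  assumes inj: "right_small_injective R" and x: "x \<in> carrier R" and min: "minimal_right_ideal R (rPIdl x)"
  shows "maximal_right_ideal (opp_ring R) (lann R {x})"
  unfolding maximal_right_ideal_def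
proof (intro conjI allI impI)
  interpret op: ring "opp_ring R" by (rule ring_opp)
  show "right_ideal (opp_ring R) (lann R {x})" using x by (intro left_ideal_lann) simp
  have "x \<noteq> \<zero>"
  proof
    assume "x = \<zero>"
    then have "rPIdl x = {\<zero>}" by (auto simp: rPIdl_def)
    then show False using min by (simp add: minimal_right_ideal_def)
  qed
  then have "\<one> \<notin> lann R {x}" using x by (simp add: lann_mem)
  then show "lann R {x} \<noteq> carrier (opp_ring R)" by auto
  fix L assume L: "right_ideal (opp_ring R) L \<and> lann R {x} \<subseteq> L"
  then have LR: "right_ideal (opp_ring R) L" by simp
  note Ls = left_ideal_simps[OF LR]
  show "L = lann R {x} \<or> L = carrier (opp_ring R)"
  proof (cases "L \<subseteq> lann R {x}")
    case False
    then obtain a where a: "a \<in> L" "a \<notin> lann R {x}" by blast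
    have ac: "a \<in> carrier R" using a(1) by (rule Ls(1))
    have ax: "a \<otimes> x \<noteq> \<zero>" using a(2) ac by (simp add: lann_mem)
    note m = minimal_left_mult[OF x min ac ax]
    obtain d where d: "d \<in> carrier R" "x = d \<otimes> (a \<otimes> x)"
      using extends_principal[OF minimal_extends[OF inj m(2)], of x] m(1) ac x by auto
    have "(\<one> \<ominus> d \<otimes> a) \<otimes> x = x \<ominus> d \<otimes> (a \<otimes> x)" using d(1) ac x by (simp add: l_distr_minus m_assoc)
    also have "\<dots> = \<zero>" using d x ac eq_iff_minus_zero[of x "d \<otimes> (a \<otimes> x)"] by simp
    finally have "\<one> \<ominus> d \<otimes> a \<in> L" using L d(1) ac by (auto simp: lann_mem)
    then have "(\<one> \<ominus> d \<otimes> a) \<oplus> d \<otimes> a \<in> L" using a(1) d(1) by (intro Ls(3) Ls(4))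
    then have "\<one> \<in> L" using d(1) ac by (simp add: minus_add_cancel)
    then show ?thesis using op.right_ideal_one[OF LR] by simp
  qed (use L in blast)
qed

lemma singular_J_of_ACC:
  assumes A: "ACC (right_annihilator R)" and z: "z \<in> carrier R"
    and sing: "\<And>K. right_ideal R K \<Longrightarrow> K \<noteq> {\<zero>} \<Longrightarrow> \<exists>k\<in>K. k \<noteq> \<zero> \<and> z \<otimes> k = \<zero>"
  shows "z \<in> J"
proof -
  interpret op: ring "opp_ring R" by (rule ring_opp)
  have "\<exists>v\<in>carrier R. v \<otimes> (\<one> \<ominus> c \<otimes> z) = \<one>" if c: "c \<in> carrier R" for c
  proof -
    define y where "y = c \<otimes> z"
    have yc: "y \<in> carrier R" using c z by (simp add: y_def)
    have ySuc: "y [^] Suc n = y \<otimes> y [^] n" for n :: nat using yc by (rule nat_pow_Suc2)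
    have "\<exists>N. \<forall>n\<ge>N. rann R {y [^] (n :: nat)} = rann R {y [^] N}"
    proof (rule ACC_stable[OF A])
      show "right_annihilator R (rann R {y [^] n})" for n :: nat using yc by (intro right_annihilator_rann) simp
      show "rann R {y [^] n} \<subseteq> rann R {y [^] Suc n}" for n :: nat
        unfolding ySuc using yc by (auto simp: rann_mem m_assoc)
    qed
    then obtain N :: nat where N: "\<forall>n\<ge>N. rann R {y [^] n} = rann R {y [^] N}" by blast
    have "y [^] N = \<zero>"
    proof (rule ccontr)
      assume n0: "y [^] N \<noteq> \<zero>"
      have pc: "y [^] N \<in> carrier R" using yc by simp
      have "rPIdl (y [^] N) \<noteq> {\<zero>}" using n0 rPIdl_mem[OF pc] by blast
      then obtain k where k: "k \<in> rPIdl (y [^] N)" "k \<noteq> \<zero>" "z \<otimes> k = \<zero>"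
        using sing right_ideal_rPIdl[OF pc] by blast
      then obtain t where t: "t \<in> carrier R" "k = y [^] N \<otimes> t" by (auto simp: rPIdl_def)
      have kc: "k \<in> carrier R" using t pc by simp
      have "y [^] Suc N \<otimes> t = y \<otimes> k" unfolding ySuc using t yc pc by (simp add: m_assoc)
      also have "\<dots> = \<zero>" using k(3) c z kc by (simp add: y_def m_assoc)
      finally have "t \<in> rann R {y [^] Suc N}" using t(1) by (simp add: rann_mem)
      moreover have "rann R {y [^] Suc N} = rann R {y [^] N}" by (rule N[rule_format]) simp
      ultimately have "t \<in> rann R {y [^] N}" by blast
      then show False using k(2) t(2) by (simp add: rann_mem)
    qed
    \<comment> \<open>The geometric series.\<close>
    moreover have "\<exists>v\<in>carrier R. v \<otimes> (\<one> \<ominus> y) = \<one> \<ominus> y [^] n" for n :: nat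
    proof (induction n)
      case 0
      show ?case using yc by (intro bexI[of _ \<zero>]) (simp_all add: a_minus_def r_neg)
    next
      case (Suc n)
      then obtain v where v: "v \<in> carrier R" "v \<otimes> (\<one> \<ominus> y) = \<one> \<ominus> y [^] n" by blast
      have pc: "y [^] n \<in> carrier R" using yc by simp
      have "(v \<oplus> y [^] n) \<otimes> (\<one> \<ominus> y) = (\<one> \<ominus> y [^] n) \<oplus> (y [^] n \<ominus> y [^] n \<otimes> y)"
        unfolding v(2)[symmetric] using v(1) yc pc r_distr_minus[of \<one> y "y [^] n"]
        by (simp add: l_distr)
      also have "\<dots> = \<one> \<ominus> y [^] Suc n" using pc yc by (simp add: minus_trans)
      finally show ?case using v(1) pc by blast
    qed
    ultimately obtain v where "v \<in> carrier R" "v \<otimes> (\<one> \<ominus> y) = \<one> \<ominus> \<zero>" by metis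
    then show ?thesis by (auto simp: y_def a_minus_def)
  qed
  then show ?thesis using z op.J_iff_right_inverse[of z] by simp
qed

text \<open>
  By the chain condition some finite set \<open>F\<close> of generators of minimal right ideals has
  \<open>r(l(F))\<close> containing the socle. Then \<open>l(F)\<close> is singular, hence inside \<open>J\<close>, and it is an
  intersection of finitely many maximal left ideals.
\<close>

lemma radical_split_of_essential_socle:
  assumes inj: "right_small_injective R" and A: "ACC (right_annihilator R)"
    and ess: "essential_right_ideal R (right_socle R)"
  shows "radical_split R"
proof -
  interpret op: ring "opp_ring R" by (rule ring_opp)
  define G where "G = {x \<in> carrier R. minimal_right_ideal R (rPIdl x)}"
  define Q where "Q B \<longleftrightarrow> (\<exists>F. finite F \<and> F \<subseteq> G \<and> B = rann R (lann R F))" for B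
  have lc: "lann R X \<subseteq> carrier R" for X by (auto simp: lann_mem)
  have ra: "right_annihilator R (rann R (lann R F))" for F using lc by (rule right_annihilator_rann)
  have "Q (rann R (lann R {}))" unfolding Q_def by (intro exI[of _ "{}"]) simp
  then obtain B where B: "Q B" "\<And>C. right_annihilator R C \<Longrightarrow> Q C \<Longrightarrow> B \<subseteq> C \<Longrightarrow> C = B"
    using ACC_maximal[OF A ra] by metis
  obtain F where F: "finite F" "F \<subseteq> G" "B = rann R (lann R F)" using B(1) unfolding Q_def by blast
  have GB: "x \<in> B" if x: "x \<in> G" for x
  proof -
    let ?C = "rann R (lann R (insert x F))"
    have "Q ?C" unfolding Q_def using F(1,2) x by blast
    moreover have "B \<subseteq> ?C" unfolding F(3) by (intro rann_antimono lann_antimono) blast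
    ultimately have "?C = B" using B(2) ra by blast
    moreover have "insert x F \<subseteq> carrier R" using x F(2) by (auto simp: G_def)
    then have "x \<in> ?C" using rann_lann_ge by blast
    ultimately show ?thesis by simp
  qed
  have BR: "right_ideal R B" unfolding F(3) using lc by (rule right_ideal_rann)
  have minB: "T \<subseteq> B" if T: "minimal_right_ideal R T" for T
  proof
    fix x assume x: "x \<in> T"
    have TR: "right_ideal R T" and Tm: "\<And>K. right_ideal R K \<Longrightarrow> K \<subseteq> T \<Longrightarrow> K = {\<zero>} \<or> K = T"
      using T by (auto simp: minimal_right_ideal_def)
    have xc: "x \<in> carrier R" using right_ideal_carr[OF TR x] .
    show "x \<in> B"
    proof (cases "x = \<zero>")
      case True then show ?thesis using right_ideal_zero[OF BR] by simp
    next
      case False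
      have "rPIdl x = {\<zero>} \<or> rPIdl x = T" using Tm[OF right_ideal_rPIdl[OF xc] rPIdl_le[OF TR x]] .
      then have "rPIdl x = T" using False rPIdl_mem[OF xc] by blast
      then show ?thesis using T xc by (intro GB) (simp add: G_def)
    qed
  qed
  then have SB: "right_socle R \<subseteq> B" using BR unfolding right_socle_def by blast
  have "lann R F \<subseteq> J"
  proof
    fix z assume z: "z \<in> lann R F"
    show "z \<in> J"
    proof (rule singular_J_of_ACC[OF A])
      show "z \<in> carrier R" using z lc by blast
      fix K assume K: "right_ideal R K" "K \<noteq> {\<zero>}"
      then have "right_socle R \<inter> K \<noteq> {\<zero>}" using ess unfolding essential_right_ideal_def by blast
      moreover have "\<zero> \<in> right_socle R \<inter> K"
        using ess right_ideal_zero K(1) by (simp add: essential_right_ideal_def)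
      ultimately obtain k where k: "k \<in> right_socle R" "k \<in> K" "k \<noteq> \<zero>" by blast
      have "k \<in> rann R (lann R F)" using k(1) SB F(3) by blast
      then have "z \<otimes> k = \<zero>" using z unfolding rann_mem by blast
      then show "\<exists>k\<in>K. k \<noteq> \<zero> \<and> z \<otimes> k = \<zero>" using k by blast
    qed
  qed
  moreover have "carrier R \<inter> \<Inter>((\<lambda>x. lann R {x}) ` F) \<subseteq> lann R F" by (auto simp: lann_mem)
  ultimately have sub: "carrier R \<inter> \<Inter>((\<lambda>x. lann R {x}) ` F) \<subseteq> J" by blast
  \<comment> \<open>The maximal ideals at hand are left ideals, so the splitting is obtained on the
    left and transferred.\<close>
  have "radical_split (opp_ring R)"
  proof (rule op.radical_split_of_finite_Inter)
    show "finite ((\<lambda>x. lann R {x}) ` F)" using F(1) by simp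
    show "maximal_right_ideal (opp_ring R) M" if "M \<in> (\<lambda>x. lann R {x}) ` F" for M
      using that F(2) maximal_left_of_minimal[OF inj] by (auto simp: G_def)
    show "carrier (opp_ring R) \<inter> \<Inter>((\<lambda>x. lann R {x}) ` F) \<subseteq> op.J" using sub by simp
  qed
  then show ?thesis by (simp add: radical_split_opp_iff)
qed

text \<open>
  If \<open>x(1 - x)\<close> is nilpotent, suitable powers \<open>a\<close> of \<open>x\<close> and \<open>b\<close> of \<open>1 - x\<close> are orthogonal, and
  \<open>u = a + b\<close> is a unit congruent to 1; the idempotent is \<open>u\<^sup>-\<^sup>1 a\<close>.
\<close>

lemma idempotents_lift_of_nilpotent:
  assumes nil: "J_nilpotent R"
  shows "idempotents_lift R J"
  unfolding idempotents_lift_def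
proof (intro ballI impI)
  fix x assume x: "x \<in> carrier R" and xx: "x \<otimes> x \<ominus> x \<in> J"
  obtain n0 where n0: "J_prods R n0 \<subseteq> {\<zero>}" using nil by (auto simp: J_nilpotent_def)
  \<comment> \<open>The exponent must be positive, because the powers of \<open>x\<close> are
    congruent to \<open>x\<close> only from the first one on.\<close>
  let ?n = "Suc n0"
  have n: "p = \<zero>" if "p \<in> J_prods R ?n" for p
    using that n0 J_carr by auto
  have cx: "cong (x \<otimes> x) x" using x xx by (simp add: cong_def)
  define y where "y = \<one> \<ominus> x"
  have yc: "y \<in> carrier R" using x by (simp add: y_def)
  have xy: "x \<otimes> y = x \<ominus> x \<otimes> x" and yx: "y \<otimes> x = x \<ominus> x \<otimes> x"
    using x by (simp_all add: y_def l_distr_minus r_distr_minus)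
  have xyJ: "x \<otimes> y \<in> J" unfolding xy using cong_sym[OF cx] by (simp add: cong_def)
  have "y \<otimes> y = y \<ominus> x \<otimes> y" using x yc by (metis l_distr_minus l_one one_closed y_def)
  moreover have "cong (y \<ominus> x \<otimes> y) (y \<ominus> \<zero>)"
    using xyJ yc by (intro cong_minus cong_refl) (simp_all add: cong_zero)
  ultimately have cy: "cong (y \<otimes> y) y" using yc by (simp add: a_minus_def)
  have pow: "cong (z [^] Suc m) z" if z: "z \<in> carrier R" "cong (z \<otimes> z) z" for z and m :: nat
  proof (induction m)
    case 0 then show ?case using z by (simp add: cong_refl)
  next
    case (Suc m)
    have "cong (z [^] Suc m \<otimes> z) (z \<otimes> z)" using Suc z by (intro cong_mult cong_refl)
    also have "cong \<dots> z" by (rule z(2))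
    finally show ?case using z by simp
  qed
  define a where "a = x [^] ?n"
  define b where "b = y [^] ?n"
  have ac: "a \<in> carrier R" and bc: "b \<in> carrier R" using x yc by (simp_all add: a_def b_def)
  have powJ: "(x \<otimes> y) [^] m \<in> J_prods R m" for m :: nat
  proof (induction m)
    case (Suc m)
    have "(x \<otimes> y) [^] Suc m = (x \<otimes> y) [^] m \<otimes> (x \<otimes> y)" by simp
    then show ?case unfolding J_prods_Suc2 using Suc xyJ by blast
  qed simp
  have ab: "a \<otimes> b = \<zero>"
    using pow_mult_distrib[of x y ?n] x yc xy yx n[OF powJ] by (simp add: a_def b_def del: nat_pow_Suc)
  have ba: "b \<otimes> a = \<zero>"
    using pow_mult_distrib[of y x ?n] x yc xy yx n[OF powJ] by (simp add: a_def b_def del: nat_pow_Suc)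
  define u where "u = a \<oplus> b"
  have uc: "u \<in> carrier R" using ac bc by (simp add: u_def)
  have ax: "cong a x" and "cong b y" using pow[OF x cx, of n0] pow[OF yc cy, of n0] by (simp_all add: a_def b_def)
  then have "cong u (x \<oplus> y)" unfolding u_def by (rule cong_add)
  then have u1: "cong u \<one>" using x by (simp add: y_def add_minus_minus)
  obtain v where v: "v \<in> carrier R" "u \<otimes> v = \<one>" "v \<otimes> u = \<one>" "cong v \<one>"
    using cong_inverse_one[OF uc u1] by blast
  have ua: "u \<otimes> a = a \<otimes> a" and au: "a \<otimes> u = a \<otimes> a"
    using ac bc ab ba by (simp_all add: u_def l_distr r_distr)
  have "v \<otimes> (a \<otimes> u) \<otimes> v = v \<otimes> (u \<otimes> a) \<otimes> v" using ua au by simp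
  then have "v \<otimes> a \<otimes> (u \<otimes> v) = (v \<otimes> u) \<otimes> (a \<otimes> v)" using ac uc v(1) by (simp add: m_assoc)
  then have va: "v \<otimes> a = a \<otimes> v" using v ac by simp
  define e where "e = v \<otimes> a"
  have ec: "e \<in> carrier R" using v(1) ac by (simp add: e_def)
  have "e \<otimes> e = v \<otimes> (a \<otimes> a) \<otimes> v" unfolding e_def using va v(1) ac by (metis m_assoc m_closed)
  also have "\<dots> = (v \<otimes> u) \<otimes> (a \<otimes> v)" using ua v(1) uc ac by (metis m_assoc m_closed)
  also have "\<dots> = e" using v ac va by (simp add: e_def)
  finally have ee: "e \<otimes> e = e" .
  have "cong (v \<otimes> a) (\<one> \<otimes> x)" using v(4) ax by (rule cong_mult)
  then have "e \<ominus> x \<in> J" using x by (simp add: e_def cong_def)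
  then show "\<exists>e\<in>carrier R. e \<otimes> e = e \<and> e \<ominus> x \<in> J" using ec ee by blast
qed

section \<open>Passage between \<open>QF_ring\<close>, the listed conditions and the quasi-Frobenius
  property\<close>

lemma essential_socle_of_DCC:
  assumes D: "DCC (right_ideal R)"
  shows "essential_right_ideal R (right_socle R)"
  unfolding essential_right_ideal_def
proof (intro conjI allI impI)
  let ?F = "{I. right_ideal R I \<and> (\<forall>S. minimal_right_ideal R S \<longrightarrow> S \<subseteq> I)}"
  have "carrier R \<in> ?F"
    using right_ideal_carrier right_ideal_subset by (auto simp: minimal_right_ideal_def)
  then have eq: "right_socle R = carrier R \<inter> \<Inter>?F" unfolding right_socle_def by blast
  show "right_ideal R (right_socle R)" unfolding eq by (rule right_ideal_Inter) simp
  fix K assume "right_ideal R K \<and> K \<noteq> {\<zero>}"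
  then have K: "right_ideal R K" "K \<noteq> {\<zero>} \<and> K \<subseteq> K" by auto
  obtain T where T: "right_ideal R T" "T \<noteq> {\<zero>} \<and> T \<subseteq> K"
    "\<And>C. right_ideal R C \<Longrightarrow> C \<noteq> {\<zero>} \<and> C \<subseteq> K \<Longrightarrow> C \<subseteq> T \<Longrightarrow> C = T"
    using DCC_minimal[OF D K(1), of "\<lambda>T. T \<noteq> {\<zero>} \<and> T \<subseteq> K", OF K(2)] by blast
  have "minimal_right_ideal R T"
    unfolding minimal_right_ideal_def
  proof (intro conjI allI impI)
    fix C assume "right_ideal R C \<and> C \<subseteq> T"
    then show "C = {\<zero>} \<or> C = T" using T(2) T(3)[of C] by blast
  qed (use T in auto)
  then have "T \<subseteq> right_socle R" unfolding right_socle_def by blast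
  then have "T \<subseteq> right_socle R \<inter> K" using T(2) by blast
  moreover have "\<not> T \<subseteq> {\<zero>}" using T(2) right_ideal_zero[OF T(1)] by blast
  ultimately show "right_socle R \<inter> K \<noteq> {\<zero>}" by auto
qed

lemma semiregular_of_QF_ring: "QF_ring \<Longrightarrow> semiregular R"
proof -
  assume Q: QF_ring
  have "\<exists>y\<in>carrier R. cong (x \<otimes> y \<otimes> x) x" if "x \<in> carrier R" for x
  proof -
    have "radical_split R" using Q by (simp add: QF_ring_def)
    from radical_split_regular[OF this that] show ?thesis using cong_sym by metis
  qed
  then show ?thesis
    using Q idempotents_lift_of_nilpotent by (simp add: semiregular_def von_Neumann_regular_quot QF_ring_def)
qed

text \<open>In the left artinian case taking left annihilators, which is injective on right
  annihilators, turns ascending chains of these into descending chains of left ideals.\<close>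

lemma QF_ring_of_artinian:
  assumes baer: "right_baer R" and art: "left_artinian R \<or> right_artinian R"
  shows QF_ring
proof -
  interpret op: ring "opp_ring R" by (rule ring_opp)
  from art show ?thesis
  proof
    assume "right_artinian R"
    then have "radical_split R" "DCC (right_ideal R)"
      using radical_split_of_right_artinian by (auto simp: right_artinian_def)
    moreover from this(2) have "DCC (right_annihilator R)" by (rule DCC_mono) (rule right_annihilator_ideal)
    ultimately show ?thesis using QF_ring_of_DCC baer by blast
  next
    assume "left_artinian R"
    then have r: "right_artinian (opp_ring R)" by (simp add: left_artinian_def)
    then have S: "radical_split R"
      using op.radical_split_of_right_artinian radical_split_opp_iff by blast
    have D: "DCC (right_ideal (opp_ring R))" using r by (simp add: right_artinian_def)
    have "ACC (right_annihilator R)"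
      unfolding ACC_def
    proof (intro allI impI)
      fix A :: "nat \<Rightarrow> 'a set" assume A: "\<forall>n. right_annihilator R (A n) \<and> A n \<subseteq> A (Suc n)"
      have "\<exists>N. \<forall>n\<ge>N. lann R (A n) = lann R (A N)"
      proof (rule DCC_stable[OF D])
        show "right_ideal (opp_ring R) (lann R (A n))" for n
          using A right_ideal_subset[OF right_annihilator_ideal] by (intro left_ideal_lann) blast
        show "lann R (A (Suc n)) \<subseteq> lann R (A n)" for n using A by (intro lann_antimono) blast
      qed
      moreover have "rann R (lann R (A n)) = A n" for n
      proof -
        obtain X where "X \<subseteq> carrier R" "A n = rann R X" using A unfolding right_annihilator_iff by blast
        then show ?thesis using rann_lann_rann by simp
      qed
      ultimately show "\<exists>N. \<forall>n\<ge>N. A n = A N" by metis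
    qed
    then show ?thesis using QF_ring_of_ACC[OF S baer] by blast
  qed
qed

text \<open>Two of the four combinations are handled by \<open>QF_ring_of_artinian\<close>, the
  other two by the same result in the opposite ring.\<close>

lemma quasi_Frobenius_iff: "quasi_Frobenius TYPE('a + 'c) R \<longleftrightarrow> QF_ring"
proof
  interpret op: ring "opp_ring R" by (rule ring_opp)
  assume q: "quasi_Frobenius TYPE('a + 'c) R"
  then consider "right_self_injective TYPE('a + 'c) R" | "right_self_injective TYPE('a + 'c) (opp_ring R)"
    by (auto simp: quasi_Frobenius_def left_self_injective_def)
  then show QF_ring
  proof cases
    case 1
    then have "right_baer R" by (rule baer_of_injective)
    then show ?thesis using QF_ring_of_artinian q by (simp add: quasi_Frobenius_def)
  next
    case 2
    then have "right_baer (opp_ring R)" by (rule op.baer_of_injective)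
    moreover have "left_artinian (opp_ring R) \<or> right_artinian (opp_ring R)"
      using q by (auto simp: quasi_Frobenius_def left_artinian_def)
    ultimately have "op.QF_ring" by (rule op.QF_ring_of_artinian)
    then show ?thesis by (simp add: QF_ring_opp)
  qed
next
  assume QF_ring
  then have "right_artinian R" "right_baer R" by (simp_all add: QF_ring_def right_artinian_def)
  then show "quasi_Frobenius TYPE('a + 'c) R" using injective_of_baer by (auto simp: quasi_Frobenius_def)
qed

end

theorem theorem3p8:
  fixes R :: "('a, 'r) ring_scheme"
  assumes "ring R"
  shows
    "(quasi_Frobenius TYPE('a + 'b) R \<longleftrightarrow>
        right_perfect R \<and> right_small_injective R \<and> left_small_injective R) \<and>
     (quasi_Frobenius TYPE('a + 'b) R \<longleftrightarrow>
        left_perfect R \<and> right_small_injective R \<and> left_small_injective R) \<and>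
     (quasi_Frobenius TYPE('a + 'b) R \<longleftrightarrow>
        semilocal R \<and> right_small_injective R \<and> ACC (right_annihilator R)) \<and>
     (quasi_Frobenius TYPE('a + 'b) R \<longleftrightarrow>
        semilocal R \<and> right_small_injective R \<and> DCC (right_annihilator R)) \<and>
     (quasi_Frobenius TYPE('a + 'b) R \<longleftrightarrow>
        right_small_injective R \<and> ACC (right_annihilator R) \<and>
        essential_right_ideal R (right_socle R)) \<and>
     (quasi_Frobenius TYPE('a + 'b) R \<longleftrightarrow>
        semiregular R \<and> right_small_injective R \<and> ACC (right_annihilator R))"
proof -
  interpret ring R by fact
  interpret op: ring "opp_ring R" by (rule ring_opp)
  note q = quasi_Frobenius_iff[where 'c = 'b]
  have S: "radical_split R" "radical_split (opp_ring R)" and nil: "J_nilpotent R"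
    and inj: "right_small_injective R" "left_small_injective R"
    and AD: "ACC (right_annihilator R)" "DCC (right_annihilator R)" and D: "DCC (right_ideal R)"
    if Q: QF_ring
  proof -
    show "radical_split R" "J_nilpotent R" "DCC (right_ideal R)" using Q by (simp_all add: QF_ring_def)
    then show "radical_split (opp_ring R)" by (simp add: radical_split_opp)
    show "right_small_injective R" using Q right_small_injective_of_baer by (simp add: QF_ring_def)
    show "left_small_injective R"
      using Q op.right_small_injective_of_baer by (simp add: QF_ring_def left_small_injective_def)
    have "ACC (right_ideal R)" using Q by (simp add: QF_ring_def)
    then show "ACC (right_annihilator R)" by (rule ACC_mono) (rule right_annihilator_ideal)
    show "DCC (right_annihilator R)"
      using \<open>DCC (right_ideal R)\<close> by (rule DCC_mono) (rule right_annihilator_ideal)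
  qed
  have of_ACC: QF_ring if "radical_split R" "right_small_injective R" "ACC (right_annihilator R)"
    using QF_ring_of_ACC[OF that(1) baer_of_small_injective[OF that(1,2)] that(3)] .
  have of_DCC: QF_ring if "radical_split R" "right_small_injective R" "DCC (right_annihilator R)"
    using QF_ring_of_DCC[OF that(1) baer_of_small_injective[OF that(1,2)] that(3)] .
  have perfR: "QF_ring \<longleftrightarrow> right_perfect R \<and> right_small_injective R \<and> left_small_injective R"
  proof
    assume Q: QF_ring
    then show "right_perfect R \<and> right_small_injective R \<and> left_small_injective R"
      using S nil inj right_T_nilpotent_of_nilpotent by (simp add: right_perfect_def semilocal_iff)
  next
    assume h: "right_perfect R \<and> right_small_injective R \<and> left_small_injective R"
    then have s: "radical_split R" "right_T_nilpotent R J" by (simp_all add: right_perfect_def semilocal_iff)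
    have "right_baer R" using h by (intro baer_of_small_injective s) simp
    moreover have "right_baer (opp_ring R)"
      using h by (intro op.baer_of_small_injective radical_split_opp s) (simp add: left_small_injective_def)
    ultimately show QF_ring using QF_ring_of_perfect s by blast
  qed
  have perfL: "QF_ring \<longleftrightarrow> left_perfect R \<and> right_small_injective R \<and> left_small_injective R"
  proof
    assume Q: QF_ring
    then show "left_perfect R \<and> right_small_injective R \<and> left_small_injective R"
      using S nil inj op.right_T_nilpotent_of_nilpotent
      by (simp add: left_perfect_def right_perfect_def op.semilocal_iff)
  next
    assume h: "left_perfect R \<and> right_small_injective R \<and> left_small_injective R"
    then have s: "radical_split R" "right_T_nilpotent (opp_ring R) J"
      by (simp_all add: left_perfect_def right_perfect_def op.semilocal_iff radical_split_opp_iff)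
    have "right_baer R" using h by (intro baer_of_small_injective s) simp
    moreover have "right_baer (opp_ring R)"
      using h by (intro op.baer_of_small_injective radical_split_opp s) (simp add: left_small_injective_def)
    \<comment> \<open>The left perfect case is the right perfect case of the opposite ring.\<close>
    ultimately have "op.QF_ring"
      using op.QF_ring_of_perfect radical_split_opp[OF s(1)] s(2) by simp
    then show QF_ring by (simp add: QF_ring_opp)
  qed
  have acc: "QF_ring \<longleftrightarrow> semilocal R \<and> right_small_injective R \<and> ACC (right_annihilator R)"
    using S inj AD of_ACC by (auto simp: semilocal_iff)
  have dcc: "QF_ring \<longleftrightarrow> semilocal R \<and> right_small_injective R \<and> DCC (right_annihilator R)"
    using S inj AD of_DCC by (auto simp: semilocal_iff)
  have socle: "QF_ring \<longleftrightarrow> right_small_injective R \<and> ACC (right_annihilator R) \<and>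
      essential_right_ideal R (right_socle R)"
    using inj AD D of_ACC radical_split_of_essential_socle essential_socle_of_DCC by blast
  have semireg: "QF_ring \<longleftrightarrow> semiregular R \<and> right_small_injective R \<and> ACC (right_annihilator R)"
    using inj AD of_ACC radical_split_of_semiregular semiregular_of_QF_ring by blast
  show ?thesis unfolding q using perfR perfL acc dcc socle semireg by (intro conjI)
qed

end
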